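(* Let $q$ be any positive integer. Then $$(\mathfrak{g}_{\mathbb{R}},\mathfrak{q}')=\bigl(\mathfrak{su}_2\oplus V^{\mathbb{R}}_{2q\omega},\ \mathfrak{b}\oplus V^{-}_{2q\omega}\bigr)$$ is the CR algebra of a homogeneous CR manifold $E_{2q}$, of CR dimension $q+1$ and CR codimension $1$, which is fundamental and weakly nondegenerate of Levi order $q$.
   Context: Let $\mathfrak{h}\subset\mathfrak{sl}_2(\mathbb{C})$ be the diagonal Cartan subalgebra, $\alpha=e_1-e_2$ the root whose root space consists of strictly upper triangular matrices, $\omega=\alpha/2$ the fundamental weight, and $\mathfrak{b}=\mathfrak{h}\oplus\mathfrak{sl}_2(\mathbb{C})^{-\alpha}$ the Borel subalgebra of lower triangular matrices. The conjugation of $\mathfrak{sl}_2(\mathbb{C})$ is $X\mapsto -X^*$, with fixed points $\mathfrak{su}_2$. For $k\ge0$, $V_{k\omega}$ is the irreducible $\mathfrak{sl}_2(\mathbb{C})$-module of complex homogeneous polynomials $\sum_{h=0}^k a_hz^hw^{k-h}$ of degree $k$ in $z,w$ (the differential of the action $(g\cdot f)(v)=f(g^{-1}v)$ of $\mathbf{SL}_2(\mathbb{C})$), with weight spaces $V_{k\omega}^{(k-2h)\omega}=\mathbb{C}\,z^hw^{k-h}$ for $0\le h\le k$. Put $V^{-}_{k\omega}=\bigoplus_{k<2h\le 2k}V_{k\omega}^{(k-2h)\omega}$, a $\mathfrak{b}$-submodule. For $k$ even, the anti-$\mathbb{C}$-linear map $\theta(\sum a_hz^hw^{k-h})=\sum(-1)^h\bar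 a_h w^hz^{k-h}$ is an $\mathfrak{su}_2$-equivariant involution of $V_{k\omega}$, and $V^{\mathbb{R}}_{k\omega}$ denotes its real subspace of fixed points, a $(k+1)$-dimensional real irreducible $\mathfrak{su}_2$-module whose complexification is $V_{k\omega}$. The direct sums above are semidirect: $\mathfrak{g}_{\mathbb{R}}=\mathfrak{su}_2\oplus V^{\mathbb{R}}_{2q\omega}$ with $V^{\mathbb{R}}_{2q\omega}$ an abelian ideal, and $\mathfrak{q}'=\mathfrak{b}\oplus V^-_{2q\omega}$ is a complex subalgebra of the complexification $\mathfrak{g}=\mathfrak{sl}_2(\mathbb{C})\oplus V_{2q\omega}$. The bar denotes conjugation of $\mathfrak{g}$ with respect to $\mathfrak{g}_{\mathbb{R}}$. A CR algebra is a pair $(\mathfrak{g}_{\mathbb{R}},\mathfrak{q})$ of a real Lie algebra and a complex Lie subalgebra $\mathfrak{q}$ of $\mathfrak{g}=\mathbb{C}\otimes\mathfrak{g}_{\mathbb{R}}$ with $\mathfrak{g}_{\mathbb{R}}/(\mathfrak{g}_{\mathbb{R}}\cap\mathfrak{q})$ finite dimensional. It is the CR algebra of a homogeneous CR manifold $M$ of a Lie group $\mathbf{G}_{\mathbb{R}}$ with Lie algebra $\mathfrak{g}_{\mathbb{R}}$, at a point $x\in M$, if $\mathfrak{q}$ is the preimage of $T^{0,1}_xM$ under the complexified differential $\mathfrak{g}\to T^{\mathbb{C}}_xM$ of the orbit map $g\mapsto g\cdot x$. Here $E_{2q}$ is the homogeneous space $(\mathbf{SU}(2)\ltimes V^{\mathbb{R}}_{2q\omega})/\mathbf{T}$,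 $\mathbf{T}$ being the diagonal torus of $\mathbf{SU}(2)$, with the invariant CR structure determined by $\mathfrak{q}'$; it is a vector bundle over $\mathbb{CP}^1=\mathbf{SU}(2)/\mathbf{T}$. One has CR dimension $=\dim_{\mathbb{C}}\mathfrak{q}-\dim_{\mathbb{C}}(\mathfrak{q}\cap\bar{\mathfrak{q}})$ and CR codimension $=\dim_{\mathbb{C}}\mathfrak{g}-\dim_{\mathbb{C}}(\mathfrak{q}+\bar{\mathfrak{q}})$. Fundamental means that $\mathfrak{q}+\bar{\mathfrak{q}}$ generates $\mathfrak{g}$ as a Lie algebra. With $\mathfrak{q}^{(0)}=\mathfrak{q}$ and $\mathfrak{q}^{(p)}=\{Z\in\mathfrak{q}^{(p-1)}\mid[Z,\bar{\mathfrak{q}}]\subseteq\mathfrak{q}^{(p-1)}+\bar{\mathfrak{q}}\}$ for $p\ge1$, weakly nondegenerate of Levi order $q$ means $\mathfrak{q}^{(q-1)}\supsetneq\mathfrak{q}^{(q)}=\mathfrak{q}\cap\bar{\mathfrak{q}}$. *)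

theory Defs
  imports "HOL-Analysis.Analysis" "HOL-Algebra.Group_Action"
begin

section \<open>Smooth maps, submanifolds and tangent spaces\<close>

primrec Ck_on :: "nat \<Rightarrow> 'a::euclidean_space set \<Rightarrow> ('a \<Rightarrow> 'b::euclidean_space) \<Rightarrow> bool" where
  "Ck_on 0 U f \<longleftrightarrow> continuous_on U f"
| "Ck_on (Suc k) U f \<longleftrightarrow> (\<forall>x\<in>U. f differentiable (at x)) \<and>
     (\<forall>v. Ck_on k U (\<lambda>x. frechet_derivative f (at x) v))"

definition smooth_on :: "'a::euclidean_space set \<Rightarrow> ('a \<Rightarrow> 'b::euclidean_space) \<Rightarrow> bool" where
  "smooth_on U f \<longleftrightarrow> open U \<and> (\<forall>k. Ck_on k U f)"

text \<open>Smoothness of a map on an arbitrary subset of a Euclidean space: existence of local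
  smooth extensions.\<close>

definition smooth_map :: "'a::euclidean_space set \<Rightarrow> ('a \<Rightarrow> 'b::euclidean_space) \<Rightarrow> bool" where
  "smooth_map M f \<longleftrightarrow>
     (\<forall>x\<in>M. \<exists>U h. x \<in> U \<and> smooth_on U h \<and> (\<forall>y\<in>U \<inter> M. h y = f y))"

definition submanifold :: "nat \<Rightarrow> 'a::euclidean_space set \<Rightarrow> bool" where
  "submanifold n M \<longleftrightarrow>
     (\<forall>x\<in>M. \<exists>U V \<Phi> \<Psi> (L :: 'a set). x \<in> U \<and> smooth_on U \<Phi> \<and> smooth_on V \<Psi> \<and>
        homeomorphism U V \<Phi> \<Psi> \<and> subspace L \<and> dim L = n \<and> \<Phi> ` (U \<inter> M) = V \<inter> L)"

definition curve_in :: "'a::euclidean_space set \<Rightarrow> 'a \<Rightarrow> 'a \<Rightarrow> (real \<Rightarrow> 'a) \<Rightarrow> bool" where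
  "curve_in M x v c \<longleftrightarrow>
     (\<exists>e>0. smooth_on {-e<..<e} c \<and> (\<forall>t\<in>{-e<..<e}. c t \<in> M)) \<and>
     c 0 = x \<and> (c has_vector_derivative v) (at 0)"

definition tangent_space :: "'a::euclidean_space set \<Rightarrow> 'a \<Rightarrow> 'a set" where
  "tangent_space M x = {v. \<exists>c. curve_in M x v c}"

text \<open>The differential at \<open>x\<close> of a map defined on \<open>M\<close>, applied to the tangent vector \<open>v\<close>.\<close>

definition mdiff :: "'a::euclidean_space set \<Rightarrow> ('a \<Rightarrow> 'b::euclidean_space) \<Rightarrow> 'a \<Rightarrow> 'a \<Rightarrow> 'b" where
  "mdiff M f x v =
     (THE w. \<forall>c. curve_in M x v c \<longrightarrow> ((\<lambda>t. f (c t)) has_vector_derivative w) (at 0))"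


section \<open>CR manifolds\<close>

text \<open>The complexified tangent space is the set of pairs \<open>(u, v)\<close> of tangent vectors,
  standing for \<open>u + i v\<close>; complex scalars act on pairs as follows.\<close>

definition pscale :: "complex \<Rightarrow> 'a::real_vector \<times> 'a \<Rightarrow> 'a \<times> 'a" where
  "pscale c p = (Re c *\<^sub>R fst p - Im c *\<^sub>R snd p, Re c *\<^sub>R snd p + Im c *\<^sub>R fst p)"

definition pconj :: "'a::real_vector \<times> 'a \<Rightarrow> 'a \<times> 'a" where
  "pconj p = (fst p, - snd p)"

lemma vector_space_pscale: "vector_space (pscale :: complex \<Rightarrow> 'a::real_vector \<times> 'a \<Rightarrow> _)"
  by unfold_locales
    (auto simp: pscale_def algebra_simps scaleR_add_left scaleR_diff_left prod_eq_iff)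

definition complex_dderiv ::
    "('a::euclidean_space \<Rightarrow> 'a \<times> 'a) \<Rightarrow> 'a \<Rightarrow> 'a \<times> 'a \<Rightarrow> 'a \<times> 'a" where
  "complex_dderiv W x \<zeta> = frechet_derivative W (at x) (fst \<zeta>) +
     pscale \<i> (frechet_derivative W (at x) (snd \<zeta>))"

definition vf_bracket ::
    "('a::euclidean_space \<Rightarrow> 'a \<times> 'a) \<Rightarrow> ('a \<Rightarrow> 'a \<times> 'a) \<Rightarrow> 'a \<Rightarrow> 'a \<times> 'a" where
  "vf_bracket Z W x = complex_dderiv W x (Z x) - complex_dderiv Z x (W x)"

text \<open>\<open>T x\<close> is the space of tangent vectors of type \<open>(0,1)\<close> at \<open>x\<close>: a smooth, formally integrable
  complex subbundle of rank \<open>n\<close> of the complexified tangent bundle that meets its conjugate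
  trivially.\<close>

definition cr_manifold ::
    "nat \<Rightarrow> nat \<Rightarrow> 'a::euclidean_space set \<Rightarrow> ('a \<Rightarrow> ('a \<times> 'a) set) \<Rightarrow> bool" where
  "cr_manifold n k M T \<longleftrightarrow> submanifold (2 * n + k) M \<and>
     (\<forall>x\<in>M. T x \<subseteq> tangent_space M x \<times> tangent_space M x \<and>
        module.subspace pscale (T x) \<and> vector_space.dim pscale (T x) = n \<and>
        T x \<inter> pconj ` T x = {0}) \<and>
     (\<forall>x\<in>M. \<forall>\<zeta>\<in>T x. \<exists>U Z. x \<in> U \<and> smooth_on U Z \<and> Z x = \<zeta> \<and> (\<forall>y\<in>U \<inter> M. Z y \<in> T y)) \<and>
     (\<forall>U Z W. smooth_on U Z \<and> smooth_on U W \<and> (\<forall>y\<in>U \<inter> M. Z y \<in> T y \<and> W y \<in> T y) \<longrightarrow>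
        (\<forall>y\<in>U \<inter> M. vf_bracket Z W y \<in> T y))"


section \<open>Lie groups, Lie algebras and homogeneous CR manifolds\<close>

definition lie_group :: "nat \<Rightarrow> ('a::euclidean_space, 'm) monoid_scheme \<Rightarrow> bool" where
  "lie_group n G \<longleftrightarrow> group G \<and> submanifold n (carrier G) \<and>
     smooth_map (carrier G \<times> carrier G) (\<lambda>p. fst p \<otimes>\<^bsub>G\<^esub> snd p) \<and>
     smooth_map (carrier G) (\<lambda>g. inv\<^bsub>G\<^esub> g)"

definition group_Ad :: "('a::euclidean_space, 'm) monoid_scheme \<Rightarrow> 'a \<Rightarrow> 'a \<Rightarrow> 'a" where
  "group_Ad G g Y = mdiff (carrier G) (\<lambda>h. g \<otimes>\<^bsub>G\<^esub> h \<otimes>\<^bsub>G\<^esub> inv\<^bsub>G\<^esub> g) \<one>\<^bsub>G\<^esub> Y"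

text \<open>\<open>A\<close> with the bracket \<open>br\<close> is the Lie algebra of \<open>G\<close>: it is the tangent space at the identity,
  and the bracket is the differential of the adjoint representation.\<close>

definition is_lie_algebra_of ::
    "('a::euclidean_space, 'm) monoid_scheme \<Rightarrow> 'a set \<Rightarrow> ('a \<Rightarrow> 'a \<Rightarrow> 'a) \<Rightarrow> bool" where
  "is_lie_algebra_of G A br \<longleftrightarrow> A = tangent_space (carrier G) \<one>\<^bsub>G\<^esub> \<and>
     (\<forall>X\<in>A. \<forall>Y\<in>A. br X Y = mdiff (carrier G) (\<lambda>g. group_Ad G g Y) \<one>\<^bsub>G\<^esub> X)"

definition homogeneous_cr_manifold ::
    "nat \<Rightarrow> nat \<Rightarrow> ('g::euclidean_space, 'm) monoid_scheme \<Rightarrow> 'a::euclidean_space set \<Rightarrow>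
     ('g \<Rightarrow> 'a \<Rightarrow> 'a) \<Rightarrow> ('a \<Rightarrow> ('a \<times> 'a) set) \<Rightarrow> bool" where
  "homogeneous_cr_manifold n k G M act T \<longleftrightarrow>
     (\<exists>d. lie_group d G) \<and> cr_manifold n k M T \<and>
     transitive_action G M (\<lambda>g. restrict (act g) M) \<and>
     smooth_map (carrier G \<times> M) (\<lambda>p. act (fst p) (snd p)) \<and>
     (\<forall>g\<in>carrier G. \<forall>x\<in>M. map_prod (mdiff M (act g) x) (mdiff M (act g) x) ` T x = T (act g x))"

definition orbit_diff ::
    "('g::euclidean_space, 'm) monoid_scheme \<Rightarrow> ('g \<Rightarrow> 'a \<Rightarrow> 'a) \<Rightarrow> 'a::euclidean_space \<Rightarrow> 'g \<Rightarrow> 'a" where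
  "orbit_diff G act x X = mdiff (carrier G) (\<lambda>g. act g x) \<one>\<^bsub>G\<^esub> X"

definition lie_algebra ::
    "('k::field \<Rightarrow> 'v::ab_group_add \<Rightarrow> 'v) \<Rightarrow> 'v set \<Rightarrow> ('v \<Rightarrow> 'v \<Rightarrow> 'v) \<Rightarrow> bool" where
  "lie_algebra sc A br \<longleftrightarrow> module.subspace sc A \<and>
     (\<forall>X\<in>A. \<forall>Y\<in>A. br X Y \<in> A) \<and>
     (\<forall>X\<in>A. \<forall>Y\<in>A. \<forall>Z\<in>A. br (X + Y) Z = br X Z + br Y Z \<and> br Z (X + Y) = br Z X + br Z Y) \<and>
     (\<forall>c. \<forall>X\<in>A. \<forall>Y\<in>A. br (sc c X) Y = sc c (br X Y) \<and> br X (sc c Y) = sc c (br X Y)) \<and>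
     (\<forall>X\<in>A. br X X = 0) \<and>
     (\<forall>X\<in>A. \<forall>Y\<in>A. \<forall>Z\<in>A. br X (br Y Z) + br Y (br Z X) + br Z (br X Y) = 0)"

definition lie_subalgebra ::
    "('k::field \<Rightarrow> 'v::ab_group_add \<Rightarrow> 'v) \<Rightarrow> 'v set \<Rightarrow> ('v \<Rightarrow> 'v \<Rightarrow> 'v) \<Rightarrow> 'v set \<Rightarrow> bool" where
  "lie_subalgebra sc A br S \<longleftrightarrow> module.subspace sc S \<and> S \<subseteq> A \<and> (\<forall>X\<in>S. \<forall>Y\<in>S. br X Y \<in> S)"


section \<open>The modules of homogeneous polynomials\<close>

text \<open>The module of homogeneous polynomials of degree \<open>k\<close> in \<open>z, w\<close> is represented by coefficient
  vectors in \<open>complex^'n\<close>, where \<open>'n\<close> is linearly ordered and \<open>CARD('n) = k + 1\<close>: the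
  coordinate whose index is the \<open>h\<close>-th smallest (counting from \<open>0\<close>) is the coefficient
  of \<open>z ^ h * w ^ (k - h)\<close>.\<close>

definition zexp :: "'n::{finite,linorder} \<Rightarrow> nat" where
  "zexp i = card {j. j < i}"

definition wexp :: "'n::{finite,linorder} \<Rightarrow> nat" where
  "wexp i = CARD('n) - 1 - zexp i"

definition hpoly :: "complex^'n::{finite,linorder} \<Rightarrow> complex^2 \<Rightarrow> complex" where
  "hpoly a v = (\<Sum>i\<in>UNIV. a $ i * (v $ 1) ^ zexp i * (v $ 2) ^ wexp i)"

definition SL2 :: "(complex^2^2) set" where
  "SL2 = {g. det g = 1}"

definition sl2 :: "(complex^2^2) set" where
  "sl2 = {X. trace X = 0}"

definition ctransp :: "complex^2^2 \<Rightarrow> complex^2^2" where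
  "ctransp X = (\<chi> i j. cnj (X $ j $ i))"

definition SU2 :: "(complex^2^2) set" where
  "SU2 = {g \<in> SL2. g ** ctransp g = mat 1}"

definition su2 :: "(complex^2^2) set" where
  "su2 = {X \<in> sl2. - ctransp X = X}"

text \<open>\<open>(g f)(v) = f(g\<^sup>-\<^sup>1 v)\<close> and its differential at the identity of \<open>SL2\<close>, a real
  submanifold of \<open>complex^2^2\<close>.\<close>

definition grp_act :: "complex^2^2 \<Rightarrow> complex^'n::{finite,linorder} \<Rightarrow> complex^'n::{finite,linorder}" where
  "grp_act g a = (THE b. \<forall>v. hpoly b v = hpoly a (matrix_inv g *v v))"

definition alg_act :: "complex^2^2 \<Rightarrow> complex^'n::{finite,linorder} \<Rightarrow> complex^'n::{finite,linorder}" where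
  "alg_act X a = mdiff SL2 (\<lambda>g. grp_act g a) (mat 1) X"

definition theta :: "complex^'n::{finite,linorder} \<Rightarrow> complex^'n::{finite,linorder}" where
  "theta a = (THE b. \<forall>v. hpoly b v =
     (\<Sum>i\<in>UNIV. (-1) ^ zexp i * cnj (a $ i) * (v $ 2) ^ zexp i * (v $ 1) ^ wexp i))"

definition V_real :: "(complex^'n::{finite,linorder}) set" where
  "V_real = {a. theta a = a}"

definition V_minus :: "(complex^'n::{finite,linorder}) set" where
  "V_minus = {a. \<forall>i. \<not> CARD('n) - 1 < 2 * zexp i \<longrightarrow> a $ i = 0}"


section \<open>The pair of Lie algebras\<close>

type_synonym 'n lalg = "(complex^2^2) \<times> (complex^'n)"

definition lscale :: "complex \<Rightarrow> 'n::finite lalg \<Rightarrow> 'n lalg" where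
  "lscale c Z = ((\<chi> i j. c * fst Z $ i $ j), (\<chi> i. c * snd Z $ i))"

lemma vector_space_lscale: "vector_space (lscale :: complex \<Rightarrow> 'n::finite lalg \<Rightarrow> _)"
  by unfold_locales (auto simp: lscale_def vec_eq_iff algebra_simps prod_eq_iff)

abbreviation cdim :: "'n::finite lalg set \<Rightarrow> nat" where
  "cdim \<equiv> vector_space.dim lscale"

definition lbr :: "'n::{finite,linorder} lalg \<Rightarrow> 'n lalg \<Rightarrow> 'n lalg" where
  "lbr Z W = (fst Z ** fst W - fst W ** fst Z, alg_act (fst Z) (snd W) - alg_act (fst W) (snd Z))"

definition g_cplx :: "'n::{finite,linorder} lalg set" where
  "g_cplx = sl2 \<times> UNIV"

definition g_real :: "'n::{finite,linorder} lalg set" where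
  "g_real = su2 \<times> V_real"

definition borel_b :: "(complex^2^2) set" where
  "borel_b = {X \<in> sl2. X $ 1 $ 2 = 0}"

definition q_prime :: "'n::{finite,linorder} lalg set" where
  "q_prime = borel_b \<times> V_minus"


section \<open>CR algebras\<close>

text \<open>In this section \<open>A\<close> is a real Lie algebra and \<open>B\<close> its complexification, realised as
  \<open>A \<oplus> i A\<close> inside \<open>'n lalg\<close>, both with the bracket \<open>lbr\<close>.\<close>

definition is_complexification :: "'n::{finite,linorder} lalg set \<Rightarrow> 'n lalg set \<Rightarrow> bool" where
  "is_complexification A B \<longleftrightarrow> lie_algebra (*\<^sub>R) A lbr \<and> lie_algebra lscale B lbr \<and> A \<subseteq> B \<and>
     (\<forall>Z\<in>B. \<exists>!p. p \<in> A \<times> A \<and> Z = fst p + lscale \<i> (snd p))"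

definition conj_wrt :: "'n::{finite,linorder} lalg set \<Rightarrow> 'n lalg \<Rightarrow> 'n lalg" where
  "conj_wrt A Z = (THE W. \<exists>X\<in>A. \<exists>Y\<in>A. Z = X + lscale \<i> Y \<and> W = X - lscale \<i> Y)"

definition cr_algebra ::
    "'n::{finite,linorder} lalg set \<Rightarrow> 'n lalg set \<Rightarrow> 'n lalg set \<Rightarrow> bool" where
  "cr_algebra A B Q \<longleftrightarrow> is_complexification A B \<and> lie_subalgebra lscale B lbr Q \<and>
     (\<exists>F. finite F \<and> A \<subseteq> span (F \<union> (A \<inter> Q)))"

text \<open>\<open>Q\<close> is the preimage of \<open>T x\<close> under the complexified differential of the orbit map at \<open>x\<close>.\<close>

definition is_cr_algebra_at ::
    "'n::{finite,linorder} lalg set \<Rightarrow> 'n lalg set \<Rightarrow> 'n lalg monoid \<Rightarrow>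
     ('n lalg \<Rightarrow> 'a \<Rightarrow> 'a) \<Rightarrow> ('a \<Rightarrow> ('a \<times> 'a) set) \<Rightarrow> 'a::euclidean_space \<Rightarrow> bool" where
  "is_cr_algebra_at A Q G act T x \<longleftrightarrow> is_lie_algebra_of G A lbr \<and>
     Q = {X + lscale \<i> Y | X Y. X \<in> A \<and> Y \<in> A \<and>
           (orbit_diff G act x X, orbit_diff G act x Y) \<in> T x}"

definition cr_dim :: "'n::{finite,linorder} lalg set \<Rightarrow> 'n lalg set \<Rightarrow> nat" where
  "cr_dim A Q = cdim Q - cdim (Q \<inter> conj_wrt A ` Q)"

definition cr_codim :: "'n::{finite,linorder} lalg set \<Rightarrow> 'n lalg set \<Rightarrow> 'n lalg set \<Rightarrow> nat" where
  "cr_codim A B Q = cdim B - cdim {X + Y | X Y. X \<in> Q \<and> Y \<in> conj_wrt A ` Q}"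

definition fundamental ::
    "'n::{finite,linorder} lalg set \<Rightarrow> 'n lalg set \<Rightarrow> 'n lalg set \<Rightarrow> bool" where
  "fundamental A B Q \<longleftrightarrow>
     \<Inter>{S. lie_subalgebra lscale B lbr S \<and>
         {X + Y | X Y. X \<in> Q \<and> Y \<in> conj_wrt A ` Q} \<subseteq> S} = B"

primrec levi_filt ::
    "'n::{finite,linorder} lalg set \<Rightarrow> 'n lalg set \<Rightarrow> nat \<Rightarrow> 'n lalg set" where
  "levi_filt A Q 0 = Q"
| "levi_filt A Q (Suc p) = {Z \<in> levi_filt A Q p. \<forall>W \<in> conj_wrt A ` Q.
     lbr Z W \<in> {X + Y | X Y. X \<in> levi_filt A Q p \<and> Y \<in> conj_wrt A ` Q}}"

definition weakly_nondegenerate_of_order ::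
    "nat \<Rightarrow> 'n::{finite,linorder} lalg set \<Rightarrow> 'n lalg set \<Rightarrow> bool" where
  "weakly_nondegenerate_of_order r A Q \<longleftrightarrow> r \<ge> 1 \<and>
     levi_filt A Q r \<subset> levi_filt A Q (r - 1) \<and> levi_filt A Q r = Q \<inter> conj_wrt A ` Q"


section \<open>The homogeneous space\<close>

definition G_real :: "'n::{finite,linorder} lalg monoid" where
  "G_real = \<lparr>carrier = SU2 \<times> V_real,
     monoid.mult = (\<lambda>x y. (fst x ** fst y, snd x + grp_act (fst x) (snd y))),
     one = (mat 1, 0)\<rparr>"

definition torus :: "'n::{finite,linorder} lalg set" where
  "torus = {g \<in> SU2. g $ 1 $ 2 = 0 \<and> g $ 2 $ 1 = 0} \<times> {0}"

text \<open>The quotient of \<open>G_real\<close> by the torus is realised as an orbit, so that it becomes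
  a submanifold of a Euclidean space: \<open>G_real\<close> acts on pairs \<open>(X, u)\<close> in \<open>su2 \<times> V_real\<close> by the
  adjoint action of \<open>SU2\<close> on \<open>X\<close> and by affine transformations on \<open>u\<close>, and the stabilizer of
  \<open>(diag(i, -i), 0)\<close> is the torus. The first component is the adjoint orbit
  \<open>SU2 / T\<close>, i.e. the complex projective line.\<close>

definition E_act :: "'n::{finite,linorder} lalg \<Rightarrow> 'n lalg \<Rightarrow> 'n lalg" where
  "E_act g x = (fst g ** fst x ** matrix_inv (fst g), snd g + grp_act (fst g) (snd x))"

definition E_base :: "'n::{finite,linorder} lalg" where
  "E_base = (vector [vector [\<i>, 0], vector [0, - \<i>]], 0)"

definition E_space :: "'n::{finite,linorder} lalg set" where
  "E_space = {E_act g E_base | g. g \<in> carrier G_real}"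

text \<open>The invariant structure determined by \<open>q_prime\<close>: the image of \<open>q_prime\<close> at the base point,
  moved around by the group.\<close>

definition E_T01 :: "'n::{finite,linorder} lalg \<Rightarrow> ('n lalg \<times> 'n lalg) set" where
  "E_T01 x = {(mdiff E_space (E_act g) E_base (orbit_diff G_real E_act E_base X),
               mdiff E_space (E_act g) E_base (orbit_diff G_real E_act E_base Y)) | g X Y.
       g \<in> carrier G_real \<and> E_act g E_base = x \<and> X \<in> g_real \<and> Y \<in> g_real \<and>
       X + lscale \<i> Y \<in> q_prime}"

end

theory Submission
  imports Defs
begin

text \<open>
  Let \<open>H\<close>, \<open>E\<close>, \<open>F\<close> be the standard basis of \<open>sl2\<close> and consider binary forms of degree \<open>2 q\<close>.
  On them \<open>E\<close> acts as \<open>- w d/dz\<close> and \<open>F\<close> as \<open>- z d/dw\<close>, so \<open>E\<close> lowers and \<open>F\<close> raises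
  the exponent \<open>h\<close> of \<open>z\<close> by one.  The conjugation \<open>rconj\<close> exchanges \<open>h\<close> with \<open>2 q - h\<close> and
  \<open>F\<close> with \<open>- E\<close>.  Hence \<open>q_prime\<close> is spanned by \<open>H\<close>, \<open>F\<close> and the monomials with \<open>h > q\<close>, its
  conjugate by \<open>H\<close>, \<open>E\<close> and the monomials with \<open>h < q\<close>.  They meet in the line of \<open>H\<close>, which
  gives the CR dimension, and their sum misses exactly the monomial with \<open>h = q\<close>, which gives the
  codimension.  The missing monomial is the image under \<open>E\<close> of its neighbour \<open>h = q + 1\<close>; thus
  the algebra is fundamental.  In the Levi filtration the first step removes \<open>F\<close>, which carries
  the monomial with \<open>h = q - 1\<close> to the missing one, and every step removes the monomial with the smallest
  \<open>h\<close> still present, because \<open>E\<close> carries it into a position that is not available in the sum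
  (\<open>levi_space_step\<close>).  The monomials \<open>h = q + 1, ..., 2 q\<close> take \<open>q\<close> steps.

  For the geometry, inverses in \<open>SU2\<close> are conjugate transposes and inverses in \<open>SL2\<close> are
  adjugates, so all actions are restrictions of polynomial maps of the ambient Euclidean spaces.
  Differentials along the submanifolds are therefore ordinary derivatives of these extensions
  (\<open>mdiff_eqI\<close>), and the one formula that enters everywhere is the derivative at the identity of the
  action on forms (\<open>has_derivative_pact\<close>).  The manifolds are vector spaces and round spheres:
  \<open>SU2\<close> is a sphere in the space \<open>quat\<close> of quaternionic matrices and the adjoint orbit a
  sphere in \<open>su2\<close>.

  Pairs of real vectors are identified with elements of the complexification (\<open>re_im\<close>,
  \<open>recombine\<close>).  The vectors of type \<open>(0,1)\<close> at \<open>g o\<close> then form the translate by \<open>g\<close> of the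
  space \<open>T01_base\<close> spanned by \<open>F\<close> and the monomials with \<open>h > q\<close> (\<open>E_T01_eq\<close>); the choice of \<open>g\<close>
  is immaterial because the torus preserves \<open>T01_base\<close>.  Rank and transversality to the
  conjugate are read off at the base point.  Through every vector of type \<open>(0,1)\<close> there is a
  polynomial section, given by a quaternion that rotates one point of the sphere to another
  (\<open>E_T01_extension\<close>).  Integrability holds because \<open>borel_b\<close> preserves \<open>T01_base\<close>: differentiating
  a section along an orbit curve adds to a vector of \<open>T01_base\<close> only the action of the velocity,
  which is in \<open>borel_b\<close> for directions of type \<open>(0,1)\<close> (\<open>section_derivative\<close>).
\<close>

section \<open>Calculus of smooth maps\<close>

lemma Ck_on_cong:
  assumes "Ck_on k U f" "open U" "\<And>x. x \<in> U \<Longrightarrow> f x = g x"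
  shows "Ck_on k U g"
  using assms
proof (induction k arbitrary: f g)
  case 0
  then show ?case by (simp add: continuous_on_eq)
next
  case (Suc k)
  have d: "(g has_derivative frechet_derivative f (at x)) (at x)" if "x \<in> U" for x
  proof (rule has_derivative_transform_within_open)
    show "(f has_derivative frechet_derivative f (at x)) (at x)"
      using Suc.prems(1) that by (simp add: frechet_derivative_works[symmetric])
  qed (use Suc.prems that in auto)
  have eq: "frechet_derivative f (at x) = frechet_derivative g (at x)" if "x \<in> U" for x
    using frechet_derivative_at[OF d[OF that]] .
  have "Ck_on k U (\<lambda>x. frechet_derivative g (at x) v)" for v
  proof (rule Suc.IH)
    show "Ck_on k U (\<lambda>x. frechet_derivative f (at x) v)"
      using Suc.prems(1) by simp
  qed (simp_all add: eq Suc.prems(2))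
  moreover have "g differentiable (at x)" if "x \<in> U" for x
    using d[OF that] by (rule differentiableI)
  ultimately show ?case by simp
qed

text \<open>Derivatives of concrete maps are known in closed form near each point; openness of \<open>U\<close> makes
  any such pointwise derivative agree with \<open>frechet_derivative\<close>.\<close>

lemma Ck_on_SucI:
  assumes "open U" "\<And>x. x \<in> U \<Longrightarrow> (f has_derivative f' x) (at x)" "\<And>v. Ck_on k U (\<lambda>x. f' x v)"
  shows "Ck_on (Suc k) U f"
proof -
  have "frechet_derivative f (at x) = f' x" if "x \<in> U" for x
    using assms(2)[OF that] frechet_derivative_at by metis
  then have "Ck_on k U (\<lambda>x. frechet_derivative f (at x) v)" for v
    by (intro Ck_on_cong[OF assms(3)[of v] assms(1)]) simp
  moreover have "f differentiable (at x)" if "x \<in> U" for x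
    using assms(2)[OF that] by (rule differentiableI)
  ultimately show ?thesis by simp
qed

lemma Ck_on_SucD:
  assumes "Ck_on (Suc k) U f"
  shows "\<exists>f'. (\<forall>x\<in>U. (f has_derivative f' x) (at x)) \<and> (\<forall>v. Ck_on k U (\<lambda>x. f' x v))"
  using assms by (intro exI[of _ "\<lambda>x. frechet_derivative f (at x)"]) (auto simp: frechet_derivative_works)

lemma Ck_on_Suc_imp: "Ck_on (Suc k) U f \<Longrightarrow> Ck_on k U f"
proof (induction k arbitrary: f)
  case 0
  then show ?case
    by (auto simp: differentiable_imp_continuous_within continuous_on_eq_continuous_within
        intro: continuous_at_imp_continuous_at_within)
next
  case (Suc k)
  then show ?case by auto
qed

lemma Ck_on_const: "open U \<Longrightarrow> Ck_on k U (\<lambda>x. c)"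
  by (induction k arbitrary: c) (auto intro: Ck_on_SucI[of _ _ "\<lambda>_ _. 0"])

lemma Ck_on_bounded_linear:
  assumes "bounded_linear L" "open U" "Ck_on k U f"
  shows "Ck_on k U (\<lambda>x. L (f x))"
  using assms(3)
proof (induction k arbitrary: f)
  case 0
  then show ?case using bounded_linear.continuous_on[OF assms(1)] by auto
next
  case (Suc k)
  obtain f' where f': "\<And>x. x \<in> U \<Longrightarrow> (f has_derivative f' x) (at x)"
    "\<And>v. Ck_on k U (\<lambda>x. f' x v)" using Ck_on_SucD[OF Suc.prems] by blast
  show ?case
    using Suc.IH[OF f'(2)] bounded_linear.has_derivative[OF assms(1) f'(1)]
    by (intro Ck_on_SucI[OF assms(2)]) auto
qed

lemma Ck_on_linear:
  assumes "bounded_linear L" "open U"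
  shows "Ck_on k U L"
proof (cases k)
  case 0
  then show ?thesis using assms by (simp add: linear_continuous_on)
next
  case (Suc k')
  have "Ck_on (Suc k') U L"
    by (rule Ck_on_SucI[of _ _ "\<lambda>_. L"])
      (simp_all add: assms bounded_linear_imp_has_derivative Ck_on_const)
  then show ?thesis using Suc by simp
qed

lemma Ck_on_add:
  assumes "open U" "Ck_on k U f" "Ck_on k U g"
  shows "Ck_on k U (\<lambda>x. f x + g x)"
  using assms(2,3)
proof (induction k arbitrary: f g)
  case 0
  then show ?case by (simp add: continuous_on_add)
next
  case (Suc k)
  obtain f' where f': "\<And>x. x \<in> U \<Longrightarrow> (f has_derivative f' x) (at x)"
    "\<And>v. Ck_on k U (\<lambda>x. f' x v)" using Ck_on_SucD[OF Suc.prems(1)] by blast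
  obtain g' where g': "\<And>x. x \<in> U \<Longrightarrow> (g has_derivative g' x) (at x)"
    "\<And>v. Ck_on k U (\<lambda>x. g' x v)" using Ck_on_SucD[OF Suc.prems(2)] by blast
  show ?case
    by (rule Ck_on_SucI[OF assms(1)]) (use f' g' Suc.IH in \<open>auto intro!: has_derivative_add\<close>)
qed

lemma Ck_on_sum:
  assumes "open U" "\<And>i. i \<in> I \<Longrightarrow> Ck_on k U (f i)"
  shows "Ck_on k U (\<lambda>x. \<Sum>i\<in>I. f i x)"
  using assms(2)
  by (induction I rule: infinite_finite_induct) (auto simp: Ck_on_const Ck_on_add assms(1))

lemma Ck_on_bilinear:
  assumes "bounded_bilinear B" "open U" "Ck_on k U f" "Ck_on k U g"
  shows "Ck_on k U (\<lambda>x. B (f x) (g x))"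
  using assms(3,4)
proof (induction k arbitrary: f g)
  case 0
  then show ?case by (simp add: bounded_bilinear.continuous_on[OF assms(1)])
next
  case (Suc k)
  obtain f' where f': "\<And>x. x \<in> U \<Longrightarrow> (f has_derivative f' x) (at x)"
    "\<And>v. Ck_on k U (\<lambda>x. f' x v)" using Ck_on_SucD[OF Suc.prems(1)] by blast
  obtain g' where g': "\<And>x. x \<in> U \<Longrightarrow> (g has_derivative g' x) (at x)"
    "\<And>v. Ck_on k U (\<lambda>x. g' x v)" using Ck_on_SucD[OF Suc.prems(2)] by blast
  show ?case
  proof (rule Ck_on_SucI[OF assms(2)])
    show "((\<lambda>x. B (f x) (g x)) has_derivative (\<lambda>v. B (f x) (g' x v) + B (f' x v) (g x))) (at x)"
      if "x \<in> U" for x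
      using bounded_bilinear.FDERIV[OF assms(1) f'(1) g'(1)] that by auto
    show "Ck_on k U (\<lambda>x. B (f x) (g' x v) + B (f' x v) (g x))" for v
      by (rule Ck_on_add[OF assms(2) Suc.IH[OF Ck_on_Suc_imp[OF Suc.prems(1)] g'(2)]
            Suc.IH[OF f'(2) Ck_on_Suc_imp[OF Suc.prems(2)]]])
  qed
qed

text \<open>In the chain rule the inner derivative supplies a direction that varies with the point, whereas
  the induction hypothesis concerns fixed directions.  The direction is therefore expanded in the
  standard basis.\<close>

lemma Ck_on_compose:
  fixes f :: "'a::euclidean_space \<Rightarrow> 'b::euclidean_space" and g :: "'b \<Rightarrow> 'c::euclidean_space"
  assumes "open U" "open V" "f ` U \<subseteq> V" "Ck_on k U f" "Ck_on k V g"
  shows "Ck_on k U (\<lambda>x. g (f x))"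
  using assms(4,5)
proof (induction k arbitrary: g)
  case 0
  then show ?case using assms(3) by (auto intro: continuous_on_compose2)
next
  case (Suc k)
  obtain f' where f': "\<And>x. x \<in> U \<Longrightarrow> (f has_derivative f' x) (at x)"
    "\<And>v. Ck_on k U (\<lambda>x. f' x v)" using Ck_on_SucD[OF Suc.prems(1)] by blast
  obtain g' where g': "\<And>x. x \<in> V \<Longrightarrow> (g has_derivative g' x) (at x)"
    "\<And>v. Ck_on k V (\<lambda>x. g' x v)" using Ck_on_SucD[OF Suc.prems(2)] by blast
  show ?case
  proof (rule Ck_on_SucI[OF assms(1)])
    show "((\<lambda>x. g (f x)) has_derivative (\<lambda>v. \<Sum>b\<in>Basis. (f' x v \<bullet> b) *\<^sub>R g' (f x) b)) (at x)"
      if "x \<in> U" for x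
    proof -
      have fx: "f x \<in> V" using assms(3) that by auto
      have lin: "linear (g' (f x))"
        using g'(1)[OF fx] has_derivative_linear by blast
      have "g' (f x) (f' x v) = (\<Sum>b\<in>Basis. (f' x v \<bullet> b) *\<^sub>R g' (f x) b)" for v
        by (subst euclidean_representation[symmetric, of "f' x v"])
          (simp only: linear_sum[OF lin] linear_scale[OF lin])
      moreover have "((\<lambda>x. g (f x)) has_derivative (\<lambda>v. g' (f x) (f' x v))) (at x)"
        using diff_chain_at[OF f'(1)[OF that] g'(1)[OF fx]] by (simp add: o_def)
      ultimately show ?thesis by simp
    qed
    show "Ck_on k U (\<lambda>x. \<Sum>b\<in>Basis. (f' x v \<bullet> b) *\<^sub>R g' (f x) b)" for v
    proof (intro Ck_on_sum[OF assms(1)] Ck_on_bilinear[OF bounded_bilinear_scaleR assms(1)])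
      show "Ck_on k U (\<lambda>x. f' x v \<bullet> b)" for b
        by (rule Ck_on_bounded_linear[OF bounded_linear_inner_left assms(1) f'(2)])
      show "Ck_on k U (\<lambda>x. g' (f x) b)" for b
        using Suc.IH[OF Ck_on_Suc_imp[OF Suc.prems(1)] g'(2)] .
    qed
  qed
qed

text \<open>The derivative \<open>- f' / f\<^sup>2\<close> contains only the reciprocal itself, which the induction hypothesis
  covers one order lower.\<close>

lemma Ck_on_inverse:
  fixes f :: "'a::euclidean_space \<Rightarrow> 'b::{euclidean_space, real_normed_field}"
  assumes "open U" "\<And>x. x \<in> U \<Longrightarrow> f x \<noteq> 0" "Ck_on k U f"
  shows "Ck_on k U (\<lambda>x. inverse (f x))"
  using assms(3)
proof (induction k)
  case 0
  then show ?case using assms(2) by (auto intro: continuous_on_inverse)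
next
  case (Suc k)
  obtain f' where f': "\<And>x. x \<in> U \<Longrightarrow> (f has_derivative f' x) (at x)"
    "\<And>v. Ck_on k U (\<lambda>x. f' x v)" using Ck_on_SucD[OF Suc.prems(1)] by blast
  have inv: "Ck_on k U (\<lambda>x. inverse (f x))"
    using Suc.IH[OF Ck_on_Suc_imp[OF Suc.prems(1)]] .
  show ?case
  proof (rule Ck_on_SucI[OF assms(1)])
    show "((\<lambda>x. inverse (f x)) has_derivative (\<lambda>v. - (inverse (f x) * f' x v * inverse (f x)))) (at x)"
      if "x \<in> U" for x
      using Deriv.has_derivative_inverse[OF assms(2)[OF that] f'(1)[OF that]] .
    show "Ck_on k U (\<lambda>x. - (inverse (f x) * f' x v * inverse (f x)))" for v
      by (intro Ck_on_bounded_linear[OF bounded_linear_minus[OF bounded_linear_ident] assms(1)]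
          Ck_on_bilinear[OF bounded_bilinear_mult assms(1)] inv f'(2))
  qed
qed

named_theorems smooth_intros

lemma smooth_on_open: "smooth_on U f \<Longrightarrow> open U"
  by (simp add: smooth_on_def)

lemma smooth_on_cong:
  assumes "smooth_on U f" "\<And>x. x \<in> U \<Longrightarrow> f x = g x"
  shows "smooth_on U g"
  using assms Ck_on_cong unfolding smooth_on_def by metis

lemma smooth_on_const [smooth_intros]: "open U \<Longrightarrow> smooth_on U (\<lambda>x. c)"
  by (simp add: smooth_on_def Ck_on_const)

lemma smooth_on_bounded_linear:
  "bounded_linear L \<Longrightarrow> smooth_on U f \<Longrightarrow> smooth_on U (\<lambda>x. L (f x))"
  by (simp add: smooth_on_def Ck_on_bounded_linear)

lemma smooth_on_linear:
  "linear L \<Longrightarrow> smooth_on U f \<Longrightarrow> smooth_on U (\<lambda>x. L (f x))"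
  by (simp add: smooth_on_bounded_linear linear_conv_bounded_linear)

lemma smooth_on_bilinear:
  "bounded_bilinear B \<Longrightarrow> smooth_on U f \<Longrightarrow> smooth_on U g \<Longrightarrow> smooth_on U (\<lambda>x. B (f x) (g x))"
  by (simp add: smooth_on_def Ck_on_bilinear)

lemma smooth_on_id [smooth_intros]: "open U \<Longrightarrow> smooth_on U (\<lambda>x. x)"
  by (simp add: smooth_on_def Ck_on_linear bounded_linear_ident)

lemma smooth_on_add [smooth_intros]:
  "smooth_on U f \<Longrightarrow> smooth_on U g \<Longrightarrow> smooth_on U (\<lambda>x. f x + g x)"
  by (simp add: smooth_on_def Ck_on_add)

lemma smooth_on_minus [smooth_intros]: "smooth_on U f \<Longrightarrow> smooth_on U (\<lambda>x. - f x)"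
  by (rule smooth_on_bounded_linear[OF bounded_linear_minus[OF bounded_linear_ident]])

lemma smooth_on_diff [smooth_intros]:
  "smooth_on U f \<Longrightarrow> smooth_on U g \<Longrightarrow> smooth_on U (\<lambda>x. f x - g x)"
  using smooth_on_add[of U f "\<lambda>x. - g x"] smooth_on_minus[of U g] by simp

lemma smooth_on_sum [smooth_intros]:
  "open U \<Longrightarrow> (\<And>i. i \<in> I \<Longrightarrow> smooth_on U (f i)) \<Longrightarrow> smooth_on U (\<lambda>x. \<Sum>i\<in>I. f i x)"
  by (simp add: smooth_on_def Ck_on_sum)

lemmas smooth_on_scaleR [smooth_intros] = smooth_on_bilinear[OF bounded_bilinear_scaleR]
lemmas smooth_on_inner [smooth_intros] = smooth_on_bilinear[OF bounded_bilinear_inner]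
lemmas smooth_on_fst [smooth_intros] = smooth_on_bounded_linear[OF bounded_linear_fst]
lemmas smooth_on_snd [smooth_intros] = smooth_on_bounded_linear[OF bounded_linear_snd]
lemmas smooth_on_of_real [smooth_intros] = smooth_on_bounded_linear[OF bounded_linear_of_real]

lemma smooth_on_mult [smooth_intros]:
  fixes f g :: "'a::euclidean_space \<Rightarrow> 'b::{euclidean_space, real_normed_field}"
  shows "smooth_on U f \<Longrightarrow> smooth_on U g \<Longrightarrow> smooth_on U (\<lambda>x. f x * g x)"
  by (rule smooth_on_bilinear[OF bounded_bilinear_mult])

lemma smooth_on_power [smooth_intros]:
  fixes f :: "'a::euclidean_space \<Rightarrow> 'b::{euclidean_space, real_normed_field}"
  assumes "smooth_on U f" shows "smooth_on U (\<lambda>x. f x ^ n)"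
  by (induction n) (simp_all add: smooth_on_const smooth_on_open[OF assms] smooth_on_mult assms)

lemma smooth_on_inverse [smooth_intros]:
  fixes f :: "'a::euclidean_space \<Rightarrow> 'b::{euclidean_space, real_normed_field}"
  shows "smooth_on U f \<Longrightarrow> (\<And>x. x \<in> U \<Longrightarrow> f x \<noteq> 0) \<Longrightarrow> smooth_on U (\<lambda>x. inverse (f x))"
  by (simp add: smooth_on_def Ck_on_inverse)

lemma smooth_on_divide [smooth_intros]:
  fixes f g :: "'a::euclidean_space \<Rightarrow> 'b::{euclidean_space, real_normed_field}"
  shows "smooth_on U f \<Longrightarrow> smooth_on U g \<Longrightarrow> (\<And>x. x \<in> U \<Longrightarrow> g x \<noteq> 0) \<Longrightarrow>
    smooth_on U (\<lambda>x. f x / g x)"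
  unfolding divide_inverse by (intro smooth_intros)

lemma smooth_on_Pair [smooth_intros]:
  assumes "smooth_on U f" "smooth_on U g"
  shows "smooth_on U (\<lambda>x. (f x, g x))"
proof -
  have "smooth_on U (\<lambda>x. (f x, 0) + (0, g x))"
    by (intro smooth_on_add smooth_on_linear[of "\<lambda>a. (a, 0)"] smooth_on_linear[of "\<lambda>a. (0, a)"] assms)
      (auto intro!: linearI)
  then show ?thesis by simp
qed

lemma smooth_on_vec_lambda [smooth_intros]:
  fixes f :: "'i::finite \<Rightarrow> 'a::euclidean_space \<Rightarrow> 'b::euclidean_space"
  assumes "open U" "\<And>i. smooth_on U (f i)"
  shows "smooth_on U (\<lambda>x. \<chi> i. f i x)"
proof -
  have "smooth_on U (\<lambda>x. \<Sum>i\<in>UNIV. axis i (f i x))"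
    by (intro smooth_on_sum assms smooth_on_linear[of "axis _"])
      (auto intro!: linearI simp: vec_eq_iff axis_def)
  moreover have "(\<Sum>i\<in>UNIV. axis i (f i x)) = (\<chi> i. f i x)" for x
    by (simp add: vec_eq_iff axis_def if_distrib cong: if_cong)
  ultimately show ?thesis by simp
qed

lemma smooth_on_vec_nth [smooth_intros]:
  "smooth_on U f \<Longrightarrow> smooth_on U (\<lambda>x. f x $ i)"
  by (rule smooth_on_bounded_linear[OF bounded_linear_vec_nth])

lemma smooth_on_compose:
  assumes "smooth_on U f" "smooth_on V g" "f ` U \<subseteq> V"
  shows "smooth_on U (\<lambda>x. g (f x))"
  using assms unfolding smooth_on_def by (blast intro: Ck_on_compose)

lemma smooth_on_subset:
  assumes "smooth_on V f" "open U" "U \<subseteq> V"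
  shows "smooth_on U f"
  using smooth_on_compose[OF smooth_on_id[OF assms(2)] assms(1)] assms(3) by simp

lemma smooth_on_has_derivative:
  assumes "smooth_on U f" "x \<in> U"
  shows "(f has_derivative frechet_derivative f (at x)) (at x)"
proof -
  have "Ck_on (Suc 0) U f" using assms(1) unfolding smooth_on_def by blast
  then show ?thesis using assms(2) by (auto simp: frechet_derivative_works)
qed

lemma smooth_mapI: "smooth_on UNIV h \<Longrightarrow> (\<And>y. y \<in> M \<Longrightarrow> h y = f y) \<Longrightarrow> smooth_map M f"
  unfolding smooth_map_def by blast


section \<open>Submanifolds, tangent vectors and differentials\<close>

lemma submanifold_subspace:
  assumes "subspace S"
  shows "submanifold (dim S) S"
  unfolding submanifold_def
proof
  fix x assume "x \<in> S"
  have "smooth_on UNIV (\<lambda>x::'a. x)" "homeomorphism UNIV UNIV (\<lambda>x::'a. x) (\<lambda>x. x)"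
    "(\<lambda>x. x) ` (UNIV \<inter> S) = UNIV \<inter> S"
    by (rule smooth_on_id[OF open_UNIV], rule homeomorphism_ident, simp)
  then show "\<exists>U V \<Phi> \<Psi> (L :: 'a set). x \<in> U \<and> smooth_on U \<Phi> \<and> smooth_on V \<Psi> \<and> homeomorphism U V \<Phi> \<Psi> \<and>
      subspace L \<and> dim L = dim S \<and> \<Phi> ` (U \<inter> S) = V \<inter> L"
    using assms by blast
qed

lemma submanifold_Times:
  fixes A :: "'a::euclidean_space set" and B :: "'b::euclidean_space set"
  assumes "submanifold m A" "submanifold n B"
  shows "submanifold (m + n) (A \<times> B)"
  unfolding submanifold_def
proof (clarify)
  fix a b assume "a \<in> A" "b \<in> B"
  obtain U V \<Phi> \<Psi> and L :: "'a set" where 1: "a \<in> U" "smooth_on U \<Phi>" "smooth_on V \<Psi>"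
    "homeomorphism U V \<Phi> \<Psi>" "subspace L" "dim L = m" "\<Phi> ` (U \<inter> A) = V \<inter> L"
    using assms(1) \<open>a \<in> A\<close> unfolding submanifold_def by blast
  obtain U' V' \<Phi>' \<Psi>' and L' :: "'b set" where 2: "b \<in> U'" "smooth_on U' \<Phi>'" "smooth_on V' \<Psi>'"
    "homeomorphism U' V' \<Phi>' \<Psi>'" "subspace L'" "dim L' = n" "\<Phi>' ` (U' \<inter> B) = V' \<inter> L'"
    using assms(2) \<open>b \<in> B\<close> unfolding submanifold_def by blast
  have prod: "smooth_on (X \<times> Y) (map_prod f g)"
    if "smooth_on X f" "smooth_on Y g" for X :: "'a set" and Y :: "'b set" and f :: "'a \<Rightarrow> 'a" and g :: "'b \<Rightarrow> 'b"
  proof -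
    have o: "open (X \<times> Y)"
      using open_Times[OF smooth_on_open[OF that(1)] smooth_on_open[OF that(2)]] .
    have "smooth_on (X \<times> Y) (\<lambda>p. (f (fst p), g (snd p)))"
      by (intro smooth_on_Pair smooth_on_compose[OF _ that(1)] smooth_on_compose[OF _ that(2)]
          smooth_on_fst smooth_on_snd smooth_on_id o) auto
    then show ?thesis by (simp add: map_prod_def case_prod_beta')
  qed
  have img: "map_prod \<Phi> \<Phi>' ` ((U \<times> U') \<inter> (A \<times> B)) = (V \<times> V') \<inter> (L \<times> L')"
    unfolding Times_Int_Times by (rule map_prod_surj_on[OF 1(7) 2(7)])
  have hom: "homeomorphism (U \<times> U') (V \<times> V') (map_prod \<Phi> \<Phi>') (map_prod \<Psi> \<Psi>')"
  proof (rule homeomorphismI)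
    show "continuous_on (U \<times> U') (map_prod \<Phi> \<Phi>')" "continuous_on (V \<times> V') (map_prod \<Psi> \<Psi>')"
      using prod[OF 1(2) 2(2)] prod[OF 1(3) 2(3)] unfolding smooth_on_def by (metis Ck_on.simps(1))+
  qed (use homeomorphism_image1[OF 1(4)] homeomorphism_image2[OF 1(4)] homeomorphism_image1[OF 2(4)]
        homeomorphism_image2[OF 2(4)] homeomorphism_apply1[OF 1(4)] homeomorphism_apply2[OF 1(4)]
        homeomorphism_apply1[OF 2(4)] homeomorphism_apply2[OF 2(4)] in auto)
  show "\<exists>U V \<Phi> \<Psi> (L :: ('a \<times> 'b) set). (a, b) \<in> U \<and> smooth_on U \<Phi> \<and> smooth_on V \<Psi> \<and> homeomorphism U V \<Phi> \<Psi> \<and>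
      subspace L \<and> dim L = m + n \<and> \<Phi> ` (U \<inter> A \<times> B) = V \<inter> L"
  proof (intro exI conjI)
    show "(a, b) \<in> U \<times> U'" using 1(1) 2(1) by simp
    show "dim (L \<times> L') = m + n" using dim_Times[OF 1(5) 2(5)] 1(6) 2(6) by simp
    show "subspace (L \<times> L')" by (rule subspace_Times[OF 1(5) 2(5)])
  qed (fact prod[OF 1(2) 2(2)] prod[OF 1(3) 2(3)] hom img)+
qed

text \<open>Inversion at a sphere centred at \<open>-p\<close> carries the sphere about the origin through \<open>p\<close>
  to a hyperplane.  Unlike stereographic projection it is defined on the ambient space without \<open>-p\<close>, it is its
  own inverse, and it preserves every subspace through \<open>p\<close>.\<close>

lemma submanifold_sphere_subspace:
  fixes S :: "'a::euclidean_space set"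
  assumes S: "subspace S" and dimS: "dim S = Suc n" and r: "r > 0"
  shows "submanifold n {x \<in> S. norm x = r}"
  unfolding submanifold_def
proof
  fix p assume "p \<in> {x \<in> S. norm x = r}"
  then have p: "p \<in> S" "norm p = r" "p \<bullet> p = r\<^sup>2" by (auto simp: dot_square_norm)
  define c where "c = 2 * r\<^sup>2"
  have c: "c > 0" using r by (simp add: c_def)
  define \<Phi> where "\<Phi> x = - p + (c / ((x + p) \<bullet> (x + p))) *\<^sub>R (x + p)" for x
  define U where "U = - {- p}"
  define L where "L = {x \<in> S. p \<bullet> x = 0}"
  have U: "x \<in> U \<longleftrightarrow> x + p \<noteq> 0" for x by (auto simp: U_def add_eq_0_iff2)
  have oU: "open U" by (simp add: U_def open_Compl)
  have smooth: "smooth_on U \<Phi>"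
    unfolding \<Phi>_def by (intro smooth_intros oU) (simp add: U)
  have \<Phi>p: "\<Phi> x + p = (c / ((x + p) \<bullet> (x + p))) *\<^sub>R (x + p)" for x
    by (simp add: \<Phi>_def)
  have \<Phi>U: "\<Phi> x \<in> U" if "x \<in> U" for x
    using that c by (simp add: U \<Phi>p)
  have inv: "\<Phi> (\<Phi> x) = x" if "x \<in> U" for x
  proof -
    have nz: "(x + p) \<bullet> (x + p) \<noteq> 0" using that by (simp add: U)
    define d where "d = (x + p) \<bullet> (x + p)"
    have "(\<Phi> x + p) \<bullet> (\<Phi> x + p) = (c / d)\<^sup>2 * d"
      by (simp add: \<Phi>p power2_eq_square d_def)
    then have "\<Phi> (\<Phi> x) + p = (c / ((c / d)\<^sup>2 * d)) *\<^sub>R ((c / d) *\<^sub>R (x + p))"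
      using \<Phi>p[of "\<Phi> x"] \<Phi>p[of x] d_def by simp
    also have "\<dots> = x + p"
      using nz c by (simp add: d_def[symmetric] power2_eq_square)
    finally show ?thesis by simp
  qed
  have img: "\<Phi> ` (U \<inter> {x \<in> S. norm x = r}) = U \<inter> L"
  proof -
    have S\<Phi>: "\<Phi> x \<in> S" if "x \<in> S" for x
      unfolding \<Phi>_def using p that by (intro subspace_add[OF S] subspace_scale[OF S] subspace_neg[OF S]) auto
    have 1: "\<Phi> x \<in> L" if "x \<in> U" "x \<in> S" "norm x = r" for x
    proof -
      have e: "(x + p) \<bullet> (x + p) = 2 * (r\<^sup>2 + p \<bullet> x)"
        using that(3) p(3) dot_square_norm[of x]
        by (simp add: inner_add_left inner_add_right inner_commute del: dot_square_norm)
      have "(x + p) \<bullet> (x + p) \<noteq> 0" using that(1) by (simp add: U)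
      then have "r\<^sup>2 + p \<bullet> x \<noteq> 0" unfolding e by simp
      moreover have "p \<bullet> \<Phi> x = - r\<^sup>2 + c / (2 * (r\<^sup>2 + p \<bullet> x)) * (p \<bullet> x + r\<^sup>2)"
        unfolding \<Phi>_def e by (simp only: inner_add_right inner_minus_right inner_scaleR_right p(3))
      ultimately have "p \<bullet> \<Phi> x = 0" by (simp add: c_def field_simps)
      then show ?thesis using S\<Phi>[OF that(2)] by (simp add: L_def)
    qed
    have 2: "norm (\<Phi> z) = r" if "z \<in> U" "z \<in> L" for z
    proof -
      define d where "d = (z + p) \<bullet> (z + p)"
      have d: "d \<noteq> 0" using that(1) by (simp add: U d_def)
      have pz: "p \<bullet> (z + p) = r\<^sup>2" using that(2) p by (simp add: L_def inner_add_right)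
      have "\<Phi> z \<bullet> \<Phi> z = p \<bullet> p - 2 * (c / d) * (p \<bullet> (z + p)) + (c / d)\<^sup>2 * d"
      proof -
        have "(- p + k *\<^sub>R w) \<bullet> (- p + k *\<^sub>R w) = p \<bullet> p - 2 * k * (p \<bullet> w) + k\<^sup>2 * (w \<bullet> w)" for k w
          by (simp only: inner_add_left inner_add_right inner_minus_left inner_minus_right
              inner_scaleR_left inner_scaleR_right inner_commute[of w p] power2_eq_square)
            (simp add: algebra_simps)
        then show ?thesis unfolding \<Phi>_def d_def .
      qed
      also have "\<dots> = r\<^sup>2" unfolding pz p(3)
        using d by (simp add: c_def power2_eq_square field_simps)
      finally show ?thesis
        using r by (simp add: norm_eq_sqrt_inner)
    qed
    show ?thesis
    proof (intro equalityI subsetI)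
      fix y assume "y \<in> \<Phi> ` (U \<inter> {x \<in> S. norm x = r})"
      then show "y \<in> U \<inter> L" using 1 \<Phi>U by auto
    next
      fix y assume y: "y \<in> U \<inter> L"
      then have "\<Phi> y \<in> U \<inter> {x \<in> S. norm x = r}"
        using \<Phi>U S\<Phi> 2 by (auto simp: L_def)
      then show "y \<in> \<Phi> ` (U \<inter> {x \<in> S. norm x = r})" using inv y by (metis IntD1 image_eqI)
    qed
  qed
  have L: "subspace L"
    using S by (auto simp: L_def subspace_def inner_add_right)
  have "dim {y \<in> S. \<forall>x \<in> span {p}. orthogonal x y} + dim (span {p}) = dim S"
    using p S by (intro dim_subspace_orthogonal_to_vectors) (auto simp: span_minimal)
  moreover have "{y \<in> S. \<forall>x \<in> span {p}. orthogonal x y} = L"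
    by (auto simp: L_def orthogonal_def span_singleton)
  moreover have "p \<noteq> 0" using p r by auto
  ultimately have "dim L = n" using dimS by simp
  moreover have "homeomorphism U U \<Phi> \<Phi>"
  proof (rule homeomorphismI)
    show "continuous_on U \<Phi>" using smooth unfolding smooth_on_def by (metis Ck_on.simps(1))
    then show "continuous_on U \<Phi>" .
  qed (use \<Phi>U inv in auto)
  moreover have "p \<in> U" using \<open>p \<noteq> 0\<close> by (simp add: U flip: scaleR_2)
  ultimately show "\<exists>U V \<Phi> \<Psi> (L::'a set). p \<in> U \<and> smooth_on U \<Phi> \<and> smooth_on V \<Psi> \<and> homeomorphism U V \<Phi> \<Psi> \<and>
      subspace L \<and> dim L = n \<and> \<Phi> ` (U \<inter> {x \<in> S. norm x = r}) = V \<inter> L"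
    using smooth L img by blast
qed

lemma has_vector_derivative_chain_at:
  assumes "(c has_vector_derivative v) (at x)" "(h has_derivative h') (at (c x))"
  shows "((\<lambda>t. h (c t)) has_vector_derivative h' v) (at x)"
  using vector_derivative_diff_chain_within[of c v x UNIV h h'] assms
  by (simp add: o_def has_derivative_at_withinI)

text \<open>Curves in a manifold are controlled only near \<open>0\<close>, so identities along them hold only there.\<close>

lemma has_vector_derivative_eventually_eq:
  assumes "(f has_vector_derivative v) (at x)" "\<forall>\<^sub>F t in nhds x. f t = g t"
  shows "(g has_vector_derivative v) (at x)"
proof -
  have "f x = g x" using eventually_nhds_x_imp_x[OF assms(2)] .
  moreover have "\<forall>\<^sub>F t in nhds x. t \<in> UNIV \<longrightarrow> f t = g t" using assms(2) by simp
  ultimately show ?thesis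
    using has_vector_derivative_cong_ev[of UNIV f g x v] assms(1) by simp
qed

lemma curve_inI:
  assumes "e > 0" "smooth_on {-e<..<e} c" "\<And>t. \<bar>t\<bar> < e \<Longrightarrow> c t \<in> M" "c 0 = x"
    "(c has_vector_derivative v) (at 0)"
  shows "curve_in M x v c"
  unfolding curve_in_def using assms by (auto intro!: exI[of _ e])

lemma curve_inD:
  assumes "curve_in M x v c"
  shows "c 0 = x" "(c has_vector_derivative v) (at 0)" "\<forall>\<^sub>F t in nhds 0. c t \<in> M" "x \<in> M"
proof -
  obtain e where e: "e > 0" "\<And>t. t \<in> {-e<..<e} \<Longrightarrow> c t \<in> M"
    using assms unfolding curve_in_def by blast
  show "c 0 = x" "(c has_vector_derivative v) (at 0)"
    using assms unfolding curve_in_def by auto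
  then show "x \<in> M" using e(2)[of 0] e(1) by auto
  show "\<forall>\<^sub>F t in nhds 0. c t \<in> M"
    using e eventually_nhds_in_open[of "{-e<..<e}" "0::real"] by (auto elim!: eventually_mono)
qed

text \<open>By the chain rule every curve with velocity \<open>v\<close> gives the same value \<open>h' v\<close>, and there is at
  least one such curve; hence the definite description is determined by any extension.\<close>

lemma mdiff_eqI:
  assumes v: "v \<in> tangent_space M x"
    and h: "(h has_derivative h') (at x)" "\<And>y. y \<in> M \<Longrightarrow> h y = f y"
  shows "mdiff M f x v = h' v"
proof -
  have deriv: "((\<lambda>t. f (c t)) has_vector_derivative h' v) (at 0)" if c: "curve_in M x v c" for c
  proof -
    have "((\<lambda>t. h (c t)) has_vector_derivative h' v) (at 0)"
      using has_vector_derivative_chain_at[OF curve_inD(2)[OF c], of h h'] curve_inD(1)[OF c] h(1)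
      by simp
    moreover have "\<forall>\<^sub>F t in nhds 0. h (c t) = f (c t)"
      using curve_inD(3)[OF c] by eventually_elim (rule h(2))
    ultimately show ?thesis
      by (rule has_vector_derivative_eventually_eq)
  qed
  obtain c0 where c0: "curve_in M x v c0" using v by (auto simp: tangent_space_def)
  show ?thesis
    unfolding mdiff_def
  proof (rule the_equality)
    fix w assume "\<forall>c. curve_in M x v c \<longrightarrow> ((\<lambda>t. f (c t)) has_vector_derivative w) (at 0)"
    then show "w = h' v" using deriv[OF c0] c0 vector_derivative_unique_at by blast
  qed (use deriv in blast)
qed

text \<open>The difference quotients lie in the subspace, and subspaces are closed.\<close>

lemma tangent_in_subspace:
  fixes S :: "'a::euclidean_space set"
  assumes S: "subspace S" and c: "(c has_vector_derivative v) (at 0)" "\<forall>\<^sub>F t in nhds (0::real). c t \<in> S"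
  shows "v \<in> S"
proof (rule Lim_in_closed_set)
  show "closed S" using closed_subspace[OF S] .
  show "((\<lambda>t. (c t - c 0) /\<^sub>R t) \<longlongrightarrow> v) (at 0)"
  proof -
    have "(\<lambda>h. norm (c h - c 0 - h *\<^sub>R v) / norm h) \<midarrow>0\<rightarrow> 0"
      using c(1) by (simp add: has_vector_derivative_def has_derivative_at)
    moreover have "norm (c h - c 0 - h *\<^sub>R v) / norm h = norm ((c h - c 0) /\<^sub>R h - v)" if "h \<noteq> 0" for h
    proof -
      have "(c h - c 0) /\<^sub>R h - v = (c h - c 0 - h *\<^sub>R v) /\<^sub>R h"
        using that by (simp add: scaleR_diff_right)
      then show ?thesis by (simp add: divide_inverse mult.commute)
    qed
    ultimately have "(\<lambda>h. norm ((c h - c 0) /\<^sub>R h - v)) \<midarrow>0\<rightarrow> 0"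
      by (simp cong: LIM_cong)
    then show ?thesis
      by (simp add: LIM_zero_iff tendsto_norm_zero_iff)
  qed
  have "c 0 \<in> S" using c(2) eventually_nhds_x_imp_x by blast
  then show "\<forall>\<^sub>F t in at 0. (c t - c 0) /\<^sub>R t \<in> S"
    using c(2) unfolding eventually_at_filter
    by (auto elim!: eventually_mono intro: subspace_scale[OF S] subspace_diff[OF S])
qed simp

lemma tangent_to_sphere:
  assumes c: "(c has_vector_derivative v) (at 0)" "\<forall>\<^sub>F t in nhds (0::real). norm (c t) = r"
  shows "c 0 \<bullet> v = 0"
proof -
  have "((\<lambda>t. c t \<bullet> c t) has_vector_derivative c 0 \<bullet> v + v \<bullet> c 0) (at 0)"
    using bounded_bilinear.has_vector_derivative[OF bounded_bilinear_inner c(1) c(1)] by simp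
  moreover have "((\<lambda>t. c t \<bullet> c t) has_vector_derivative 0) (at 0)"
  proof -
    have "((\<lambda>t. r\<^sup>2) has_vector_derivative 0) (at 0)" by simp
    moreover have "\<forall>\<^sub>F t in nhds 0. r\<^sup>2 = c t \<bullet> c t"
      using c(2) by eventually_elim (simp add: dot_square_norm)
    ultimately show ?thesis
      by (rule has_vector_derivative_eventually_eq)
  qed
  ultimately have "c 0 \<bullet> v + v \<bullet> c 0 = 0" using vector_derivative_unique_at by blast
  then show ?thesis by (simp add: inner_commute)
qed

section \<open>Binary forms and their coefficients\<close>

type_synonym 'n form = "complex^'n"

lemma card_Suc: "CARD('n::finite) = Suc (CARD('n) - 1)"
  by simp

lemma zexp_less: "zexp (i :: 'n::{finite,linorder}) < CARD('n)"
  unfolding zexp_def by (rule psubset_card_mono) auto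

lemma inj_zexp: "inj (zexp :: 'n::{finite,linorder} \<Rightarrow> nat)"
proof (rule linorder_injI)
  fix i j :: 'n assume "i < j"
  then have "zexp i < zexp j"
    unfolding zexp_def by (intro psubset_card_mono) auto
  then show "zexp i \<noteq> zexp j" by simp
qed

lemma bij_zexp: "bij_betw (zexp :: 'n::{finite,linorder} \<Rightarrow> nat) UNIV {..<CARD('n)}"
proof (rule bij_betw_imageI[OF inj_zexp])
  show "range (zexp :: 'n \<Rightarrow> nat) = {..<CARD('n)}"
    by (rule card_subset_eq) (auto simp: zexp_less card_image inj_zexp)
qed

lemma sum_zexp: "(\<Sum>i\<in>UNIV. f (zexp (i :: 'n::{finite,linorder}))) = (\<Sum>h<CARD('n). f h)"
  by (rule sum.reindex_bij_betw[OF bij_zexp])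

text \<open>Coefficients are indexed by all integers, with value \<open>0\<close> outside the range of exponents.
  The operators of the Lie algebra are three-term recurrences in the exponent, and with this
  convention they need no case distinction at the two ends.\<close>

definition cf :: "'n::{finite,linorder} form \<Rightarrow> int \<Rightarrow> complex" where
  "cf a h = (\<Sum>i\<in>UNIV. if int (zexp i) = h then a $ i else 0)"

definition of_cf :: "(int \<Rightarrow> complex) \<Rightarrow> 'n::{finite,linorder} form" where
  "of_cf f = (\<chi> i. f (int (zexp i)))"

lemma cf_zexp [simp]: "cf a (int (zexp i)) = a $ i"
proof -
  have "cf a (int (zexp i)) = (\<Sum>j\<in>UNIV. if j = i then a $ j else 0)"
    unfolding cf_def by (rule sum.cong) (auto dest: injD[OF inj_zexp])
  then show ?thesis by simp
qed

lemma cf_outside: "h < 0 \<or> h \<ge> int CARD('n) \<Longrightarrow> cf (a :: 'n::{finite,linorder} form) h = 0"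
proof -
  assume h: "h < 0 \<or> h \<ge> int CARD('n)"
  have "int (zexp i) \<noteq> h" for i :: 'n using zexp_less[of i] h by linarith
  then show ?thesis by (simp add: cf_def)
qed

lemma zexp_surj:
  assumes "0 \<le> h" "h < int CARD('n)"
  obtains i :: "'n::{finite,linorder}" where "h = int (zexp i)"
proof -
  have "nat h \<in> zexp ` (UNIV :: 'n set)"
    unfolding bij_betw_imp_surj_on[OF bij_zexp] using assms by auto
  then obtain i :: 'n where "nat h = zexp i" by blast
  then have "h = int (zexp i)" using assms(1) by linarith
  then show ?thesis by (rule that)
qed

lemma cf_of_cf: "cf (of_cf f :: 'n::{finite,linorder} form) h = (if 0 \<le> h \<and> h < int CARD('n) then f h else 0)"
proof (cases "0 \<le> h \<and> h < int CARD('n)")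
  case True
  then obtain i :: 'n where "h = int (zexp i)" using zexp_surj by blast
  then show ?thesis using True by (simp add: of_cf_def)
qed (auto simp: cf_outside)

lemma cf_eqI: "(\<And>h. cf a h = cf b h) \<Longrightarrow> a = b"
  unfolding vec_eq_iff by (metis cf_zexp)

lemma cf_add [simp]: "cf (a + b) h = cf a h + cf b h"
  by (simp add: cf_def flip: sum.distrib) (rule sum.cong, auto)

lemma cf_diff [simp]: "cf (a - b) h = cf a h - cf b h"
  by (simp add: cf_def flip: sum_subtractf) (rule sum.cong, auto)

lemma cf_zero [simp]: "cf 0 h = 0"
  unfolding cf_def zero_index by simp

lemma cf_minus [simp]: "cf (- a) h = - cf a h"
  using cf_diff[of 0 a h] by simp

lemma cf_scale [simp]: "cf (\<chi> i. c * a $ i) h = c * cf a h"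
  by (simp add: cf_def sum_distrib_left) (rule sum.cong, auto)

lemma cf_scaleR [simp]: "cf (r *\<^sub>R a) h = r *\<^sub>R cf a h"
  by (simp add: cf_def scaleR_sum_right) (rule sum.cong, auto)

lemma hpoly_cf:
  "hpoly (a :: 'n::{finite,linorder} form) v =
    (\<Sum>h<CARD('n). cf a (int h) * (v $ 1) ^ h * (v $ 2) ^ (CARD('n) - 1 - h))"
  using sum_zexp[where 'n='n, of "\<lambda>h. cf a (int h) * (v $ 1) ^ h * (v $ 2) ^ (CARD('n) - 1 - h)"]
  by (simp add: hpoly_def wexp_def)

text \<open>On the line \<open>w = 1\<close> the form is a polynomial in \<open>z\<close> with the same coefficients.\<close>

lemma hpoly_inj:
  fixes a b :: "'n::{finite,linorder} form"
  assumes "\<And>v. hpoly a v = hpoly b v"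
  shows "a = b"
proof -
  have rng: "{..<CARD('n)} = {..CARD('n) - 1}"
    using zero_less_card_finite[where 'a='n] by (auto simp: le_eq_less_or_eq)
  have eq: "(\<Sum>h\<le>CARD('n)-1. cf a (int h) * t ^ h) = (\<Sum>h\<le>CARD('n)-1. cf b (int h) * t ^ h)" for t
    using assms[of "vector [t, 1]"] by (simp add: hpoly_cf rng)
  then have "\<forall>h\<le>CARD('n)-1. cf a (int h) = cf b (int h)"
    by (subst polyfun_eq_coeffs[symmetric]) simp
  then have "a $ i = b $ i" for i
    using zexp_less[of i] by (metis cf_zexp Suc_pred' less_Suc_eq_le zero_less_card_finite)
  then show ?thesis by (simp add: vec_eq_iff)
qed

lemma hpoly_add: "hpoly (a + b) v = hpoly a v + hpoly b v"
  by (simp add: hpoly_def sum.distrib algebra_simps)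

lemma hpoly_scale: "hpoly (\<chi> i. c * a $ i) v = c * hpoly a v"
  by (simp add: hpoly_def sum_distrib_left algebra_simps)

lemma hpoly_scaleR: "hpoly (r *\<^sub>R a) v = r *\<^sub>R hpoly a v"
  by (simp add: hpoly_def scaleR_sum_right)

lemma linear_hpoly: "linear (\<lambda>a. hpoly a v)"
  by (intro linearI) (simp_all add: hpoly_add hpoly_scaleR)

section \<open>Linear substitutions\<close>

lemma matrix_vector_2:
  fixes N :: "complex^2^2"
  shows "(N *v v) $ 1 = N $ 1 $ 1 * v $ 1 + N $ 1 $ 2 * v $ 2"
    "(N *v v) $ 2 = N $ 2 $ 1 * v $ 1 + N $ 2 $ 2 * v $ 2"
  by (simp_all add: matrix_vector_mult_def sum_2)

text \<open>The coefficient of \<open>z ^ m * w ^ (k - m)\<close> in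
  \<open>(N11 z + N12 w) ^ h * (N21 z + N22 w) ^ (k - h)\<close>.\<close>

definition subst_coeff :: "complex^2^2 \<Rightarrow> nat \<Rightarrow> nat \<Rightarrow> nat \<Rightarrow> complex" where
  "subst_coeff N k h m = (\<Sum>j\<le>h. \<Sum>l\<le>k-h. if j + l = m then
     (of_nat (h choose j) * N$1$1 ^ j * N$1$2 ^ (h - j)) *
     (of_nat ((k-h) choose l) * N$2$1 ^ l * N$2$2 ^ (k - h - l)) else 0)"

definition pact :: "complex^2^2 \<Rightarrow> 'n::{finite,linorder} form \<Rightarrow> 'n form" where
  "pact N a = (\<chi> i. \<Sum>j\<in>UNIV. a $ j * subst_coeff N (CARD('n) - 1) (zexp j) (zexp i))"

lemma sum_subst_coeff:
  assumes "h \<le> k"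
  shows "(\<Sum>m\<le>k. subst_coeff N k h m * z ^ m * w ^ (k - m)) =
    (N$1$1 * z + N$1$2 * w) ^ h * (N$2$1 * z + N$2$2 * w) ^ (k - h)" (is "?L = ?R")
proof -
  define A where "A j = of_nat (h choose j) * N$1$1 ^ j * N$1$2 ^ (h - j)" for j
  define B where "B l = of_nat ((k-h) choose l) * N$2$1 ^ l * N$2$2 ^ (k - h - l)" for l
  have "?L = (\<Sum>m\<le>k. \<Sum>j\<le>h. \<Sum>l\<le>k-h. if j + l = m then A j * B l * z ^ m * w ^ (k - m) else 0)"
    by (simp add: subst_coeff_def A_def B_def sum_distrib_right if_distrib[of "\<lambda>x. x * _"] cong: if_cong)
  also have "\<dots> = (\<Sum>j\<le>h. \<Sum>l\<le>k-h. \<Sum>m\<le>k. if j + l = m then A j * B l * z ^ m * w ^ (k - m) else 0)"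
    by (subst sum.swap, rule sum.cong[OF refl], rule sum.swap)
  also have "\<dots> = (\<Sum>j\<le>h. \<Sum>l\<le>k-h. (A j * z ^ j * w ^ (h - j)) * (B l * z ^ l * w ^ (k - h - l)))"
  proof (intro sum.cong refl)
    fix j l assume "j \<in> {..h}" "l \<in> {..k-h}"
    then have *: "j + l \<le> k" "k - (j + l) = (h - j) + (k - h - l)" using assms by auto
    have "(\<Sum>m\<le>k. if j + l = m then A j * B l * z ^ m * w ^ (k - m) else 0) =
        A j * B l * z ^ (j + l) * w ^ (k - (j + l))"
      using *(1) by (simp add: sum.delta)
    then show "(\<Sum>m\<le>k. if j + l = m then A j * B l * z ^ m * w ^ (k - m) else 0) =
        (A j * z ^ j * w ^ (h - j)) * (B l * z ^ l * w ^ (k - h - l))"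
      unfolding *(2) by (simp add: power_add)
  qed
  also have "\<dots> = (\<Sum>j\<le>h. A j * z ^ j * w ^ (h - j)) * (\<Sum>l\<le>k-h. B l * z ^ l * w ^ (k - h - l))"
    by (simp add: sum_product)
  also have "\<dots> = ?R"
    unfolding binomial_ring A_def B_def power_mult_distrib by (simp only: mult_ac)
  finally show ?thesis .
qed

text \<open>Since a form is determined by its values, the algebraic properties of \<open>pact\<close> follow from this
  identity without reference to the coefficients.\<close>

lemma hpoly_pact: "hpoly (pact N a) v = hpoly (a :: 'n::{finite,linorder} form) (N *v v)"
proof -
  let ?k = "CARD('n) - 1"
  have rng: "{..<CARD('n)} = {..?k}"
    using zero_less_card_finite[where 'a='n] by (auto simp: le_eq_less_or_eq)
  have "hpoly (pact N a) v = (\<Sum>j\<in>UNIV. a $ j * (\<Sum>i\<in>(UNIV::'n set). subst_coeff N ?k (zexp j) (zexp i) * v $ 1 ^ zexp i * v $ 2 ^ (?k - zexp i)))"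
    unfolding hpoly_def pact_def wexp_def vec_lambda_beta sum_distrib_right sum_distrib_left
    by (subst sum.swap) (simp add: mult.assoc)
  also have "\<dots> = (\<Sum>j\<in>UNIV. a $ j * (\<Sum>m\<le>?k. subst_coeff N ?k (zexp j) m * v $ 1 ^ m * v $ 2 ^ (?k - m)))"
    using sum_zexp[where 'n='n, of "\<lambda>m. subst_coeff N ?k _ m * v $ 1 ^ m * v $ 2 ^ (?k - m)"]
    by (simp add: rng)
  also have "\<dots> = hpoly a (N *v v)"
    unfolding hpoly_def wexp_def matrix_vector_2
  proof (rule sum.cong[OF refl])
    fix j :: 'n
    have "zexp j \<le> ?k" using zexp_less[of j] by linarith
    show "a $ j * (\<Sum>m\<le>?k. subst_coeff N ?k (zexp j) m * v $ 1 ^ m * v $ 2 ^ (?k - m)) =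
        a $ j * (N$1$1 * v$1 + N$1$2 * v$2) ^ zexp j * (N$2$1 * v$1 + N$2$2 * v$2) ^ (?k - zexp j)"
      unfolding sum_subst_coeff[OF \<open>zexp j \<le> ?k\<close>] by (simp only: mult.assoc)
  qed
  finally show ?thesis .
qed

text \<open>Substitution is a right action.\<close>

lemma pact_pact: "pact N (pact M a) = pact (M ** N) a"
  by (rule hpoly_inj) (simp add: hpoly_pact matrix_vector_mul_assoc)

lemma pact_one [simp]: "pact (mat 1) a = a"
  by (rule hpoly_inj) (simp add: hpoly_pact)

lemma pact_add: "pact N (a + b) = pact N a + pact N b"
  by (rule hpoly_inj) (simp add: hpoly_pact hpoly_add)

lemma pact_scale: "pact N (\<chi> i. c * a $ i) = (\<chi> i. c * pact N a $ i)"
  by (rule hpoly_inj) (simp add: hpoly_pact hpoly_scale)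

lemma pact_scaleR: "pact N (r *\<^sub>R a) = r *\<^sub>R pact N a"
  by (rule hpoly_inj) (simp add: hpoly_pact hpoly_scaleR)

lemma linear_pact: "linear (pact N)"
  by (intro linearI) (simp_all add: pact_add pact_scaleR)

lemmas pact_zero [simp] = linear_0[OF linear_pact]

lemma grp_act_pact: "grp_act g a = pact (matrix_inv g) a"
  unfolding grp_act_def
  by (rule the_equality) (auto simp: hpoly_pact intro: hpoly_inj)

lemma smooth_on_pact [smooth_intros]:
  "smooth_on U f \<Longrightarrow> smooth_on U g \<Longrightarrow> smooth_on U (\<lambda>x. pact (f x) (g x))"
proof -
  assume f: "smooth_on U f" and g: "smooth_on U g"
  have o: "open U" using smooth_on_open[OF f] .
  have s: "smooth_on U (\<lambda>x. subst_coeff (f x) k h m)" for k h m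
  proof -
    have "smooth_on U (\<lambda>x. if j + l = m then
     (of_nat (h choose j) * f x$1$1 ^ j * f x$1$2 ^ (h - j)) *
     (of_nat ((k-h) choose l) * f x$2$1 ^ l * f x$2$2 ^ (k - h - l)) else 0)" for j l
      by (cases "j + l = m") (simp_all, (intro smooth_intros f o)+)
    then show ?thesis unfolding subst_coeff_def by (intro smooth_on_sum o)
  qed
  show ?thesis
    unfolding pact_def by (intro smooth_intros o s g)
qed

section \<open>The infinitesimal action\<close>

text \<open>The vector field \<open>(b11 z + b12 w) d/dz + (b21 z + b22 w) d/dw\<close>, acting on forms.\<close>

definition der :: "complex^2^2 \<Rightarrow> 'n::{finite,linorder} form \<Rightarrow> 'n form" where
  "der B a = of_cf (\<lambda>h. (of_int h * B$1$1 + of_int (int (CARD('n) - 1) - h) * B$2$2) * cf a h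
     + of_int (h + 1) * B$1$2 * cf a (h + 1)
     + of_int (int (CARD('n) - 1) - h + 1) * B$2$1 * cf a (h - 1))"

lemma cf_der:
  fixes a :: "'n::{finite,linorder} form"
  shows "cf (der B a) h = (of_int h * B$1$1 + of_int (int (CARD('n) - 1) - h) * B$2$2) * cf a h
     + of_int (h + 1) * B$1$2 * cf a (h + 1)
     + of_int (int (CARD('n) - 1) - h + 1) * B$2$1 * cf a (h - 1)"
proof (cases "0 \<le> h \<and> h < int CARD('n)")
  case True
  then show ?thesis by (simp add: der_def cf_of_cf)
next
  case False
  have c: "int (CARD('n) - 1) = int CARD('n) - 1"
    using zero_less_card_finite[where 'a='n] by linarith
  consider "h < -1" | "h = -1" | "h = int CARD('n)" | "h > int CARD('n)" using False by linarith
  then show ?thesis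
    by cases (simp_all add: cf_outside c)
qed

lemma der_add: "der B (a + b) = der B a + der B b"
  by (rule cf_eqI) (simp add: cf_der algebra_simps)

lemma der_add_left: "der (A + B) a = der A a + der B a"
  by (rule cf_eqI) (simp add: cf_der algebra_simps)

lemma der_minus_left: "der (- B) a = - der B a"
  by (rule cf_eqI) (simp add: cf_der algebra_simps)

lemma der_scale_left: "der (\<chi> i j. c * B $ i $ j) a = (\<chi> i. c * der B a $ i)"
  by (rule cf_eqI) (simp add: cf_der algebra_simps)

lemma der_scaleR_left: "der (r *\<^sub>R B) a = r *\<^sub>R der B a"
  by (rule cf_eqI) (simp add: cf_der algebra_simps)

lemma der_zero [simp]: "der B 0 = 0"
  by (rule cf_eqI) (simp add: cf_der)

lemma linear_der_left: "linear (\<lambda>B. der B a)"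
  by (intro linearI) (simp_all add: der_add_left der_scaleR_left)

text \<open>The differential of a right action reverses commutators.\<close>

lemma der_commutator:
  "der A (der B a) - der B (der A a) = der (B ** A - A ** B) a"
proof (rule cf_eqI)
  fix h :: int
  have e: "h + 1 - 1 = h" "h - 1 + 1 = h" "h + 1 + 1 = h + 2" "h - 1 - 1 = h - 2" by simp_all
  show "cf (der A (der B a) - der B (der A a)) h = cf (der (B ** A - A ** B) a) h"
    unfolding cf_diff cf_der matrix_matrix_mult_def vector_minus_component vec_lambda_beta sum_2 e
      of_int_add of_int_diff of_int_1 by algebra
qed

text \<open>The right-hand side is the derivative of the form along the vector field.  Its mixed terms move the
  exponent by one; reindexing their sums leaves no boundary terms, since each of these has a zero
  coefficient or a zero factor.\<close>

lemma hpoly_der: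
  fixes a :: "'n::{finite,linorder} form"
  defines "k \<equiv> CARD('n) - 1"
  shows "hpoly (der B a) v = (\<Sum>i\<in>UNIV. a $ i *
     (of_nat (zexp i) * v $ 1 ^ (zexp i - 1) * (B *v v) $ 1 * v $ 2 ^ (k - zexp i)
      + v $ 1 ^ zexp i * (of_nat (k - zexp i) * v $ 2 ^ (k - zexp i - 1) * (B *v v) $ 2)))"
proof -
  define z where "z = v $ 1"
  define w where "w = v $ 2"
  have cs: "CARD('n) = Suc k" unfolding k_def by (rule card_Suc)
  have c: "{..<CARD('n)} = {..k}" "int CARD('n) = int k + 1"
    unfolding cs by (auto simp: lessThan_Suc_atMost)
  define \<alpha> where "\<alpha> h = cf a (int h)" for h
  have \<alpha>0: "\<alpha> (Suc k) = 0" "cf a (-1) = 0" by (auto simp: \<alpha>_def cf_outside c)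
  have R: "(\<Sum>i\<in>UNIV. a $ i *
     (of_nat (zexp i) * v $ 1 ^ (zexp i - 1) * (B *v v) $ 1 * v $ 2 ^ (k - zexp i)
      + v $ 1 ^ zexp i * (of_nat (k - zexp i) * v $ 2 ^ (k - zexp i - 1) * (B *v v) $ 2))) =
     (\<Sum>h\<le>k. \<alpha> h *
     (of_nat h * z ^ (h - 1) * (B$1$1 * z + B$1$2 * w) * w ^ (k - h)
      + z ^ h * (of_nat (k - h) * w ^ (k - h - 1) * (B$2$1 * z + B$2$2 * w))))"
    unfolding c(1)[symmetric] \<alpha>_def sum_zexp[where 'n='n, symmetric]
    by (simp add: matrix_vector_2 z_def w_def)
  have t1: "(\<Sum>h\<le>k. \<alpha> h * of_nat h * z ^ (h - 1) * w ^ (k - h) * w) =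
      (\<Sum>h\<le>k. of_nat (h + 1) * \<alpha> (h + 1) * z ^ h * w ^ (k - h))" (is "?L = ?R")
  proof -
    have "?R = (\<Sum>h<k. of_nat (h + 1) * \<alpha> (h + 1) * z ^ h * w ^ (k - h))"
      by (simp add: lessThan_Suc_atMost[symmetric] \<alpha>0)
    also have "\<dots> = (\<Sum>h<k. \<alpha> (Suc h) * of_nat (Suc h) * z ^ h * w ^ (k - Suc h) * w)"
    proof (rule sum.cong[OF refl])
      fix h assume "h \<in> {..<k}"
      then have "k - h = Suc (k - Suc h)" by auto
      then show "of_nat (h + 1) * \<alpha> (h + 1) * z ^ h * w ^ (k - h) =
          \<alpha> (Suc h) * of_nat (Suc h) * z ^ h * w ^ (k - Suc h) * w" by simp
    qed
    also have "\<dots> = ?L"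
      unfolding lessThan_Suc_atMost[symmetric] sum.lessThan_Suc_shift by simp
    finally show ?thesis ..
  qed
  have t2: "(\<Sum>h\<le>k. \<alpha> h * z ^ h * of_nat (k - h) * w ^ (k - h - 1) * z) =
      (\<Sum>h\<le>k. of_nat (k + 1 - h) * cf a (int h - 1) * z ^ h * w ^ (k - h))" (is "?L = ?R")
  proof -
    have "?L = (\<Sum>h<k. \<alpha> h * z ^ h * of_nat (k - h) * w ^ (k - h - 1) * z)"
      by (simp add: lessThan_Suc_atMost[symmetric])
    also have "\<dots> = (\<Sum>h<k. of_nat (k + 1 - Suc h) * cf a (int (Suc h) - 1) * z ^ Suc h * w ^ (k - Suc h))"
      by (rule sum.cong[OF refl]) (simp add: \<alpha>_def)
    also have "\<dots> = ?R"
      unfolding lessThan_Suc_atMost[symmetric] sum.lessThan_Suc_shift by (simp add: \<alpha>0)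
    finally show ?thesis .
  qed
  have p1: "of_nat h * z ^ (h - 1) * z = of_nat h * z ^ h" for h by (cases h) auto
  have p2: "of_nat (k - h) * w ^ (k - h - 1) * w = of_nat (k - h) * w ^ (k - h)" for h
    by (cases "k - h") auto
  have "(\<Sum>h\<le>k. \<alpha> h *
     (of_nat h * z ^ (h - 1) * (B$1$1 * z + B$1$2 * w) * w ^ (k - h)
      + z ^ h * (of_nat (k - h) * w ^ (k - h - 1) * (B$2$1 * z + B$2$2 * w)))) =
     (\<Sum>h\<le>k. \<alpha> h * B$1$1 * (of_nat h * z ^ (h - 1) * z) * w ^ (k - h)) +
     B$1$2 * (\<Sum>h\<le>k. \<alpha> h * of_nat h * z ^ (h - 1) * w ^ (k - h) * w) +
     B$2$1 * (\<Sum>h\<le>k. \<alpha> h * z ^ h * of_nat (k - h) * w ^ (k - h - 1) * z) +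
     (\<Sum>h\<le>k. \<alpha> h * B$2$2 * z ^ h * (of_nat (k - h) * w ^ (k - h - 1) * w))"
    unfolding sum_distrib_left sum.distrib[symmetric]
    by (rule sum.cong[OF refl]) (simp add: algebra_simps)
  also have "\<dots> = (\<Sum>h\<le>k. ((of_nat h * B$1$1 + of_nat (k - h) * B$2$2) * \<alpha> h
     + of_nat (h + 1) * B$1$2 * \<alpha> (h + 1)
     + of_nat (k + 1 - h) * B$2$1 * cf a (int h - 1)) * z ^ h * w ^ (k - h))"
    unfolding t1 t2 p1 p2 sum_distrib_left sum.distrib[symmetric]
    by (rule sum.cong[OF refl]) (simp add: algebra_simps)
  also have "\<dots> = hpoly (der B a) v"
    unfolding hpoly_cf c(1) k_def[symmetric]
  proof (rule sum.cong[OF refl])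
    fix h assume "h \<in> {..k}"
    then have "of_nat (k + 1 - h) = (of_int (int k - int h + 1) :: complex)"
      "of_nat (k - h) = (of_int (int k - int h) :: complex)"
      by (auto simp: of_nat_diff)
    then show "((of_nat h * B$1$1 + of_nat (k - h) * B$2$2) * \<alpha> h
     + of_nat (h + 1) * B$1$2 * \<alpha> (h + 1)
     + of_nat (k + 1 - h) * B$2$1 * cf a (int h - 1)) * z ^ h * w ^ (k - h) =
     cf (der B a) (int h) * v $ 1 ^ h * v $ 2 ^ (k - h)"
      by (simp add: cf_der cs \<alpha>_def z_def w_def add.commute)
  qed
  finally show ?thesis unfolding R by simp
qed

text \<open>Smoothness provides some derivative.  Evaluation at a point \<open>v\<close> is linear and injective on forms and
  turns \<open>pact N a\<close> into the value of \<open>a\<close> at \<open>N v\<close>, whose derivative is elementary.\<close>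

lemma has_derivative_pact:
  fixes a :: "'n::{finite,linorder} form"
  shows "((\<lambda>p. pact (fst p) (snd p)) has_derivative (\<lambda>p. der (fst p) a + snd p)) (at (mat 1, a))"
proof -
  let ?F = "\<lambda>p. pact (fst p) (snd p :: 'n form)"
  let ?k = "CARD('n) - 1"
  define D where "D = frechet_derivative ?F (at (mat 1, a))"
  have "smooth_on UNIV ?F" by (intro smooth_intros open_UNIV)
  then have D: "(?F has_derivative D) (at (mat 1, a))"
    unfolding D_def by (rule smooth_on_has_derivative) simp
  have "D p = der (fst p) a + snd p" for p
  proof (rule hpoly_inj)
    fix v :: "complex^2"
    have 1: "((\<lambda>p. hpoly (?F p) v) has_derivative (\<lambda>p. hpoly (D p) v)) (at (mat 1, a))"
      by (rule bounded_linear.has_derivative[OF linear_hpoly[THEN linear_conv_bounded_linear[THEN iffD1]] D])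
    have l: "((\<lambda>p::(complex^2^2) \<times> 'n form. (fst p *v v) $ j) has_derivative (\<lambda>p. (fst p *v v) $ j)) (at (mat 1, a))" for j
      unfolding matrix_vector_mult_def vec_lambda_beta
      by (intro has_derivative_sum has_derivative_mult_left bounded_linear_imp_has_derivative
          bounded_linear_compose[OF bounded_linear_vec_nth] bounded_linear_fst)
    have n: "((\<lambda>p::(complex^2^2) \<times> 'n form. snd p $ j) has_derivative (\<lambda>p. snd p $ j)) (at (mat 1, a))" for j
    proof (rule bounded_linear_imp_has_derivative)
      show "bounded_linear (\<lambda>p::(complex^2^2) \<times> 'n form. snd p $ j)"
        unfolding linear_conv_bounded_linear[symmetric] by (intro linearI) simp_all
    qed
    have pw: "((\<lambda>p::(complex^2^2) \<times> ('n form). ((fst p *v v) $ j) ^ m) has_derivative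
        (\<lambda>p. of_nat m * (fst p *v v) $ j * (v $ j) ^ (m - 1))) (at (mat 1, a))" for j m
      using has_derivative_power[OF l[of j], of m] by simp
    have "((\<lambda>p. \<Sum>i\<in>UNIV. snd p $ i * ((fst p *v v) $ 1) ^ zexp i * ((fst p *v v) $ 2) ^ (?k - zexp i)) has_derivative
        (\<lambda>p. (\<Sum>i\<in>UNIV. (a $ i * v $ 1 ^ zexp i) * (of_nat (?k - zexp i) * (fst p *v v) $ 2 * v $ 2 ^ (?k - zexp i - 1)) +
           (a $ i * (of_nat (zexp i) * (fst p *v v) $ 1 * v $ 1 ^ (zexp i - 1)) + snd p $ i * v $ 1 ^ zexp i) * v $ 2 ^ (?k - zexp i))))
        (at (mat 1, a))" (is "(_ has_derivative ?D') _")
    proof (rule has_derivative_sum)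
      fix i :: 'n
      show "((\<lambda>p. snd p $ i * ((fst p *v v) $ 1) ^ zexp i * ((fst p *v v) $ 2) ^ (?k - zexp i)) has_derivative
        (\<lambda>p. (a $ i * v $ 1 ^ zexp i) * (of_nat (?k - zexp i) * (fst p *v v) $ 2 * v $ 2 ^ (?k - zexp i - 1)) +
           (a $ i * (of_nat (zexp i) * (fst p *v v) $ 1 * v $ 1 ^ (zexp i - 1)) + snd p $ i * v $ 1 ^ zexp i) * v $ 2 ^ (?k - zexp i)))
        (at (mat 1, a))"
        using has_derivative_mult[OF has_derivative_mult[OF n[of i] pw[of 1 "zexp i"]] pw[of 2 "?k - zexp i"]]
        by simp
    qed
    moreover have "?D' = (\<lambda>p. (\<Sum>i\<in>UNIV. a $ i *
     (of_nat (zexp i) * v $ 1 ^ (zexp i - 1) * (fst p *v v) $ 1 * v $ 2 ^ (?k - zexp i)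
      + v $ 1 ^ zexp i * (of_nat (?k - zexp i) * v $ 2 ^ (?k - zexp i - 1) * (fst p *v v) $ 2))) +
      (\<Sum>i\<in>UNIV. snd p $ i * v $ 1 ^ zexp i * v $ 2 ^ (?k - zexp i)))"
      unfolding sum.distrib[symmetric] by (intro ext sum.cong refl) (simp add: algebra_simps)
    ultimately have "((\<lambda>p. hpoly (snd p) (fst p *v v)) has_derivative
        (\<lambda>p. hpoly (der (fst p) a) v + hpoly (snd p) v)) (at (mat 1, a))"
      unfolding hpoly_der unfolding hpoly_def wexp_def by simp
    then have 2: "((\<lambda>p. hpoly (?F p) v) has_derivative (\<lambda>p. hpoly (der (fst p) a) v + hpoly (snd p) v)) (at (mat 1, a))"
      by (simp add: hpoly_pact)
    show "hpoly (D p) v = hpoly (der (fst p) a + snd p) v"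
      using has_derivative_unique[OF 1 2] by (metis hpoly_add)
  qed
  then show ?thesis using D by presburger
qed

section \<open>The real structure\<close>

text \<open>Multiplication of \<open>v\<close>, seen as a quaternion, by the unit \<open>j\<close>.\<close>

definition quat_J :: "complex^2 \<Rightarrow> complex^2" where
  "quat_J v = vector [- cnj (v $ 2), cnj (v $ 1)]"

text \<open>The first equation exhibits \<open>theta\<close> as composition with \<open>quat_J\<close> and complex conjugation, from
  which equivariance is clear.  In the second the even degree makes the signs of the exponents \<open>h\<close>
  and \<open>CARD('n) - 1 - h\<close> equal.\<close>

lemma theta_eq:
  fixes a :: "'n::{finite,linorder} form"
  assumes "odd CARD('n)"
  shows "hpoly (theta a) v = cnj (hpoly a (quat_J v))"
    "cf (theta a) h = (if even h then 1 else -1) * cnj (cf a (int CARD('n) - 1 - h))"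
proof -
  let ?k = "CARD('n) - 1"
  define \<epsilon> :: "int \<Rightarrow> complex" where "\<epsilon> h = (if even h then 1 else -1)" for h
  have ck: "int CARD('n) - 1 = int ?k" using zero_less_card_finite[where 'a='n] by linarith
  have ek: "even ?k" using assms by simp
  define b :: "'n form" where "b = of_cf (\<lambda>h. \<epsilon> h * cnj (cf a (int ?k - h)))"
  have b: "hpoly b v = (\<Sum>i\<in>UNIV. (-1) ^ zexp i * cnj (a $ i) * (v $ 2) ^ zexp i * (v $ 1) ^ wexp i)" for v
  proof -
    have "hpoly b v = (\<Sum>h<CARD('n). \<epsilon> (int h) * cnj (cf a (int ?k - int h)) * v $ 1 ^ h * v $ 2 ^ (?k - h))"
      unfolding hpoly_cf b_def by (intro sum.cong refl) (simp add: cf_of_cf)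
    also have "\<dots> = (\<Sum>h<CARD('n). \<epsilon> (int (?k - h)) * cnj (cf a (int ?k - int (?k - h))) * v $ 1 ^ (?k - h) * v $ 2 ^ (?k - (?k - h)))"
      by (subst sum.nat_diff_reindex[symmetric]) simp
    also have "\<dots> = (\<Sum>h<CARD('n). (-1) ^ h * cnj (cf a (int h)) * v $ 2 ^ h * v $ 1 ^ (?k - h))"
    proof (rule sum.cong[OF refl])
      fix h assume "h \<in> {..<CARD('n)}"
      then have h: "h \<le> ?k" by auto
      then have "?k - (?k - h) = h" "int ?k - int (?k - h) = int h" by (simp_all only: diff_diff_cancel of_nat_diff)
      moreover have "even (?k - h) = even h" using h ek even_diff_nat[of ?k h] by fastforce
      ultimately
      show "\<epsilon> (int (?k - h)) * cnj (cf a (int ?k - int (?k - h))) * v $ 1 ^ (?k - h) * v $ 2 ^ (?k - (?k - h)) =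
          (-1) ^ h * cnj (cf a (int h)) * v $ 2 ^ h * v $ 1 ^ (?k - h)"
        by (simp add: \<epsilon>_def del: of_nat_diff)
    qed
    also have "\<dots> = (\<Sum>i\<in>UNIV. (-1) ^ zexp i * cnj (a $ i) * (v $ 2) ^ zexp i * (v $ 1) ^ wexp i)"
      unfolding sum_zexp[where 'n='n, symmetric] by (simp add: wexp_def)
    finally show ?thesis .
  qed
  have th: "theta a = b"
    unfolding theta_def by (rule the_equality) (auto simp: b intro: hpoly_inj)
  show "hpoly (theta a) v = cnj (hpoly a (quat_J v))"
    unfolding th b unfolding hpoly_def quat_J_def
    by (simp add: power_minus[of "cnj _"] mult_ac)
  show "cf (theta a) h = (if even h then 1 else -1) * cnj (cf a (int CARD('n) - 1 - h))"
    unfolding th b_def ck cf_of_cf by (auto simp: \<epsilon>_def cf_outside)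
qed

lemma theta_add: "odd CARD('n) \<Longrightarrow> theta (a + b :: 'n::{finite,linorder} form) = theta a + theta b"
  by (rule cf_eqI) (simp add: theta_eq algebra_simps)

lemma theta_diff: "odd CARD('n) \<Longrightarrow> theta (a - b :: 'n::{finite,linorder} form) = theta a - theta b"
  by (rule cf_eqI) (simp add: theta_eq algebra_simps)

lemma theta_scale: "odd CARD('n) \<Longrightarrow>
    theta (\<chi> i. c * (a :: 'n::{finite,linorder} form) $ i) = (\<chi> i. cnj c * theta a $ i)"
  by (rule cf_eqI) (simp add: theta_eq algebra_simps)

lemma theta_scaleR: "odd CARD('n) \<Longrightarrow>
    theta (r *\<^sub>R (a :: 'n::{finite,linorder} form)) = r *\<^sub>R theta a"
  by (rule cf_eqI) (simp add: theta_eq algebra_simps)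

lemma theta_theta: "odd CARD('n) \<Longrightarrow> theta (theta (a :: 'n::{finite,linorder} form)) = a"
  by (rule cf_eqI) (auto simp: theta_eq)

text \<open>The algebra of quaternions: the matrices that commute with the antilinear map
  \<open>quat_J\<close>.  It contains \<open>SU2\<close> as its unit sphere and \<open>su2\<close> as its imaginary part.\<close>

definition quat :: "(complex^2^2) set" where
  "quat = {A. A $ 2 $ 1 = - cnj (A $ 1 $ 2) \<and> A $ 2 $ 2 = cnj (A $ 1 $ 1)}"

lemma theta_pact:
  fixes a :: "'n::{finite,linorder} form"
  assumes "odd CARD('n)" "N \<in> quat"
  shows "theta (pact N a) = pact N (theta a)"
proof (rule hpoly_inj)
  fix v
  have "N *v quat_J v = quat_J (N *v v)"
    using assms(2) by (simp add: vec_eq_iff forall_2 matrix_vector_2 quat_J_def quat_def algebra_simps)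
  then show "hpoly (theta (pact N a)) v = hpoly (pact N (theta a)) v"
    by (simp add: theta_eq(1)[OF assms(1)] hpoly_pact)
qed

lemma subspace_V_real: "odd CARD('n) \<Longrightarrow> subspace (V_real :: ('n::{finite,linorder} form) set)"
proof -
  assume o: "odd CARD('n)"
  have "theta (0 :: 'n form) = 0" using theta_scaleR[OF o, of 0 0] by simp
  then show ?thesis
    using o by (simp add: subspace_def V_real_def theta_add theta_scaleR)
qed

text \<open>Multiplication by the imaginary unit carries a real form isomorphically to a complement.\<close>

lemma dim_real_form:
  fixes S :: "'a::euclidean_space set"
  assumes S: "subspace S" and j: "linear j" "inj j" "S \<inter> j ` S = {0}"
    "\<And>x. \<exists>a\<in>S. \<exists>b\<in>S. x = a + j b"
  shows "2 * dim S = DIM('a)"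
proof -
  have jS: "subspace (j ` S)" using linear_subspace_image[OF j(1) S] .
  have "dim {x + y |x y. x \<in> S \<and> y \<in> j ` S} + dim (S \<inter> j ` S) = dim S + dim (j ` S)"
    by (rule dim_sums_Int[OF S jS])
  moreover have "{x + y |x y. x \<in> S \<and> y \<in> j ` S} = UNIV" using j(4) by blast
  moreover have "dim (j ` S) = dim S"
    using dim_image_eq[OF j(1), of S] j(2) by (simp add: inj_on_subset)
  ultimately show ?thesis using j(3) by simp
qed

lemma dim_V_real:
  assumes "odd CARD('n)"
  shows "dim (V_real :: ('n::{finite,linorder} form) set) = CARD('n)"
proof -
  let ?j = "\<lambda>a :: 'n form. \<chi> i. \<i> * a $ i"
  have th: "theta (?j a) = - ?j (theta a)" for a
    unfolding theta_scale[OF assms] by (simp add: vec_eq_iff)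
  have 1: "V_real \<inter> ?j ` V_real = {0}"
  proof (intro equalityI subsetI)
    fix x assume "x \<in> V_real \<inter> ?j ` V_real"
    then obtain a where a: "theta a = a" "x = ?j a" "theta x = x" by (auto simp: V_real_def)
    then have "?j a = - ?j a" using th[of a] by simp
    then show "x \<in> {0}" using a by (simp add: vec_eq_iff)
  next
    fix x :: "'n form" assume "x \<in> {0}"
    then have "x = 0" "x = ?j 0" by (simp_all add: vec_eq_iff)
    then show "x \<in> V_real \<inter> ?j ` V_real"
      using subspace_0[OF subspace_V_real[OF assms]] by (metis IntI image_eqI)
  qed
  have 2: "\<exists>a\<in>V_real. \<exists>b\<in>V_real. x = a + ?j b" for x :: "'n form"
  proof (intro bexI)
    let ?a = "(1/2) *\<^sub>R (x + theta x)"
    let ?b = "\<chi> i. (-\<i>/2) * (x - theta x) $ i"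
    show "x = ?a + ?j ?b"
      by (simp add: vec_eq_iff scaleR_conv_of_real[symmetric] algebra_simps)
        (simp add: scaleR_conv_of_real field_simps)
    show "?a \<in> V_real"
      by (simp add: V_real_def theta_scaleR theta_add theta_theta assms add.commute)
    have "theta ?b = (\<chi> i. (\<i>/2) * (theta x - x) $ i)"
      unfolding theta_scale[OF assms] by (simp add: theta_diff theta_theta assms)
    then show "?b \<in> V_real" by (simp add: V_real_def vec_eq_iff algebra_simps)
  qed
  have lin: "linear ?j"
    by (intro linearI) (simp_all add: vec_eq_iff algebra_simps)
  have inj: "inj ?j" by (rule injI) (simp add: vec_eq_iff)
  show ?thesis
    using dim_real_form[OF subspace_V_real[OF assms] lin inj 1 2] by simp
qed

section \<open>Quaternionic matrices and SU(2)\<close>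

lemma mat2_eq_iff:
  "A = B \<longleftrightarrow> A$1$1 = B$1$1 \<and> A$1$2 = B$1$2 \<and> A$2$1 = B$2$1 \<and> A$2$2 = (B :: 'a^2^2)$2$2"
  by (auto simp: vec_eq_iff forall_2)

lemma matrix_mult_2: "(A ** B) $ i $ j = A$i$1 * B$1$j + A$i$2 * (B :: 'a::semiring_1^2^2)$2$j"
  by (simp add: matrix_matrix_mult_def sum_2)

lemma mat_1_entries: "(mat 1 :: complex^2^2)$1$1 = 1" "(mat 1 :: complex^2^2)$1$2 = 0"
  "(mat 1 :: complex^2^2)$2$1 = 0" "(mat 1 :: complex^2^2)$2$2 = 1"
  by (simp_all add: mat_def)

lemma ctransp_nth [simp]: "ctransp A $ i $ j = cnj (A $ j $ i)"
  by (simp add: ctransp_def)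

lemmas mat2_simps = mat2_eq_iff matrix_mult_2 mat_1_entries ctransp_nth

lemma bounded_bilinear_matrix_mult: "bounded_bilinear ((**) :: complex^2^2 \<Rightarrow> complex^2^2 \<Rightarrow> complex^2^2)"
  unfolding bilinear_conv_bounded_bilinear[symmetric] bilinear_def
  by (intro conjI allI linearI) (simp_all add: mat2_simps algebra_simps)

lemma linear_ctransp: "linear ctransp"
  by (intro linearI) (simp_all add: mat2_simps)

lemma bounded_linear_ctransp: "bounded_linear ctransp"
  using linear_ctransp by (simp add: linear_conv_bounded_linear)

lemmas smooth_on_matrix_mult [smooth_intros] = smooth_on_bilinear[OF bounded_bilinear_matrix_mult]
lemmas smooth_on_ctransp [smooth_intros] = smooth_on_bounded_linear[OF bounded_linear_ctransp]

lemma bounded_bilinear_der: "bounded_bilinear (der :: complex^2^2 \<Rightarrow> 'n::{finite,linorder} form \<Rightarrow> 'n form)"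
  unfolding bilinear_conv_bounded_bilinear[symmetric] bilinear_def
proof (intro conjI allI linear_der_left)
  show "linear (der B :: 'n form \<Rightarrow> 'n form)" for B
    by (intro linearI der_add) (rule cf_eqI, simp add: cf_der algebra_simps)
qed

lemma ctransp_mult: "ctransp (A ** B) = ctransp B ** ctransp A"
  by (simp add: mat2_simps mult.commute)

lemma ctransp_ctransp [simp]: "ctransp (ctransp A) = A"
  by (simp add: mat2_simps)

lemma ctransp_one [simp]: "ctransp (mat 1) = mat 1"
  by (simp add: mat2_simps)

text \<open>The inverse of a matrix of determinant \<open>1\<close> is its adjugate; equating it with the conjugate
  transpose expresses the second row by the first.\<close>

lemma SU2_iff: "g \<in> SU2 \<longleftrightarrow> g \<in> quat \<and> (cmod (g$1$1))\<^sup>2 + (cmod (g$1$2))\<^sup>2 = 1"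
proof -
  have n: "x * cnj x + y * cnj y = 1 \<longleftrightarrow> (cmod x)\<^sup>2 + (cmod y)\<^sup>2 = 1" for x y
    unfolding complex_norm_square[symmetric] of_real_add[symmetric] of_real_eq_1_iff ..
  show ?thesis
  proof
    assume "g \<in> SU2"
    then have d: "g$1$1 * g$2$2 - g$1$2 * g$2$1 = 1"
      and u: "g$1$1 * cnj (g$1$1) + g$1$2 * cnj (g$1$2) = 1" "g$1$1 * cnj (g$2$1) + g$1$2 * cnj (g$2$2) = 0"
        "g$2$1 * cnj (g$1$1) + g$2$2 * cnj (g$1$2) = 0" "g$2$1 * cnj (g$2$1) + g$2$2 * cnj (g$2$2) = 1"
      by (simp_all add: SU2_def SL2_def det_2 mat2_simps)
    have "g$2$1 = - cnj (g$1$2)" "g$2$2 = cnj (g$1$1)"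
      using d u(1,3) by algebra+
    then show "g \<in> quat \<and> (cmod (g$1$1))\<^sup>2 + (cmod (g$1$2))\<^sup>2 = 1"
      using u(1) n by (simp add: quat_def)
  next
    assume *: "g \<in> quat \<and> (cmod (g$1$1))\<^sup>2 + (cmod (g$1$2))\<^sup>2 = 1"
    then have "g$1$1 * cnj (g$1$1) + g$1$2 * cnj (g$1$2) = 1" using n by simp
    with * show "g \<in> SU2"
      by (simp add: quat_def SU2_def SL2_def det_2 mat2_simps algebra_simps)
  qed
qed

lemma inner_mat2: "(A :: complex^2^2) \<bullet> B = A$1$1 \<bullet> B$1$1 + A$1$2 \<bullet> B$1$2 + A$2$1 \<bullet> B$2$1 + A$2$2 \<bullet> B$2$2"
  by (simp add: inner_vec_def sum_2)

lemma norm_mat2_sqrt2: "norm (A :: complex^2^2) = sqrt 2 \<longleftrightarrow> A \<bullet> A = 2"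
  by (simp add: norm_eq_sqrt_inner)

lemma SU2_sphere: "SU2 = {A \<in> quat. norm A = sqrt 2}"
  by (auto simp: SU2_iff norm_mat2_sqrt2 inner_mat2 quat_def dot_square_norm power2_norm_eq_inner[symmetric] complex_mod_cnj)

lemma su2_iff: "X \<in> su2 \<longleftrightarrow> X$2$1 = - cnj (X$1$2) \<and> X$2$2 = - X$1$1 \<and> Re (X$1$1) = 0"
  by (auto simp: su2_def sl2_def trace_def sum_2 mat2_simps complex_eq_iff)

lemma su2_quat: "su2 = {X \<in> quat. mat 1 \<bullet> X = 0}"
  by (auto simp: su2_iff quat_def inner_mat2 mat_1_entries inner_complex_def complex_eq_iff)

lemma subspace_quat: "subspace quat"
  by (simp add: subspace_def quat_def algebra_simps)

lemma subspace_su2: "subspace su2"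
  by (simp add: subspace_def su2_iff algebra_simps)

text \<open>The quaternions are a real form of the complex matrices: \<open>?\<sigma>\<close> in the proof is the value at \<open>x\<close> of
  the conjugation that fixes them.\<close>

lemma dim_quat: "dim quat = 4"
proof -
  let ?j = "\<lambda>A :: complex^2^2. \<chi> i j. \<i> * A $ i $ j"
  have "linear ?j" by (intro linearI) (simp_all add: mat2_simps algebra_simps)
  moreover have "inj ?j" by (rule injI) (simp add: mat2_simps)
  moreover have "quat \<inter> ?j ` quat = {0}"
  proof (intro equalityI subsetI)
    fix x assume "x \<in> quat \<inter> ?j ` quat"
    then obtain a where a: "a \<in> quat" "x = ?j a" "x \<in> quat" by auto
    then have "a = 0" by (auto simp: quat_def mat2_simps)
    then show "x \<in> {0}" using a by (simp add: mat2_simps)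
  next
    fix x :: "complex^2^2" assume "x \<in> {0}"
    then have "x = 0" "x = ?j 0" by (simp_all add: mat2_simps)
    then show "x \<in> quat \<inter> ?j ` quat"
      using subspace_0[OF subspace_quat] by (metis IntI image_eqI)
  qed
  moreover have "\<exists>a\<in>quat. \<exists>b\<in>quat. x = a + ?j b" for x
  proof (intro bexI)
    let ?\<sigma> = "\<chi> i j. if i = 1 then if j = 1 then cnj (x$2$2) else - cnj (x$2$1)
        else if j = 1 then - cnj (x$1$2) else cnj (x$1$1)"
    let ?a = "\<chi> i j. (x + ?\<sigma>) $ i $ j / 2" and ?b = "\<chi> i j. (-\<i>/2) * (x - ?\<sigma>) $ i $ j"
    show "x = ?a + ?j ?b"
      by (simp add: mat2_simps field_simps)
    show "?a \<in> quat" "?b \<in> quat"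
      by (simp_all add: quat_def field_simps)
  qed
  ultimately have "2 * dim quat = DIM(complex^2^2)"
    by (intro dim_real_form subspace_quat)
  then show ?thesis by simp
qed

lemma dim_su2: "dim su2 = 3"
proof -
  have one: "mat 1 \<in> quat" by (simp add: quat_def mat_1_entries)
  have "dim {y \<in> quat. \<forall>x \<in> span {mat 1}. orthogonal x y} + dim (span {mat 1 :: complex^2^2}) = dim quat"
    using one by (intro dim_subspace_orthogonal_to_vectors subspace_quat) (auto simp: span_minimal subspace_quat)
  moreover have "{y \<in> quat. \<forall>x \<in> span {mat 1}. orthogonal x y} = su2"
    by (auto simp: su2_quat orthogonal_def span_singleton)
  moreover have "mat 1 \<noteq> (0 :: complex^2^2)" by (simp add: mat2_simps)
  ultimately show ?thesis by (simp add: dim_quat)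
qed

lemma SU2_quat: "g \<in> SU2 \<Longrightarrow> g \<in> quat"
  by (simp add: SU2_iff)

lemma quat_mult: "A \<in> quat \<Longrightarrow> B \<in> quat \<Longrightarrow> A ** B \<in> quat"
  by (simp add: quat_def matrix_mult_2 algebra_simps)

lemma quat_ctransp: "A \<in> quat \<Longrightarrow> ctransp A \<in> quat"
  by (simp add: quat_def)

lemma SU2_one [simp]: "mat 1 \<in> SU2"
  by (simp add: SU2_iff quat_def mat_1_entries)

lemma SU2_mult_ctransp: "g \<in> SU2 \<Longrightarrow> g ** ctransp g = mat 1"
  by (simp add: SU2_def)

lemma SU2_ctransp_mult: "g \<in> SU2 \<Longrightarrow> ctransp g ** g = mat 1"
  using SU2_mult_ctransp[of g] matrix_left_right_inverse by blast

lemma SU2_ctransp: "g \<in> SU2 \<Longrightarrow> ctransp g \<in> SU2"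
  using SU2_quat[of g, THEN quat_ctransp] SU2_iff[of "g"] unfolding SU2_iff[of "ctransp g"] quat_def by simp

lemma SU2_mult: "g \<in> SU2 \<Longrightarrow> h \<in> SU2 \<Longrightarrow> g ** h \<in> SU2"
proof -
  assume g: "g \<in> SU2" and h: "h \<in> SU2"
  have "(g ** h) ** ctransp (g ** h) = g ** (h ** ctransp h) ** ctransp g"
    by (simp add: ctransp_mult matrix_mul_assoc)
  then show ?thesis using g h by (simp add: SU2_def SL2_def det_mul)
qed

lemma matrix_inv_eqI:
  fixes A B :: "complex^2^2"
  assumes "A ** B = mat 1" "B ** A = mat 1"
  shows "matrix_inv A = B"
proof -
  have "A ** matrix_inv A = mat 1 \<and> matrix_inv A ** A = mat 1"
    unfolding matrix_inv_def by (rule someI[of _ B]) (use assms in simp)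
  then show ?thesis
    by (metis assms(2) matrix_mul_assoc matrix_mul_lid matrix_mul_rid)
qed

lemma matrix_inv_SU2: "g \<in> SU2 \<Longrightarrow> matrix_inv g = ctransp g"
  by (intro matrix_inv_eqI SU2_mult_ctransp SU2_ctransp_mult)

lemma grp_act_SU2: "g \<in> SU2 \<Longrightarrow> grp_act g a = pact (ctransp g) a"
  by (simp add: grp_act_pact matrix_inv_SU2)

lemma pact_V_real:
  "odd CARD('n) \<Longrightarrow> N \<in> quat \<Longrightarrow> a \<in> V_real \<Longrightarrow> pact N (a :: 'n::{finite,linorder} form) \<in> V_real"
  by (simp add: V_real_def theta_pact)

definition adj2 :: "complex^2^2 \<Rightarrow> complex^2^2" where
  "adj2 A = vector [vector [A$2$2, - A$1$2], vector [- A$2$1, A$1$1]]"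

lemma adj2_nth [simp]: "adj2 A $1$1 = A$2$2" "adj2 A $1$2 = - A$1$2"
  "adj2 A $2$1 = - A$2$1" "adj2 A $2$2 = A$1$1"
  by (simp_all add: adj2_def)

lemma bounded_linear_adj2: "bounded_linear adj2"
  unfolding linear_conv_bounded_linear[symmetric] by (intro linearI) (simp_all add: mat2_simps)

lemma matrix_inv_SL2: "g \<in> SL2 \<Longrightarrow> matrix_inv g = adj2 g"
  by (rule matrix_inv_eqI) (auto simp: SL2_def det_2 mat2_simps algebra_simps)

section \<open>One-parameter curves and tangent spaces\<close>

text \<open>By the theorem of Cayley and Hamilton a traceless matrix satisfies \<open>X\<^sup>2 = - det X\<close>, so the
  Cayley transform \<open>(1 + tX/2) (1 - tX/2)\<^sup>-\<^sup>1\<close> equals the following rational curve.  It is a curve in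
  \<open>SL2\<close> with velocity \<open>X\<close> at \<open>t = 0\<close>, and lies in \<open>SU2\<close> when \<open>X\<close> lies in \<open>su2\<close>.\<close>

definition cayley :: "complex^2^2 \<Rightarrow> real \<Rightarrow> complex^2^2" where
  "cayley X t = (\<chi> i j. ((mat 1 :: complex^2^2) $ i $ j * (1 - of_real (t\<^sup>2 / 4) * det X) + of_real t * X $ i $ j) /
     (1 + of_real (t\<^sup>2 / 4) * det X))"

text \<open>Small enough for \<open>t\<^sup>2 / 4 * det X\<close> to have modulus less than \<open>1\<close>.\<close>

definition cayley_radius :: "complex^2^2 \<Rightarrow> real" where
  "cayley_radius X = 1 / (1 + cmod (det X))"

lemma cayley_radius_pos: "cayley_radius X > 0"
  by (simp add: cayley_radius_def add_pos_nonneg)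

lemma cayley_denominator:
  assumes "\<bar>t\<bar> < cayley_radius X"
  shows "1 + of_real (t\<^sup>2 / 4) * det X \<noteq> 0"
proof
  assume "1 + of_real (t\<^sup>2 / 4) * det X = 0"
  then have "of_real (t\<^sup>2 / 4) * det X = -1" by (simp add: add_eq_0_iff)
  then have "cmod (of_real (t\<^sup>2 / 4) * det X) = 1" by simp
  then have 1: "t\<^sup>2 / 4 * cmod (det X) = 1" unfolding norm_mult norm_of_real by simp
  have t: "\<bar>t\<bar> * (1 + cmod (det X)) < 1"
    using assms by (simp add: cayley_radius_def field_simps add_pos_nonneg)
  have "\<bar>t\<bar> * 1 \<le> \<bar>t\<bar> * (1 + cmod (det X))" by (intro mult_left_mono) auto
  then have t1: "\<bar>t\<bar> \<le> 1" using t by linarith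
  have "t\<^sup>2 / 4 * cmod (det X) \<le> \<bar>t\<bar> * (1 + cmod (det X))"
  proof (intro mult_mono)
    have "t\<^sup>2 = \<bar>t\<bar> * \<bar>t\<bar>" by (simp add: power2_eq_square)
    also have "\<dots> \<le> \<bar>t\<bar> * 1" using t1 by (intro mult_left_mono) auto
    finally show "t\<^sup>2 / 4 \<le> \<bar>t\<bar>" by linarith
  qed auto
  then show False using 1 t by simp
qed

lemma cayley_0: "cayley X 0 = mat 1"
  by (simp add: cayley_def vec_eq_iff)

lemma smooth_on_cayley: "smooth_on {-cayley_radius X<..<cayley_radius X} (cayley X)"
proof -
  have o: "open {-cayley_radius X<..<cayley_radius X}" by simp
  show ?thesis
    unfolding cayley_def
    by (intro smooth_intros o) (use cayley_denominator in \<open>auto simp: abs_less_iff\<close>)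
qed

lemma cayley_deriv: "(cayley X has_vector_derivative X) (at 0)"
proof -
  have "cayley X differentiable (at 0)"
    by (rule differentiableI, rule smooth_on_has_derivative[OF smooth_on_cayley])
      (simp add: cayley_radius_pos)
  then obtain D where D: "(cayley X has_vector_derivative D) (at 0)"
    using vector_derivative_works by blast
  have "D $ i $ j = X $ i $ j" for i j
  proof -
    let ?f = "\<lambda>t. ((mat 1 :: complex^2^2) $ i $ j * (1 - t\<^sup>2 / 4 * det X) + t * X $ i $ j) / (1 + t\<^sup>2 / 4 * det X)"
    have "(?f has_field_derivative X $ i $ j) (at (of_real 0))"
      by (auto intro!: derivative_eq_intros)
    from has_vector_derivative_real_field[OF this, of UNIV]
    have "((\<lambda>t. cayley X t $ i $ j) has_vector_derivative X $ i $ j) (at 0)"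
      by (simp add: cayley_def)
    moreover have "((\<lambda>t. cayley X t $ i $ j) has_vector_derivative D $ i $ j) (at 0)"
      by (intro bounded_linear.has_vector_derivative[OF bounded_linear_vec_nth] D)
    ultimately show ?thesis using vector_derivative_unique_at by blast
  qed
  then have "D = X" by (simp add: vec_eq_iff)
  then show ?thesis using D by simp
qed

lemma cayley_SL2:
  assumes X: "X \<in> sl2" and t: "\<bar>t\<bar> < cayley_radius X"
  shows "cayley X t \<in> SL2"
proof -
  define s where "s = of_real (t\<^sup>2 / 4) * det X"
  have s: "1 + s \<noteq> 0" using cayley_denominator[OF t] by (simp add: s_def)
  have X2: "X$2$2 = - X$1$1" using X by (simp add: sl2_def trace_def sum_2 add_eq_0_iff)
  have "4 * s = (of_real t)\<^sup>2 * (X$1$1 * X$2$2 - X$1$2 * X$2$1)"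
    by (simp add: s_def det_2)
  then have "((1 - s) + of_real t * X$1$1) * ((1 - s) + of_real t * X$2$2) -
      (of_real t * X$1$2) * (of_real t * X$2$1) = (1 + s)\<^sup>2"
    unfolding X2 by algebra
  moreover have e: "cayley X t $ i $ j = (mat 1 $ i $ j * (1 - s) + of_real t * X $ i $ j) / (1 + s)" for i j
    by (simp only: cayley_def s_def vec_lambda_beta)
  ultimately have "det (cayley X t) = (1 + s)\<^sup>2 / (1 + s)\<^sup>2"
    unfolding det_2 e mat_1_entries
    by (simp add: power2_eq_square diff_divide_distrib[symmetric])
  then show ?thesis using s by (simp add: SL2_def)
qed

lemma cayley_SU2:
  assumes X: "X \<in> su2" and t: "\<bar>t\<bar> < cayley_radius X"
  shows "cayley X t \<in> SU2"
proof -
  have 1: "cayley X t \<in> SL2" using X cayley_SL2[OF _ t] by (simp add: su2_def)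
  have q: "X$2$1 = - cnj (X$1$2)" "X$2$2 = - X$1$1" "cnj (X$1$1) = - X$1$1"
    using X by (auto simp: su2_iff complex_eq_iff)
  have d: "cnj (det X) = det X" by (simp add: det_2 q)
  have "cayley X t \<in> quat"
    by (simp add: quat_def cayley_def mat_1_entries d q)
  moreover from this 1 have "(cayley X t)$1$1 * cnj ((cayley X t)$1$1) + (cayley X t)$1$2 * cnj ((cayley X t)$1$2) = 1"
    by (simp add: SL2_def det_2 quat_def)
  then have "(cmod (cayley X t $1$1))\<^sup>2 + (cmod (cayley X t $1$2))\<^sup>2 = 1"
    unfolding complex_norm_square[symmetric] of_real_add[symmetric] of_real_eq_1_iff .
  ultimately show ?thesis by (simp add: SU2_iff)
qed

lemma tangent_SL2: "X \<in> sl2 \<Longrightarrow> X \<in> tangent_space SL2 (mat 1)"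
  unfolding tangent_space_def
  using curve_inI[OF cayley_radius_pos smooth_on_cayley cayley_SL2 cayley_0 cayley_deriv] by blast

lemma has_derivative_pact_at_one:
  assumes "(N has_derivative N') (at p)" "(a has_derivative a') (at p)" "N p = mat 1"
  shows "((\<lambda>p. pact (N p) (a p)) has_derivative (\<lambda>v. der (N' v) (a p) + a' v)) (at p)"
  using has_derivative_compose[OF has_derivative_Pair[OF assms(1,2)], of "\<lambda>p. pact (fst p) (snd p)"]
    has_derivative_pact[of "a p"] assms(3) by fastforce

text \<open>On \<open>SL2\<close> the action is substitution of the adjugate, which is linear in the matrix and equals
  \<open>- X\<close> at a traceless matrix \<open>X\<close>.\<close>

lemma alg_act_der:
  assumes "X \<in> sl2"
  shows "alg_act X a = - der X a"
proof -
  have "((\<lambda>g. pact (adj2 g) a) has_derivative (\<lambda>B. der (adj2 B) a + 0)) (at (mat 1))"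
    by (intro has_derivative_pact_at_one bounded_linear_imp_has_derivative bounded_linear_adj2 has_derivative_const)
      (simp add: mat2_simps)
  then have "((\<lambda>g. pact (adj2 g) a) has_derivative (\<lambda>B. der (adj2 B) a)) (at (mat 1))" by simp
  then have "alg_act X a = der (adj2 X) a"
    unfolding alg_act_def
    by (rule mdiff_eqI[OF tangent_SL2[OF assms]]) (simp add: grp_act_pact matrix_inv_SL2)
  moreover have "X$2$2 = - X$1$1" using assms by (simp add: sl2_def trace_def sum_2 add_eq_0_iff)
  then have "adj2 X = - X" by (simp add: mat2_simps)
  ultimately show ?thesis by (simp add: der_minus_left)
qed

section \<open>The Lie group and its Lie algebra\<close>

lemma G_real_simps [simp]: "carrier (G_real :: 'n::{finite,linorder} lalg monoid) = SU2 \<times> V_real"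
  "\<one>\<^bsub>(G_real :: 'n::{finite,linorder} lalg monoid)\<^esub> = (mat 1, 0)"
  by (simp_all add: G_real_def)

lemma G_real_mult: "fst x \<in> SU2 \<Longrightarrow> x \<otimes>\<^bsub>G_real\<^esub> y = (fst x ** fst y, snd x + pact (ctransp (fst x)) (snd y))"
  by (simp add: G_real_def grp_act_SU2)

definition cayley_G :: "'n::finite lalg \<Rightarrow> real \<Rightarrow> 'n lalg" where
  "cayley_G X t = (cayley (fst X) t, t *\<^sub>R snd X)"

text \<open>In degree \<open>k\<close> the square of \<open>theta\<close> is \<open>(-1) ^ k\<close>; it is an involution when \<open>k\<close> is even, that is
  for an odd number of coefficients.\<close>

locale even_degree =
  fixes index_type :: "'n::{finite,linorder} itself"
  assumes odd_card: "odd CARD('n)"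
begin

lemmas V_real_add = subspace_add[OF subspace_V_real[OF odd_card]]
lemmas V_real_neg = subspace_neg[OF subspace_V_real[OF odd_card]]
lemmas V_real_diff = subspace_diff[OF subspace_V_real[OF odd_card]]
lemmas V_real_scale = subspace_scale[OF subspace_V_real[OF odd_card]]
lemmas V_real_zero [simp] = subspace_0[OF subspace_V_real[OF odd_card]]
lemmas V_real_pact = pact_V_real[OF odd_card]

lemma group_G_real: "group (G_real :: 'n lalg monoid)"
proof (rule groupI)
  fix x y z :: "'n lalg"
  assume x: "x \<in> carrier G_real" and y: "y \<in> carrier G_real" and z: "z \<in> carrier G_real"
  then have S: "fst x \<in> SU2" "fst y \<in> SU2" "snd x \<in> V_real" "snd y \<in> V_real" by auto
  show "x \<otimes>\<^bsub>G_real\<^esub> y \<in> carrier G_real"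
    using S by (simp add: G_real_mult SU2_mult V_real_add V_real_pact quat_ctransp SU2_quat)
  show "x \<otimes>\<^bsub>G_real\<^esub> y \<otimes>\<^bsub>G_real\<^esub> z = x \<otimes>\<^bsub>G_real\<^esub> (y \<otimes>\<^bsub>G_real\<^esub> z)"
    using S by (simp add: G_real_mult SU2_mult matrix_mul_assoc pact_add pact_pact ctransp_mult add.assoc)
next
  fix x :: "'n lalg" assume x: "x \<in> carrier G_real"
  then have S: "fst x \<in> SU2" "snd x \<in> V_real" by auto
  show "\<one>\<^bsub>G_real\<^esub> \<otimes>\<^bsub>G_real\<^esub> x = x" by (simp add: G_real_mult)
  show "\<exists>y\<in>carrier G_real. y \<otimes>\<^bsub>G_real\<^esub> x = \<one>\<^bsub>G_real\<^esub>"
    using S by (intro bexI[of _ "(ctransp (fst x), - pact (fst x) (snd x))"])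
      (simp_all add: G_real_mult SU2_ctransp SU2_ctransp_mult V_real_neg V_real_pact SU2_quat)
qed simp

lemma inv_G_real:
  assumes "x \<in> carrier (G_real :: 'n lalg monoid)"
  shows "inv\<^bsub>G_real\<^esub> x = (ctransp (fst x), - pact (fst x) (snd x))"
  using assms
  by (intro group.inv_equality[OF group_G_real])
    (auto simp: G_real_mult SU2_ctransp SU2_ctransp_mult V_real_neg V_real_pact SU2_quat)

lemma submanifold_SU2: "submanifold 3 SU2"
  unfolding SU2_sphere by (rule submanifold_sphere_subspace[OF subspace_quat]) (simp_all add: dim_quat)

lemma submanifold_V_real: "submanifold CARD('n) (V_real :: 'n form set)"
  using submanifold_subspace[OF subspace_V_real[OF odd_card]] dim_V_real[OF odd_card] by simp

lemma lie_group_G_real: "lie_group (3 + CARD('n)) (G_real :: 'n lalg monoid)"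
  unfolding lie_group_def
proof (intro conjI group_G_real)
  show "submanifold (3 + CARD('n)) (carrier (G_real :: 'n lalg monoid))"
    using submanifold_Times[OF submanifold_SU2 submanifold_V_real] by simp
  show "smooth_map (carrier G_real \<times> carrier G_real) (\<lambda>p. fst p \<otimes>\<^bsub>(G_real :: 'n lalg monoid)\<^esub> snd p)"
    by (rule smooth_mapI[of "\<lambda>p. (fst (fst p) ** fst (snd p), snd (fst p) + pact (ctransp (fst (fst p))) (snd (snd p)))"])
      (intro smooth_intros open_UNIV, auto simp: G_real_mult)
  show "smooth_map (carrier G_real) (\<lambda>g. inv\<^bsub>(G_real :: 'n lalg monoid)\<^esub> g)"
    by (rule smooth_mapI[of "\<lambda>g. (ctransp (fst g), - pact (fst g) (snd g))"])
      (intro smooth_intros open_UNIV, simp add: inv_G_real)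
qed

lemma curve_in_cayley_G:
  assumes "X \<in> (g_real :: 'n lalg set)"
  shows "curve_in (carrier G_real) \<one>\<^bsub>G_real\<^esub> X (cayley_G X)"
proof (rule curve_inI[of "cayley_radius (fst X)"])
  show "smooth_on {-cayley_radius (fst X)<..<cayley_radius (fst X)} (cayley_G X)"
    unfolding cayley_G_def by (intro smooth_intros smooth_on_cayley) simp_all
  show "cayley_G X t \<in> carrier G_real" if "\<bar>t\<bar> < cayley_radius (fst X)" for t
    using assms that by (auto simp: cayley_G_def g_real_def cayley_SU2 V_real_scale)
  have "((\<lambda>t. (cayley (fst X) t, t *\<^sub>R snd X)) has_vector_derivative (fst X, snd X)) (at 0)"
    using has_derivative_Pair[OF cayley_deriv[of "fst X", unfolded has_vector_derivative_def]
        bounded_linear_imp_has_derivative[OF bounded_linear_scaleR_left[of "snd X"]]]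
    by (simp add: has_vector_derivative_def scaleR_prod_def)
  then show "(cayley_G X has_vector_derivative X) (at 0)"
    unfolding cayley_G_def by simp
qed (simp_all add: cayley_radius_pos cayley_G_def cayley_0)

lemma tangent_space_G_real: "tangent_space (carrier G_real) \<one>\<^bsub>G_real\<^esub> = (g_real :: 'n lalg set)"
proof (intro equalityI subsetI)
  fix X :: "'n lalg" assume "X \<in> g_real"
  then show "X \<in> tangent_space (carrier G_real) \<one>\<^bsub>G_real\<^esub>"
    using curve_in_cayley_G unfolding tangent_space_def by blast
next
  fix X :: "'n lalg" assume "X \<in> tangent_space (carrier G_real) \<one>\<^bsub>G_real\<^esub>"
  then obtain c where c: "curve_in (SU2 \<times> V_real) (mat 1, 0) X c" by (auto simp: tangent_space_def)
  note c' = curve_inD[OF c]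
  have 1: "((\<lambda>t. fst (c t)) has_vector_derivative fst X) (at 0)"
    and 2: "((\<lambda>t. snd (c t)) has_vector_derivative snd X) (at 0)"
    using bounded_linear.has_vector_derivative[OF bounded_linear_fst c'(2)]
      bounded_linear.has_vector_derivative[OF bounded_linear_snd c'(2)] by auto
  have "snd X \<in> V_real"
    by (rule tangent_in_subspace[OF subspace_V_real[OF odd_card] 2])
      (use c'(3) in \<open>auto elim!: eventually_mono\<close>)
  moreover have "fst X \<in> quat"
    by (rule tangent_in_subspace[OF subspace_quat 1])
      (use c'(3) in \<open>auto elim!: eventually_mono simp: SU2_quat\<close>)
  moreover have "fst (c 0) \<bullet> fst X = 0"
    by (rule tangent_to_sphere[OF 1, of "sqrt 2"])
      (use c'(3) in \<open>auto elim!: eventually_mono simp: SU2_sphere\<close>)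
  ultimately show "X \<in> g_real"
    using c'(1) by (cases X) (simp add: g_real_def su2_quat)
qed

lemma su2_sl2: "X \<in> su2 \<Longrightarrow> X \<in> sl2"
  by (simp add: su2_def)

lemma su2_ctransp: "X \<in> su2 \<Longrightarrow> ctransp X = - X"
  unfolding su2_def by (metis (mono_tags, lifting) mem_Collect_eq minus_minus)

text \<open>In the semidirect product the last term arises from the translation part of \<open>g\<close>, which does not
  commute with the \<open>SU2\<close> part of the element that is conjugated.\<close>

lemma group_Ad_G_real:
  assumes g: "g \<in> carrier (G_real :: 'n lalg monoid)" and Y: "Y \<in> g_real"
  shows "group_Ad G_real g Y = (fst g ** fst Y ** ctransp (fst g),
     pact (ctransp (fst g)) (snd Y) + der (fst g ** fst Y ** ctransp (fst g)) (snd g))"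
proof -
  have gS: "fst g \<in> SU2" "snd g \<in> V_real" using g by auto
  define h where "h p = (fst g ** fst p ** ctransp (fst g),
      snd g + pact (ctransp (fst g)) (snd p) - pact (fst g ** ctransp (fst p) ** ctransp (fst g)) (snd g))"
    for p :: "'n lalg"
  define h' where "h' p = (fst g ** fst p ** ctransp (fst g),
      pact (ctransp (fst g)) (snd p) - der (fst g ** ctransp (fst p) ** ctransp (fst g)) (snd g))"
    for p :: "'n lalg"
  have bl: "bounded_linear (\<lambda>p::'n lalg. fst g ** fst p ** ctransp (fst g))"
    "bounded_linear (\<lambda>p::'n lalg. fst g ** ctransp (fst p) ** ctransp (fst g))"
    unfolding linear_conv_bounded_linear[symmetric]
    by (intro linearI; simp add: mat2_simps algebra_simps)+
  have blp: "bounded_linear (\<lambda>p::'n lalg. pact (ctransp (fst g)) (snd p))"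
    unfolding linear_conv_bounded_linear[symmetric]
    by (intro linearI) (simp_all add: pact_add pact_scaleR)
  have 1: "(h has_derivative (\<lambda>p. (fst g ** fst p ** ctransp (fst g),
      0 + pact (ctransp (fst g)) (snd p) - (der (fst g ** ctransp (fst p) ** ctransp (fst g)) (snd g) + 0)))) (at (mat 1, 0))"
    unfolding h_def
    by (intro has_derivative_Pair has_derivative_diff has_derivative_add has_derivative_const
        has_derivative_pact_at_one bounded_linear_imp_has_derivative bl blp)
      (simp add: SU2_mult_ctransp gS)
  have "group_Ad G_real g Y = h' Y"
    unfolding group_Ad_def
  proof (rule mdiff_eqI)
    show "Y \<in> tangent_space (carrier G_real) \<one>\<^bsub>G_real\<^esub>" using Y by (simp only: tangent_space_G_real)
    show "(h has_derivative h') (at \<one>\<^bsub>G_real\<^esub>)" using 1 by (simp add: h'_def[abs_def])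
    fix y :: "'n lalg" assume y: "y \<in> carrier G_real"
    then have "fst y \<in> SU2" by auto
    then show "h y = g \<otimes>\<^bsub>G_real\<^esub> y \<otimes>\<^bsub>G_real\<^esub> inv\<^bsub>G_real\<^esub> g"
      using gS by (simp add: inv_G_real[OF g] G_real_mult SU2_mult h_def pact_pact ctransp_mult
          linear_neg[OF linear_pact] matrix_mul_assoc)
  qed
  moreover have "ctransp (fst Y) = - fst Y" using Y by (intro su2_ctransp) (auto simp: g_real_def)
  moreover have "A ** (- B) ** C = - (A ** B ** C)" for A B C :: "complex^2^2"
    by (simp add: mat2_simps algebra_simps)
  ultimately show ?thesis by (simp add: h'_def der_minus_left)
qed

text \<open>At the identity the translation part of \<open>g\<close> vanishes, so differentiating the last term of the
  adjoint representation only differentiates that part.\<close>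

lemma is_lie_algebra_of_G_real: "is_lie_algebra_of G_real (g_real :: 'n lalg set) lbr"
  unfolding is_lie_algebra_of_def
proof (intro conjI ballI)
  show "g_real = tangent_space (carrier G_real) \<one>\<^bsub>(G_real :: 'n lalg monoid)\<^esub>"
    by (rule tangent_space_G_real[symmetric])
  fix X Y :: "'n lalg" assume X: "X \<in> g_real" and Y: "Y \<in> g_real"
  have XY: "fst X \<in> su2" "fst Y \<in> su2" using X Y by (auto simp: g_real_def)
  define F where "F p = (fst p ** fst Y ** ctransp (fst p),
     pact (ctransp (fst p)) (snd Y) + der (fst p ** fst Y ** ctransp (fst p)) (snd p))" for p :: "'n lalg"
  note mm = bounded_bilinear.FDERIV[OF bounded_bilinear_matrix_mult]
  have fst: "(fst has_derivative fst) (at p)" for p :: "'n lalg"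
    by (rule bounded_linear_imp_has_derivative[OF bounded_linear_fst])
  have snd: "(snd has_derivative snd) (at p)" for p :: "'n lalg"
    by (rule bounded_linear_imp_has_derivative[OF bounded_linear_snd])
  have ct: "((\<lambda>p. ctransp (fst p)) has_derivative (\<lambda>p. ctransp (fst p))) (at p)" for p :: "'n lalg"
    by (intro bounded_linear_imp_has_derivative bounded_linear_compose[OF bounded_linear_ctransp] bounded_linear_fst)
  have Q: "((\<lambda>p. fst p ** fst Y ** ctransp (fst p)) has_derivative
      (\<lambda>p. fst p ** fst Y + fst Y ** ctransp (fst p))) (at (mat 1, 0 :: 'n form))"
    by (rule has_derivative_eq_rhs[OF mm[OF mm[OF fst has_derivative_const[of "fst Y"]] ct]])
      (simp add: fun_eq_iff mat2_simps)
  have "(F has_derivative (\<lambda>p. (fst p ** fst Y + fst Y ** ctransp (fst p),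
      (der (ctransp (fst p)) (snd Y) + 0) + der (fst Y) (snd p)))) (at (mat 1, 0))"
    unfolding F_def
    by (intro has_derivative_Pair Q has_derivative_add has_derivative_pact_at_one ct has_derivative_const
        has_derivative_eq_rhs[OF bounded_bilinear.FDERIV[OF bounded_bilinear_der Q snd]])
      (simp_all add: fun_eq_iff)
  then have "mdiff (carrier G_real) (\<lambda>g. group_Ad G_real g Y) \<one>\<^bsub>G_real\<^esub> X =
      (fst X ** fst Y + fst Y ** ctransp (fst X), (der (ctransp (fst X)) (snd Y) + 0) + der (fst Y) (snd X))"
    using X by (intro mdiff_eqI[of X _ _ F]) (simp_all add: tangent_space_G_real[simplified] group_Ad_G_real Y F_def)
  also have "\<dots> = lbr X Y"
    using XY by (simp add: lbr_def su2_ctransp alg_act_der su2_sl2 der_minus_left mat2_simps)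
  finally show "lbr X Y = mdiff (carrier G_real) (\<lambda>g. group_Ad G_real g Y) \<one>\<^bsub>G_real\<^esub> X" ..
qed

end

section \<open>The complexified Lie algebra as a real form plus i times it\<close>

interpretation lv: vector_space "lscale :: complex \<Rightarrow> 'n::finite lalg \<Rightarrow> 'n lalg"
  by (rule vector_space_lscale)

interpretation pv: vector_space "pscale :: complex \<Rightarrow> 'a::real_vector \<times> 'a \<Rightarrow> 'a \<times> 'a"
  by (rule vector_space_pscale)

lemma fst_lscale: "fst (lscale c Z) $ i $ j = c * fst Z $ i $ j"
  by (simp add: lscale_def)

lemma snd_lscale: "snd (lscale c Z) $ i = c * snd Z $ i"
  by (simp add: lscale_def)

lemma cf_lscale [simp]: "cf (snd (lscale c Z)) h = c * cf (snd Z) h"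
  by (simp add: lscale_def)

lemma lalg_eq_iff: "Z = W \<longleftrightarrow> fst Z = fst W \<and> (\<forall>h. cf (snd Z) h = cf (snd W) h)"
  by (metis cf_eqI prod_eq_iff)

lemma scaleR_lscale: "r *\<^sub>R Z = lscale (of_real r) Z"
  by (simp add: prod_eq_iff vec_eq_iff lscale_def scaleR_conv_of_real[where 'a=complex])

lemma lscale_scaleR: "lscale c (r *\<^sub>R Z) = r *\<^sub>R lscale c Z"
  by (simp add: scaleR_lscale mult.commute)

text \<open>The conjugation of \<open>g_cplx\<close> with respect to \<open>g_real\<close>, and the real and imaginary
  parts that it defines.\<close>

definition rconj :: "'n::{finite,linorder} lalg \<Rightarrow> 'n lalg" where
  "rconj Z = (- ctransp (fst Z), theta (snd Z))"

definition re_part :: "'n::{finite,linorder} lalg \<Rightarrow> 'n lalg" where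
  "re_part Z = lscale (1/2) (Z + rconj Z)"

definition im_part :: "'n::{finite,linorder} lalg \<Rightarrow> 'n lalg" where
  "im_part Z = lscale (-\<i>/2) (Z - rconj Z)"

definition re_im :: "'n::{finite,linorder} lalg \<Rightarrow> 'n lalg \<times> 'n lalg" where
  "re_im Z = (re_part Z, im_part Z)"

definition recombine :: "'n::{finite,linorder} lalg \<times> 'n lalg \<Rightarrow> 'n lalg" where
  "recombine p = fst p + lscale \<i> (snd p)"

text \<open>The action of \<open>A\<close> by conjugation and substitution, in a form that is polynomial in \<open>A\<close>
  and agrees with the action of the group when \<open>A\<close> lies in \<open>SU2\<close>.\<close>

definition tau :: "complex^2^2 \<Rightarrow> 'n::{finite,linorder} lalg \<Rightarrow> 'n lalg" where
  "tau A Z = (A ** fst Z ** ctransp A, pact (ctransp A) (snd Z))"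

text \<open>The differential of \<open>tau\<close> at the identity along \<open>su2\<close>, extended complex-linearly in \<open>X\<close>.\<close>

definition ad2 :: "complex^2^2 \<Rightarrow> 'n::{finite,linorder} lalg \<Rightarrow> 'n lalg" where
  "ad2 X Z = (X ** fst Z - fst Z ** X, - der X (snd Z))"

lemma recombine_re_im [simp]: "recombine (re_im Z) = Z"
proof -
  have "recombine (re_im Z) = lscale (1/2) ((Z + rconj Z) + (Z - rconj Z))"
    unfolding lv.scale_right_distrib[of _ "Z + rconj Z"] by (simp add: recombine_def re_im_def re_part_def im_part_def)
  also have "\<dots> = lscale (1/2) Z + lscale (1/2) Z"
    by (simp flip: lv.scale_right_distrib)
  also have "\<dots> = Z" unfolding lv.scale_left_distrib[symmetric] by simp
  finally show ?thesis .
qed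

lemma inj_re_im: "inj re_im"
  by (metis injI recombine_re_im)

lemma tau_tau: "tau A (tau B Z) = tau (A ** B) Z"
  by (simp add: tau_def pact_pact ctransp_mult matrix_mul_assoc)

lemma tau_one [simp]: "tau (mat 1) Z = Z"
  by (simp add: tau_def)

lemma tau_add: "tau A (Z + W) = tau A Z + tau A W"
  by (simp add: tau_def pact_add mat2_simps algebra_simps)

lemma tau_lscale: "tau A (lscale c Z) = lscale c (tau A Z)"
  by (simp add: tau_def lscale_def pact_scale mat2_simps algebra_simps)

lemma tau_SU2_inverse:
  "A \<in> SU2 \<Longrightarrow> tau (ctransp A) (tau A Z) = Z"
  "A \<in> SU2 \<Longrightarrow> tau A (tau (ctransp A) Z) = Z"
  by (simp_all add: tau_tau SU2_ctransp_mult SU2_mult_ctransp)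

lemma tau_scaleR: "tau A (r *\<^sub>R Z) = r *\<^sub>R tau A Z"
  by (simp add: scaleR_lscale tau_lscale)

lemma linear_tau: "linear (tau A)"
  by (intro linearI tau_add tau_scaleR)

lemma smooth_on_tau [smooth_intros]:
  "smooth_on U f \<Longrightarrow> smooth_on U g \<Longrightarrow> smooth_on U (\<lambda>x. tau (f x) (g x))"
  unfolding tau_def by (intro smooth_intros)

lemma recombine_add: "recombine (p + q) = recombine p + recombine q"
  by (simp add: recombine_def lv.scale_right_distrib algebra_simps)

lemma recombine_pscale: "recombine (pscale c p) = lscale c (recombine p)"
  by (simp add: lalg_eq_iff mat2_eq_iff recombine_def pscale_def fst_lscale complex_eq_iff algebra_simps)

lemma linear_recombine: "linear recombine"
  by (intro linearI recombine_add)
    (simp add: recombine_def lscale_scaleR scaleR_add_right)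

definition base_mat :: "complex^2^2" where
  "base_mat = vector [vector [\<i>, 0], vector [0, - \<i>]]"

lemma base_mat_entries [simp]: "base_mat $1$1 = \<i>" "base_mat $1$2 = 0" "base_mat $2$1 = 0"
  "base_mat $2$2 = -\<i>"
  by (simp_all add: base_mat_def)

lemma E_base_eq: "E_base = (base_mat, 0)"
  by (simp add: E_base_def base_mat_def)

lemma E_act_tau: "fst g \<in> SU2 \<Longrightarrow> E_act g x = (0, snd g) + tau (fst g) x"
  by (simp add: E_act_def tau_def matrix_inv_SU2 grp_act_SU2 prod_eq_iff)

lemma E_act_base: "fst g \<in> SU2 \<Longrightarrow> E_act g E_base = (fst g ** base_mat ** ctransp (fst g), snd g)"
  by (simp add: E_act_tau tau_def E_base_eq prod_eq_iff)

text \<open>The fundamental vector field of \<open>X\<close> at the base point, extended complex-linearly in \<open>X\<close>.\<close>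

definition inf_act :: "'n::{finite,linorder} lalg \<Rightarrow> 'n lalg" where
  "inf_act X = (fst X ** base_mat - base_mat ** fst X, snd X)"

lemma inf_act_entries: "fst (inf_act X) $1$1 = 0" "fst (inf_act X) $1$2 = - 2 * \<i> * fst X $1$2"
  "fst (inf_act X) $2$1 = 2 * \<i> * fst X $2$1" "fst (inf_act X) $2$2 = 0" "snd (inf_act X) = snd X"
  by (simp_all add: inf_act_def matrix_mult_2 )

definition T01_base :: "'n::{finite,linorder} lalg set" where
  "T01_base = {Z. fst Z $1$1 = 0 \<and> fst Z $1$2 = 0 \<and> fst Z $2$2 = 0 \<and> snd Z \<in> V_minus}"

lemma V_minus_iff:
  "(a :: 'n::{finite,linorder} form) \<in> V_minus \<longleftrightarrow> (\<forall>h. 2 * h \<le> int CARD('n) - 1 \<longrightarrow> cf a h = 0)"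
proof
  assume a: "a \<in> V_minus"
  show "\<forall>h. 2 * h \<le> int CARD('n) - 1 \<longrightarrow> cf a h = 0"
  proof (intro allI impI)
    fix h assume h: "2 * h \<le> int CARD('n) - 1"
    show "cf a h = 0"
    proof (cases "0 \<le> h \<and> h < int CARD('n)")
      case True
      then obtain i :: 'n where i: "h = int (zexp i)" using zexp_surj by blast
      then have "\<not> CARD('n) - 1 < 2 * zexp i" using h by linarith
      then show ?thesis using a i by (simp add: V_minus_def)
    qed (auto simp: cf_outside)
  qed
next
  assume a: "\<forall>h. 2 * h \<le> int CARD('n) - 1 \<longrightarrow> cf a h = 0"
  show "a \<in> V_minus"
    unfolding V_minus_def
  proof (intro CollectI allI impI)
    fix i :: 'n assume "\<not> CARD('n) - 1 < 2 * zexp i"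
    moreover have "CARD('n) > 0" by simp
    ultimately have "2 * int (zexp i) \<le> int CARD('n) - 1" by linarith
    then show "a $ i = 0" using a cf_zexp by metis
  qed
qed

lemma subspace_T01_base: "lv.subspace T01_base"
  by (auto simp: lv.subspace_def T01_base_def V_minus_iff fst_lscale)

text \<open>The bracket with \<open>base_mat\<close> kills \<open>H\<close> and multiplies \<open>F\<close> by \<open>2 i\<close>.\<close>

lemma inf_act_image: "inf_act ` q_prime = (T01_base :: 'n::{finite,linorder} lalg set)"
proof (intro equalityI subsetI)
  fix W :: "'n lalg" assume "W \<in> inf_act ` q_prime"
  then show "W \<in> T01_base"
    by (auto simp: T01_base_def inf_act_entries q_prime_def borel_b_def)
next
  fix W :: "'n lalg" assume W: "W \<in> T01_base"
  define Z where "Z = (lscale (- \<i> / 2) (fst W, 0 :: 'n form))"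
  have "(fst Z, snd W) \<in> q_prime"
    using W by (auto simp: Z_def T01_base_def q_prime_def borel_b_def sl2_def trace_def sum_2 fst_lscale)
  moreover have "W = inf_act (fst Z, snd W)"
    using W by (auto simp: prod_eq_iff mat2_eq_iff inf_act_entries Z_def fst_lscale T01_base_def)
  ultimately show "W \<in> inf_act ` q_prime" by blast
qed

lemma inf_act_mem_iff: "Z \<in> g_cplx \<Longrightarrow> inf_act Z \<in> T01_base \<longleftrightarrow> Z \<in> q_prime"
  by (auto simp: T01_base_def inf_act_entries q_prime_def borel_b_def g_cplx_def)

lemma ad2_borel_T01_base:
  assumes "X \<in> borel_b" "Z \<in> T01_base"
  shows "ad2 X Z \<in> T01_base"
proof -
  have "fst (ad2 X Z) $1$1 = 0" "fst (ad2 X Z) $1$2 = 0" "fst (ad2 X Z) $2$2 = 0"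
    using assms by (auto simp: ad2_def matrix_mult_2 T01_base_def borel_b_def)
  moreover have "snd (ad2 X Z) \<in> V_minus"
    using assms by (auto simp: ad2_def V_minus_iff cf_der T01_base_def borel_b_def)
  ultimately show ?thesis by (simp add: T01_base_def)
qed

lemma linear_inf_act: "inf_act (Z + W) = inf_act Z + inf_act W" "inf_act (lscale c Z) = lscale c (inf_act Z)"
  by (simp_all add: prod_eq_iff inf_act_def mat2_simps fst_lscale lscale_def algebra_simps)

lemma has_derivative_tau_at_one:
  assumes A: "(A has_derivative A') (at p)" and Z: "(Z has_derivative Z') (at p)" and "A p = mat 1"
  shows "((\<lambda>p. tau (A p) (Z p)) has_derivative
    (\<lambda>v. (A' v ** fst (Z p) + fst (Z p) ** ctransp (A' v), der (ctransp (A' v)) (snd (Z p))) + Z' v)) (at p)"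
proof -
  note mm = bounded_bilinear.FDERIV[OF bounded_bilinear_matrix_mult]
  have Z1: "((\<lambda>p. fst (Z p)) has_derivative (\<lambda>v. fst (Z' v))) (at p)"
    by (rule bounded_linear.has_derivative[OF bounded_linear_fst Z])
  have Z2: "((\<lambda>p. snd (Z p)) has_derivative (\<lambda>v. snd (Z' v))) (at p)"
    by (rule bounded_linear.has_derivative[OF bounded_linear_snd Z])
  have Ac: "((\<lambda>p. ctransp (A p)) has_derivative (\<lambda>v. ctransp (A' v))) (at p)"
    by (rule bounded_linear.has_derivative[OF bounded_linear_ctransp A])
  have "((\<lambda>p. A p ** fst (Z p) ** ctransp (A p)) has_derivative
      (\<lambda>v. A' v ** fst (Z p) + fst (Z p) ** ctransp (A' v) + fst (Z' v))) (at p)"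
    by (rule has_derivative_eq_rhs[OF mm[OF mm[OF A Z1] Ac]])
      (simp add: fun_eq_iff mat2_simps assms(3))
  moreover have "((\<lambda>p. pact (ctransp (A p)) (snd (Z p))) has_derivative
      (\<lambda>v. der (ctransp (A' v)) (snd (Z p)) + snd (Z' v))) (at p)"
    by (rule has_derivative_pact_at_one[OF Ac Z2]) (simp add: assms(3))
  ultimately show ?thesis
    unfolding tau_def by (rule has_derivative_eq_rhs[OF has_derivative_Pair]) (simp add: fun_eq_iff prod_eq_iff)
qed

section \<open>Dimensions of coordinate subspaces\<close>

text \<open>The basis \<open>H\<close>, \<open>E\<close>, \<open>F\<close> of \<open>sl2\<close> together with the monomials, and the dual coordinates.\<close>

definition std_index :: "(nat + 'n) set" where
  "std_index = Inl ` {..<3} \<union> range Inr"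

definition std_basis :: "nat + 'n::finite \<Rightarrow> 'n lalg" where
  "std_basis k = (case k of
      Inl m \<Rightarrow> ((\<chi> i j. if m = 0 then (if i = j then if i = 1 then 1 else -1 else 0)
                 else if m = 1 then (if i = 1 \<and> j = 2 then 1 else 0)
                 else (if i = 2 \<and> j = 1 then 1 else 0)), 0)
    | Inr i \<Rightarrow> (0, axis i 1))"

definition coord :: "nat + 'n \<Rightarrow> 'n::finite lalg \<Rightarrow> complex" where
  "coord k Z = (case k of Inl m \<Rightarrow> if m = 0 then fst Z $1$1 else if m = 1 then fst Z $1$2 else fst Z $2$1
     | Inr i \<Rightarrow> snd Z $ i)"

lemma coord_add: "coord k (Z + W) = coord k Z + coord k W"
  by (simp add: coord_def split: sum.split)

lemma coord_lscale: "coord k (lscale c Z) = c * coord k Z"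
  by (simp add: coord_def lscale_def split: sum.split)

lemma coord_zero: "coord k 0 = 0"
  by (simp add: coord_def split: sum.split)

lemma coord_sum: "coord k (\<Sum>x\<in>A. f x) = (\<Sum>x\<in>A. coord k (f x))"
  by (induction A rule: infinite_finite_induct) (simp_all add: coord_add coord_zero)

lemma coord_std_basis:
  "k \<in> std_index \<Longrightarrow> l \<in> std_index \<Longrightarrow> coord k (std_basis l) = (if k = l then 1 else 0)"
  by (auto simp: std_index_def coord_def std_basis_def axis_def less_Suc_eq numeral_3_eq_3 split: if_splits)

lemma finite_std_index [simp]: "finite (std_index :: (nat + 'n::finite) set)"
  by (simp add: std_index_def)

lemma std_index_all: "(\<forall>k\<in>std_index. P k) \<longleftrightarrow> P (Inl 0) \<and> P (Inl 1) \<and> P (Inl 2) \<and> (\<forall>i. P (Inr i))"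
  by (auto simp: std_index_def less_Suc_eq numeral_3_eq_3 numeral_2_eq_2)

lemma g_cplx_eqI:
  assumes "Z \<in> g_cplx" "W \<in> g_cplx" "\<And>k. k \<in> std_index \<Longrightarrow> coord k Z = coord k W"
  shows "Z = W"
proof -
  have "\<forall>k\<in>std_index. coord k Z = coord k W" using assms(3) by blast
  then show ?thesis
    using assms(1,2) unfolding std_index_all
    by (auto simp: coord_def g_cplx_def sl2_def trace_def sum_2 prod_eq_iff mat2_eq_iff vec_eq_iff
        add_eq_0_iff)
qed

lemma std_basis_g_cplx: "std_basis k \<in> g_cplx"
  by (auto simp: std_basis_def g_cplx_def sl2_def trace_def sum_2 split: sum.split)

lemma subspace_g_cplx: "lv.subspace g_cplx"
  by (simp add: lv.subspace_def g_cplx_def sl2_def trace_def sum_2 mem_Times_iff fst_lscale add_eq_0_iff)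

definition coord_space :: "(nat + 'n) set \<Rightarrow> 'n::{finite,linorder} lalg set" where
  "coord_space I = {Z \<in> g_cplx. \<forall>k\<in>std_index - I. coord k Z = 0}"

text \<open>The coordinates are dual to the basis vectors, which gives independence; an element of the space
  has the same coordinates as its expansion, which gives generation.\<close>

lemma coord_space_basis:
  assumes "I \<subseteq> (std_index :: (nat + 'n::{finite,linorder}) set)"
  shows "std_basis ` I \<subseteq> coord_space I" "lv.independent (std_basis ` I)"
    "coord_space I \<subseteq> lv.span (std_basis ` I)" "card (std_basis ` I) = card I"
proof -
  have fI: "finite I" using assms finite_subset finite_std_index by blast
  have inj: "inj_on std_basis I"
  proof (rule inj_onI)
    fix k l assume kl: "k \<in> I" "l \<in> I" "std_basis k = std_basis l"
    then have "k \<in> std_index" "l \<in> std_index" using assms by auto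
    then show "k = l" using kl(3) coord_std_basis[of k k] coord_std_basis[of k l] by (auto split: if_splits)
  qed
  show "card (std_basis ` I) = card I" by (rule card_image[OF inj])
  show "std_basis ` I \<subseteq> coord_space I"
    using assms coord_std_basis by (fastforce simp: coord_space_def std_basis_g_cplx)
  show "lv.independent (std_basis ` I)"
  proof (rule lv.independent_if_scalars_zero)
    show "finite (std_basis ` I)" using fI by simp
    fix f x assume 0: "(\<Sum>x\<in>std_basis ` I. lscale (f x) x) = 0" and x: "x \<in> std_basis ` I"
    then obtain l where l: "l \<in> I" "x = std_basis l" by blast
    have "0 = coord l (\<Sum>x\<in>std_basis ` I. lscale (f x) x)" unfolding 0 by (simp add: coord_zero)
    also have "\<dots> = (\<Sum>k\<in>I. f (std_basis k) * coord l (std_basis k))"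
      by (simp add: sum.reindex[OF inj] coord_sum coord_lscale)
    also have "\<dots> = (\<Sum>k\<in>I. if l = k then f (std_basis k) else 0)"
      using assms l(1) by (intro sum.cong refl) (auto simp: coord_std_basis subset_iff)
    also have "\<dots> = f x" using l fI by simp
    finally show "f x = 0" by simp
  qed
  show "coord_space I \<subseteq> lv.span (std_basis ` I)"
  proof
    fix Z assume Z: "Z \<in> coord_space I"
    let ?W = "\<Sum>k\<in>I. lscale (coord k Z) (std_basis k)"
    have W: "?W \<in> g_cplx"
      by (intro lv.subspace_sum subspace_g_cplx lv.subspace_scale std_basis_g_cplx)
    have "Z = ?W"
    proof (rule g_cplx_eqI)
      show "Z \<in> g_cplx" "?W \<in> g_cplx" using Z W by (auto simp: coord_space_def)
      fix k :: "nat + 'n" assume k: "k \<in> std_index"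
      have "coord k ?W = (\<Sum>l\<in>I. if k = l then coord l Z else 0)"
        unfolding coord_sum coord_lscale
        using assms k by (intro sum.cong refl) (auto simp: coord_std_basis subset_iff)
      also have "\<dots> = coord k Z"
        using Z k fI by (auto simp: coord_space_def)
      finally show "coord k Z = coord k ?W" by simp
    qed
    moreover have "?W \<in> lv.span (std_basis ` I)"
      by (intro lv.span_sum lv.span_scale lv.span_base) auto
    ultimately show "Z \<in> lv.span (std_basis ` I)" by simp
  qed
qed

lemma cdim_coord_space: "I \<subseteq> std_index \<Longrightarrow> cdim (coord_space I) = card I"
  by (intro lv.dim_unique[of "std_basis ` I"] coord_space_basis)

text \<open>An injective linear map carries the basis of a coordinate space to a basis of the image.\<close>

lemma dim_image_inj:
  assumes "Vector_Spaces.linear lscale pscale f" "inj f" "I \<subseteq> std_index"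
  shows "vector_space.dim pscale (f ` coord_space I) = card I"
proof (rule pv.dim_unique)
  interpret f: Vector_Spaces.linear lscale pscale f by (rule assms(1))
  note b = coord_space_basis[OF assms(3)]
  show "f ` std_basis ` I \<subseteq> f ` coord_space I" using b(1) by blast
  show "f ` coord_space I \<subseteq> module.span pscale (f ` std_basis ` I)"
    using b(3) f.span_image by blast
  show "\<not> module.dependent pscale (f ` std_basis ` I)"
    using f.independent_injective_image[OF b(2)] assms(2) by (simp add: inj_on_subset)
  show "card (f ` std_basis ` I) = card I"
    using b(4) card_image[of f "std_basis ` I"] assms(2) by (simp add: inj_on_subset)
qed

definition high_index :: "'n::{finite,linorder} set" where
  "high_index = {i. CARD('n) - 1 < 2 * zexp i}"

lemma T01_base_coord: "T01_base = coord_space (insert (Inl 2) (Inr ` (high_index :: 'n::{finite,linorder} set)))"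
proof -
  have *: "(\<forall>k\<in>std_index - insert (Inl 2) (Inr ` (high_index :: 'n set)). P k) \<longleftrightarrow>
     P (Inl 0) \<and> P (Inl 1) \<and> (\<forall>i. i \<notin> high_index \<longrightarrow> P (Inr i))" for P
    by (auto simp: std_index_def less_Suc_eq numeral_3_eq_3 numeral_2_eq_2)
  show ?thesis
    unfolding coord_space_def *
    by (auto simp: T01_base_def coord_def g_cplx_def sl2_def trace_def sum_2 V_minus_def high_index_def add_eq_0_iff)
qed

lemma card_high_index:
  assumes "CARD('n::{finite,linorder}) = 2 * q + 1"
  shows "card (high_index :: 'n set) = q"
proof -
  have "zexp ` (high_index :: 'n set) = {q<..<2 * q + 1}"
  proof (intro equalityI subsetI)
    fix h assume "h \<in> zexp ` (high_index :: 'n set)"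
    then show "h \<in> {q<..<2 * q + 1}"
      using zexp_less[where 'n='n] assms by (auto simp: high_index_def)
  next
    fix h assume h: "h \<in> {q<..<2 * q + 1}"
    then obtain i :: 'n where "int h = int (zexp i)" using zexp_surj[of "int h", where 'n='n] assms by auto
    then have "h = zexp i" "i \<in> high_index" using h assms by (auto simp: high_index_def)
    then show "h \<in> zexp ` (high_index :: 'n set)" by blast
  qed
  then have "card (zexp ` (high_index :: 'n set)) = q" by simp
  moreover have "card (zexp ` (high_index :: 'n set)) = card (high_index :: 'n set)"
    by (rule card_image[OF inj_on_subset[OF inj_zexp subset_UNIV]])
  ultimately show ?thesis by simp
qed

context even_degree
begin

lemma rconj_add: "rconj (Z + W) = rconj Z + rconj (W :: 'n lalg)"
  by (simp add: rconj_def theta_add[OF odd_card] prod_eq_iff mat2_simps)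

lemma rconj_diff: "rconj (Z - W) = rconj Z - rconj (W :: 'n lalg)"
  by (simp add: rconj_def theta_diff[OF odd_card] prod_eq_iff mat2_simps)

lemma rconj_lscale: "rconj (lscale c Z) = lscale (cnj c) (rconj (Z :: 'n lalg))"
  by (simp add: rconj_def lscale_def theta_scale[OF odd_card] prod_eq_iff mat2_simps)

lemma rconj_rconj [simp]: "rconj (rconj Z) = (Z :: 'n lalg)"
  by (simp add: rconj_def theta_theta[OF odd_card] prod_eq_iff mat2_simps)

lemma g_real_iff: "Z \<in> (g_real :: 'n lalg set) \<longleftrightarrow> Z \<in> g_cplx \<and> rconj Z = Z"
  by (auto simp: g_real_def su2_def V_real_def g_cplx_def rconj_def prod_eq_iff)

lemma rconj_g_cplx: "Z \<in> g_cplx \<Longrightarrow> rconj Z \<in> (g_cplx :: 'n lalg set)"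
  by (auto simp: g_cplx_def rconj_def sl2_def trace_def sum_2 complex_eq_iff)

lemma re_part_g_real: "Z \<in> g_cplx \<Longrightarrow> re_part Z \<in> (g_real :: 'n lalg set)"
  unfolding g_real_iff re_part_def
  by (simp add: rconj_lscale rconj_add add.commute rconj_g_cplx subspace_g_cplx lv.subspace_scale lv.subspace_add)

lemma im_part_g_real: "Z \<in> g_cplx \<Longrightarrow> im_part Z \<in> (g_real :: 'n lalg set)"
proof -
  assume Z: "Z \<in> g_cplx"
  have "rconj (im_part Z) = lscale (\<i>/2) (- (Z - rconj Z))"
    unfolding im_part_def rconj_lscale rconj_diff by simp
  also have "\<dots> = im_part Z"
    unfolding im_part_def lv.scale_minus_right lv.scale_minus_left[symmetric] by simp
  finally show ?thesis
    using Z unfolding g_real_iff im_part_def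
    by (simp add: rconj_g_cplx subspace_g_cplx lv.subspace_neg lv.subspace_scale lv.subspace_diff)
qed

lemma re_im_recombine:
  assumes "p \<in> (g_real :: 'n lalg set) \<times> g_real"
  shows "re_im (recombine p) = p"
proof -
  have s: "rconj (fst p) = fst p" "rconj (snd p) = snd p" using assms by (auto simp: g_real_iff)
  have j: "rconj (recombine p) = fst p - lscale \<i> (snd p)"
    unfolding recombine_def rconj_add rconj_lscale s by simp
  have "re_part (recombine p) = lscale (1/2) (fst p + fst p)"
    unfolding re_part_def j by (simp add: recombine_def)
  moreover have "im_part (recombine p) = lscale (-\<i>/2) (lscale \<i> (snd p) + lscale \<i> (snd p))"
    unfolding im_part_def j by (simp add: recombine_def)
  ultimately show ?thesis
    by (simp add: re_im_def prod_eq_iff lv.scale_right_distrib lv.scale_left_distrib[symmetric])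
qed

lemma recombine_g_cplx: "p \<in> (g_real :: 'n lalg set) \<times> g_real \<Longrightarrow> recombine p \<in> g_cplx"
  unfolding recombine_def
  by (intro lv.subspace_add lv.subspace_scale subspace_g_cplx) (auto simp: g_real_iff)

lemma re_im_add: "re_im (Z + W) = re_im Z + re_im (W :: 'n lalg)"
  by (simp add: re_im_def re_part_def im_part_def rconj_add lv.scale_right_distrib lv.scale_right_diff_distrib)

lemma re_im_lscale: "re_im (lscale c Z) = pscale c (re_im (Z :: 'n lalg))"
  by (simp add: re_im_def pscale_def re_part_def im_part_def rconj_lscale prod_eq_iff mat2_eq_iff
      fst_lscale snd_lscale vec_eq_iff complex_eq_iff field_simps)

lemma linear_re_im: "linear (re_im :: 'n lalg \<Rightarrow> _)"
proof (intro linearI re_im_add)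
  show "re_im (r *\<^sub>R Z) = r *\<^sub>R re_im Z" for r and Z :: "'n lalg"
    unfolding scaleR_lscale re_im_lscale by (simp add: pscale_def prod_eq_iff)
qed

lemma pconj_re_im: "pconj (re_im Z) = re_im (rconj (Z :: 'n lalg))"
proof -
  have "im_part (rconj Z) = - im_part Z"
    unfolding im_part_def rconj_rconj lv.scale_minus_right[symmetric] by simp
  then show ?thesis
    by (simp add: pconj_def re_im_def re_part_def add.commute)
qed

lemma rconj_tau: "A \<in> quat \<Longrightarrow> rconj (tau A Z) = tau A (rconj (Z :: 'n lalg))"
  using theta_pact[OF odd_card quat_ctransp, of A "snd Z"]
  by (simp add: rconj_def tau_def prod_eq_iff mat2_simps algebra_simps)

lemma re_im_tau: "A \<in> quat \<Longrightarrow> re_im (tau A Z) = (tau A (re_part Z), tau A (im_part (Z :: 'n lalg)))"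
  unfolding re_im_def re_part_def im_part_def rconj_tau tau_lscale tau_add linear_diff[OF linear_tau] ..

lemma tau_g_cplx: "A \<in> SU2 \<Longrightarrow> Z \<in> g_cplx \<Longrightarrow> tau A Z \<in> (g_cplx :: 'n lalg set)"
proof -
  assume A: "A \<in> SU2" and Z: "Z \<in> g_cplx"
  have "trace (A ** fst Z ** ctransp A) = trace (fst Z ** (ctransp A ** A))"
    by (simp add: trace_def sum_2 matrix_mult_2 algebra_simps)
  then show ?thesis using A Z by (auto simp: g_cplx_def tau_def sl2_def SU2_ctransp_mult)
qed

lemma tau_g_real: "A \<in> SU2 \<Longrightarrow> Z \<in> g_real \<Longrightarrow> tau A Z \<in> (g_real :: 'n lalg set)"
  by (simp add: g_real_iff tau_g_cplx rconj_tau SU2_quat)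

lemma inf_act_g_real: "Z \<in> g_real \<Longrightarrow> inf_act Z \<in> (g_real :: 'n lalg set)"
  by (simp add: g_real_def mem_Times_iff su2_iff inf_act_entries complex_eq_iff)

end

section \<open>The homogeneous space\<close>

lemma base_mat_su2: "base_mat \<in> su2"
  by (simp add: su2_iff)

lemma su2_square:
  assumes "Y \<in> su2" "norm Y = sqrt 2"
  shows "Y ** Y = - mat 1"
proof -
  have q: "Y$2$1 = - cnj (Y$1$2)" "Y$2$2 = - Y$1$1" "cnj (Y$1$1) = - Y$1$1"
    using assms(1) by (auto simp: su2_iff complex_eq_iff)
  have "Y \<bullet> Y = 2" using assms(2) by (simp add: norm_mat2_sqrt2)
  then have "(cmod (Y$1$1))\<^sup>2 + (cmod (Y$1$2))\<^sup>2 = 1"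
    by (simp add: inner_mat2 q dot_square_norm)
  then have "Y$1$1 * cnj (Y$1$1) + Y$1$2 * cnj (Y$1$2) = 1"
    unfolding complex_norm_square[symmetric] of_real_add[symmetric] of_real_eq_1_iff .
  then show ?thesis
    unfolding mat2_eq_iff by (simp add: matrix_mult_2 mat_1_entries q algebra_simps)
qed

lemma quat_eq_scaled_SU2:
  assumes "s \<in> quat" "s \<noteq> 0"
  obtains r h where "r > 0" "h \<in> SU2" "s = r *\<^sub>R h"
proof
  let ?r = "norm s / sqrt 2"
  show "?r > 0" using assms by simp
  show "(1 / ?r) *\<^sub>R s \<in> SU2"
    using assms subspace_scale[OF subspace_quat assms(1), of "1 / ?r"] by (simp add: SU2_sphere)
  show "s = ?r *\<^sub>R ((1 / ?r) *\<^sub>R s)" using assms by simp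
qed

text \<open>For imaginary unit quaternions \<open>Y\<close>, \<open>Y0\<close> the quaternion \<open>s = (1 - Y Y0) / 2\<close> satisfies
  \<open>s Y0 = Y s\<close>, so away from \<open>Y = - Y0\<close> its unit part conjugates \<open>Y0\<close> to \<open>Y\<close>.  It is
  polynomial in \<open>Y\<close> and equals \<open>1\<close> at \<open>Y = Y0\<close>.\<close>

definition rotor :: "complex^2^2 \<Rightarrow> complex^2^2 \<Rightarrow> complex^2^2" where
  "rotor Y0 Y = (1/2) *\<^sub>R (mat 1 - Y ** Y0)"

lemma matrix_mult_scaleR: "(r *\<^sub>R (A :: complex^2^2)) ** B = r *\<^sub>R (A ** (B :: complex^2^2))" "A ** (r *\<^sub>R B) = r *\<^sub>R (A ** (B :: complex^2^2))"
  by (simp_all add: mat2_simps algebra_simps)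

lemma matrix_mult_diff: "((A :: complex^2^2) - B) ** C = A ** C - B ** (C :: complex^2^2)" "C ** (A - B) = C ** A - C ** (B :: complex^2^2)"
  by (simp_all add: mat2_simps algebra_simps)

lemma matrix_mult_minus: "(- (A :: complex^2^2)) ** C = - (A ** (C :: complex^2^2))" "C ** (- A) = - (C ** (A :: complex^2^2))"
  by (simp_all add: mat2_simps algebra_simps)

lemma rotor_intertwines:
  assumes "Y0 \<in> su2" "norm Y0 = sqrt 2" "Y \<in> su2" "norm Y = sqrt 2"
  shows "rotor Y0 Y ** Y0 = Y ** rotor Y0 Y"
proof -
  have "(Y ** Y0) ** Y0 = - Y" "Y ** (Y ** Y0) = - Y0"
    using su2_square[OF assms(1,2)] su2_square[OF assms(3,4)]
    by (metis matrix_mul_assoc matrix_mult_minus matrix_mul_rid matrix_mul_lid)+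
  then show ?thesis
    by (simp add: rotor_def matrix_mult_scaleR matrix_mult_diff add.commute)
qed

lemma rotor_quat:
  assumes "Y0 \<in> su2" "Y \<in> su2"
  shows "rotor Y0 Y \<in> quat"
proof -
  have "Y0 \<in> quat" "Y \<in> quat" using assms by (auto simp: su2_quat)
  then have "Y ** Y0 \<in> quat" "mat 1 \<in> quat" by (auto simp: quat_mult SU2_quat)
  then show ?thesis
    unfolding rotor_def by (intro subspace_scale[OF subspace_quat] subspace_diff[OF subspace_quat])
qed

lemma rotor_eq_0:
  assumes "Y0 \<in> su2" "norm Y0 = sqrt 2" "rotor Y0 Y = 0"
  shows "Y = - Y0"
proof -
  have "Y ** Y0 = mat 1" using assms(3) by (simp add: rotor_def)
  then have "(Y ** Y0) ** Y0 = Y0" by simp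
  moreover have "(Y ** Y0) ** Y0 = - Y"
    using su2_square[OF assms(1,2)] by (metis matrix_mul_assoc matrix_mult_minus(2) matrix_mul_rid)
  ultimately have "- Y = Y0" by simp
  then show ?thesis by (metis minus_minus)
qed

lemma rotor_self: "Y \<in> su2 \<Longrightarrow> norm Y = sqrt 2 \<Longrightarrow> rotor Y Y = mat 1"
  by (simp add: rotor_def su2_square scaleR_2[symmetric])

lemma rotor_conjugates:
  assumes "Y0 \<in> su2" "norm Y0 = sqrt 2" "Y \<in> su2" "norm Y = sqrt 2" "rotor Y0 Y \<noteq> 0"
  obtains r h where "r > 0" "h \<in> SU2" "rotor Y0 Y = r *\<^sub>R h" "h ** Y0 ** ctransp h = Y"
proof -
  obtain r h where rh: "r > 0" "h \<in> SU2" "rotor Y0 Y = r *\<^sub>R h"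
    using quat_eq_scaled_SU2[OF rotor_quat[OF assms(1,3)] assms(5)] by blast
  have "r *\<^sub>R (h ** Y0) = r *\<^sub>R (Y ** h)"
    using rotor_intertwines[OF assms(1-4)] unfolding rh(3) matrix_mult_scaleR .
  then have "h ** Y0 = Y ** h" using rh(1) by simp
  then have "h ** Y0 ** ctransp h = Y ** (h ** ctransp h)" by (simp add: matrix_mul_assoc)
  then show ?thesis using that[OF rh] rh(2) by (simp add: SU2_mult_ctransp)
qed

text \<open>Such a \<open>g\<close> is the unit part of the rotor, except at the antipode of \<open>base_mat\<close>, where a unit
  quaternion that anticommutes with \<open>base_mat\<close> will do.\<close>

lemma SU2_conj_base:
  "(\<exists>g\<in>SU2. Y = g ** base_mat ** ctransp g) \<longleftrightarrow> Y \<in> su2 \<and> norm Y = sqrt 2"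
proof
  assume "\<exists>g\<in>SU2. Y = g ** base_mat ** ctransp g"
  then obtain g where g: "g \<in> SU2" "Y = g ** base_mat ** ctransp g" by blast
  have q: "g$2$1 = - cnj (g$1$2)" "g$2$2 = cnj (g$1$1)" using SU2_quat[OF g(1)] by (auto simp: quat_def)
  have Y: "Y \<in> su2"
    unfolding su2_iff g(2) by (simp add: matrix_mult_2 q)
  have "Y ** Y = g ** base_mat ** (ctransp g ** g) ** base_mat ** ctransp g"
    unfolding g(2) by (simp add: matrix_mul_assoc)
  also have "\<dots> = g ** (base_mat ** base_mat) ** ctransp g"
    by (simp add: SU2_ctransp_mult[OF g(1)] matrix_mul_assoc)
  also have "base_mat ** base_mat = - mat 1" by (simp add: mat2_simps)
  also have "g ** - mat 1 ** ctransp g = - mat 1"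
    by (simp add: matrix_mult_minus SU2_mult_ctransp[OF g(1)])
  finally have "(Y ** Y) $1$1 = -1" "(Y ** Y) $2$2 = -1" by (simp_all add: mat_1_entries)
  then have "Y \<bullet> Y = 2"
    using Y by (auto simp: su2_iff matrix_mult_2 inner_mat2 inner_complex_def complex_eq_iff power2_eq_square)
  then show "Y \<in> su2 \<and> norm Y = sqrt 2" using Y by (simp add: norm_mat2_sqrt2)
next
  assume Y: "Y \<in> su2 \<and> norm Y = sqrt 2"
  have b: "norm base_mat = sqrt 2" by (simp add: norm_mat2_sqrt2 inner_mat2 inner_complex_def)
  show "\<exists>g\<in>SU2. Y = g ** base_mat ** ctransp g"
  proof (cases "rotor base_mat Y = 0")
    case True
    then have Y: "Y = - base_mat" using rotor_eq_0[OF base_mat_su2 b] by blast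
    define g :: "complex^2^2" where "g = vector [vector [0, 1], vector [-1, 0]]"
    have ge: "g$1$1 = 0" "g$1$2 = 1" "g$2$1 = -1" "g$2$2 = 0" by (simp_all add: g_def)
    have "g \<in> SU2" by (simp add: SU2_iff quat_def ge)
    moreover have "Y = g ** base_mat ** ctransp g" by (simp add: Y mat2_simps ge)
    ultimately show ?thesis by blast
  next
    case False
    then show ?thesis using rotor_conjugates[OF base_mat_su2 b] Y by metis
  qed
qed

lemma E_space_eq: "(E_space :: 'n::{finite,linorder} lalg set) = {Y \<in> su2. norm Y = sqrt 2} \<times> V_real"
proof -
  have "x \<in> E_space \<longleftrightarrow> (\<exists>g\<in>SU2. fst x = g ** base_mat ** ctransp g) \<and> snd x \<in> V_real" for x :: "'n lalg"
  proof
    assume "x \<in> E_space"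
    then show "(\<exists>g\<in>SU2. fst x = g ** base_mat ** ctransp g) \<and> snd x \<in> V_real"
      by (auto simp: E_space_def E_act_base)
  next
    assume "(\<exists>g\<in>SU2. fst x = g ** base_mat ** ctransp g) \<and> snd x \<in> V_real"
    then obtain g where g: "g \<in> SU2" "fst x = g ** base_mat ** ctransp g" "snd x \<in> V_real" by blast
    then have "x = E_act (g, snd x) E_base" by (simp add: E_act_base prod_eq_iff)
    then show "x \<in> E_space" unfolding E_space_def using g by auto
  qed
  then show ?thesis unfolding SU2_conj_base by auto
qed

text \<open>A quaternion that is not a unit acts through \<open>tau\<close> as its unit part up to different powers of its
  length on the two components.\<close>

definition rescale :: "real \<Rightarrow> real \<Rightarrow> 'n::finite lalg \<Rightarrow> 'n lalg" where
  "rescale c d Z = (c *\<^sub>R fst Z, d *\<^sub>R snd Z)"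

lemma rescale_T01_base: "Z \<in> T01_base \<Longrightarrow> rescale c d Z \<in> T01_base"
  by (simp add: T01_base_def rescale_def V_minus_iff)

lemma tau_rescale: "tau A (rescale c d Z) = rescale c d (tau A Z)"
  by (simp add: tau_def rescale_def pact_scaleR matrix_mult_scaleR)

text \<open>Forms are homogeneous.\<close>

lemma pact_scaleR_left: "pact (r *\<^sub>R N) (a :: 'n::{finite,linorder} form) = r ^ (CARD('n) - 1) *\<^sub>R pact N a"
proof (rule hpoly_inj)
  fix v
  have "((r *\<^sub>R N) *v v) $ j = of_real r * (N *v v) $ j" for j
    using exhaust_2[of j] by (auto simp: matrix_vector_2 scaleR_conv_of_real[where 'a=complex] algebra_simps)
  then have "hpoly a ((r *\<^sub>R N) *v v) = (\<Sum>i\<in>UNIV. a $ i * (of_real r ^ zexp i * of_real r ^ wexp i) *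
      ((N *v v) $ 1) ^ zexp i * ((N *v v) $ 2) ^ wexp i)"
    by (simp add: hpoly_def power_mult_distrib mult_ac)
  also have "\<dots> = (\<Sum>i\<in>UNIV. of_real r ^ (CARD('n) - 1) * (a $ i * ((N *v v) $ 1) ^ zexp i * ((N *v v) $ 2) ^ wexp i))"
  proof (rule sum.cong[OF refl])
    fix i :: 'n
    have "zexp i + wexp i = CARD('n) - 1" using zexp_less[of i] by (simp add: wexp_def)
    then show "a $ i * (of_real r ^ zexp i * of_real r ^ wexp i) * ((N *v v) $ 1) ^ zexp i * ((N *v v) $ 2) ^ wexp i =
        of_real r ^ (CARD('n) - 1) * (a $ i * ((N *v v) $ 1) ^ zexp i * ((N *v v) $ 2) ^ wexp i)"
      by (simp add: power_add[symmetric])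
  qed
  also have "\<dots> = r ^ (CARD('n) - 1) *\<^sub>R hpoly a (N *v v)"
    by (simp add: hpoly_def sum_distrib_left[symmetric] scaleR_conv_of_real)
  finally show "hpoly (pact (r *\<^sub>R N) a) v = hpoly (r ^ (CARD('n) - 1) *\<^sub>R pact N a) v"
    by (simp add: hpoly_pact hpoly_scaleR)
qed

lemma tau_scaleR_left: "tau (r *\<^sub>R A) (Z :: 'n::{finite,linorder} lalg) = rescale (r\<^sup>2) (r ^ (CARD('n) - 1)) (tau A Z)"
  by (simp add: tau_def rescale_def pact_scaleR_left linear_scale[OF linear_ctransp] matrix_mult_scaleR power2_eq_square)

text \<open>A diagonal matrix multiplies \<open>F\<close> and each monomial by scalars.  As the stabilizer of the base
  point consists of such matrices, the translates of \<open>T01_base\<close> depend only on the point to which they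
  belong.\<close>

lemma tau_torus_T01_base:
  assumes t: "t \<in> SU2" "t$1$2 = 0" "t$2$1 = 0" and Z: "(Z :: 'n::{finite,linorder} lalg) \<in> T01_base"
  shows "tau t Z \<in> T01_base"
proof -
  have "snd (tau t Z) \<in> V_minus"
    unfolding V_minus_def
  proof (intro CollectI allI impI)
    fix i :: 'n assume i: "\<not> CARD('n) - 1 < 2 * zexp i"
    have "subst_coeff (ctransp t) (CARD('n) - 1) (zexp j) (zexp i) = 0" if "snd Z $ j \<noteq> 0" for j
    proof -
      have "CARD('n) - 1 < 2 * zexp j"
        using Z that by (auto simp: T01_base_def V_minus_def)
      then have ne: "zexp i < zexp j" using i by linarith
      have z: "(of_nat (zexp j choose l) * ctransp t $1$1 ^ l * ctransp t $1$2 ^ (zexp j - l)) *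
         (of_nat ((CARD('n) - 1 - zexp j) choose m) * ctransp t $2$1 ^ m * ctransp t $2$2 ^ (CARD('n) - 1 - zexp j - m)) = 0"
        if "l + m = zexp i" "l \<le> zexp j" for l m
        using that ne t by (simp add: power_0_left)
      show ?thesis
        unfolding subst_coeff_def
      proof (intro sum.neutral ballI)
        fix l m assume "l \<in> {..zexp j}"
        then show "(if l + m = zexp i then
          (of_nat (zexp j choose l) * ctransp t $1$1 ^ l * ctransp t $1$2 ^ (zexp j - l)) *
          (of_nat ((CARD('n) - 1 - zexp j) choose m) * ctransp t $2$1 ^ m * ctransp t $2$2 ^ (CARD('n) - 1 - zexp j - m)) else 0) = 0"
          using z[of l m] by (simp only: atMost_iff if_split) simp
      qed
    qed
    then have "snd Z $ j * subst_coeff (ctransp t) (CARD('n) - 1) (zexp j) (zexp i) = 0" for j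
      by (cases "snd Z $ j = 0") auto
    then show "snd (tau t Z) $ i = 0"
      by (simp only: tau_def pact_def snd_conv vec_lambda_beta sum.neutral_const)
  qed
  moreover have "fst (tau t Z) $1$1 = 0" "fst (tau t Z) $1$2 = 0" "fst (tau t Z) $2$2 = 0"
    using t(2,3) Z by (auto simp: tau_def matrix_mult_2 T01_base_def)
  ultimately show ?thesis by (simp add: T01_base_def)
qed

lemma SU2_stabilizer_base:
  assumes g: "g \<in> SU2"
  shows "g ** base_mat ** ctransp g = base_mat \<longleftrightarrow> g$1$2 = 0 \<and> g$2$1 = 0"
proof
  assume "g ** base_mat ** ctransp g = base_mat"
  then have "g ** base_mat ** (ctransp g ** g) = base_mat ** g" by (simp add: matrix_mul_assoc)
  then have "g ** base_mat = base_mat ** g" by (simp add: SU2_ctransp_mult[OF g])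
  then have "\<i> * g$1$2 = - (\<i> * g$1$2)" "\<i> * g$2$1 = - (\<i> * g$2$1)"
    by (auto simp: mat2_eq_iff matrix_mult_2 algebra_simps)
  then show "g$1$2 = 0 \<and> g$2$1 = 0" by simp
next
  assume *: "g$1$2 = 0 \<and> g$2$1 = 0"
  then have "g ** base_mat = base_mat ** g" by (simp add: mat2_eq_iff matrix_mult_2)
  then have "g ** base_mat ** ctransp g = base_mat ** (g ** ctransp g)" by (simp add: matrix_mul_assoc)
  then show "g ** base_mat ** ctransp g = base_mat" by (simp add: SU2_mult_ctransp[OF g])
qed

context even_degree
begin

abbreviation "Grp \<equiv> (G_real :: 'n lalg monoid)"
abbreviation "Esp \<equiv> (E_space :: 'n lalg set)"
abbreviation "base \<equiv> (E_base :: 'n lalg)"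

lemma base_in_E: "base \<in> Esp"
  unfolding E_space_eq
  by (simp add: E_base_eq base_mat_su2 norm_mat2_sqrt2 inner_mat2 inner_complex_def)

lemma E_act_mult: "g \<in> carrier Grp \<Longrightarrow> h \<in> carrier Grp \<Longrightarrow> E_act (g \<otimes>\<^bsub>Grp\<^esub> h) x = E_act g (E_act h x)"
  by (auto simp: E_act_tau G_real_mult SU2_mult tau_def pact_add pact_pact ctransp_mult matrix_mul_assoc add.assoc)

lemma E_act_one: "E_act \<one>\<^bsub>Grp\<^esub> x = x"
  by (simp add: E_act_tau flip: zero_prod_def)

lemma E_act_closed: "g \<in> carrier Grp \<Longrightarrow> x \<in> Esp \<Longrightarrow> E_act g x \<in> Esp"
proof -
  assume g: "g \<in> carrier Grp" and x: "x \<in> Esp"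
  then obtain h where h: "h \<in> carrier Grp" "x = E_act h base" by (auto simp: E_space_def)
  then have "E_act g x = E_act (g \<otimes>\<^bsub>Grp\<^esub> h) base" using g by (simp only: E_act_mult)
  moreover have "g \<otimes>\<^bsub>Grp\<^esub> h \<in> carrier Grp"
    using group.is_monoid[OF group_G_real] g h(1) by (rule monoid.m_closed)
  ultimately show ?thesis unfolding E_space_def by blast
qed

lemma E_spaceE:
  assumes "x \<in> Esp"
  obtains g where "g \<in> carrier Grp" "x = E_act g base" "fst g \<in> SU2" "snd g \<in> V_real"
  using assms by (auto simp: E_space_def)

lemma inv_closed: "g \<in> carrier Grp \<Longrightarrow> inv\<^bsub>Grp\<^esub> g \<in> carrier Grp"
  by (rule group.inv_closed[OF group_G_real])

lemma mult_closed: "g \<in> carrier Grp \<Longrightarrow> h \<in> carrier Grp \<Longrightarrow> g \<otimes>\<^bsub>Grp\<^esub> h \<in> carrier Grp"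
  by (rule monoid.m_closed[OF group.is_monoid[OF group_G_real]])

lemma E_act_inv: "g \<in> carrier Grp \<Longrightarrow> E_act (inv\<^bsub>Grp\<^esub> g) (E_act g x) = x"
  "g \<in> carrier Grp \<Longrightarrow> E_act g (E_act (inv\<^bsub>Grp\<^esub> g) x) = x"
  by (simp_all only: E_act_mult[symmetric] inv_closed group.l_inv[OF group_G_real] group.r_inv[OF group_G_real] E_act_one)

lemma transitive_E_act: "transitive_action Grp Esp (\<lambda>g. restrict (E_act g) Esp)"
proof (intro transitive_action.intro group_action.intro transitive_action_axioms.intro)
  have bij: "restrict (E_act g) Esp \<in> Bij Esp" if "g \<in> carrier Grp" for g
  proof -
    have "bij_betw (E_act g) Esp Esp"
      by (rule bij_betw_byWitness[where f' = "E_act (inv\<^bsub>Grp\<^esub> g)"])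
        (use that E_act_inv E_act_closed inv_closed in blast)+
    then show ?thesis by (simp add: Bij_def)
  qed
  show "group_hom Grp (BijGroup Esp) (\<lambda>g. restrict (E_act g) Esp)"
  proof (intro group_hom.intro group_hom_axioms.intro group_G_real group_BijGroup homI)
    show "restrict (E_act g) Esp \<in> carrier (BijGroup Esp)" if "g \<in> carrier Grp" for g
      using bij[OF that] by (simp add: BijGroup_def)
    show "restrict (E_act (g \<otimes>\<^bsub>Grp\<^esub> h)) Esp =
        restrict (E_act g) Esp \<otimes>\<^bsub>BijGroup Esp\<^esub> restrict (E_act h) Esp"
      if "g \<in> carrier Grp" "h \<in> carrier Grp" for g h
      using bij[OF that(1)] bij[OF that(2)] that
      by (auto simp: BijGroup_def compose_def restrict_def fun_eq_iff E_act_mult E_act_closed)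
  qed
  fix x y assume "x \<in> Esp" "y \<in> Esp"
  then obtain g h where g: "g \<in> carrier Grp" "x = E_act g base" and h: "h \<in> carrier Grp" "y = E_act h base"
    by (metis E_spaceE)
  have "E_act (h \<otimes>\<^bsub>Grp\<^esub> inv\<^bsub>Grp\<^esub> g) x = y"
    using g h by (simp only: E_act_mult inv_closed E_act_inv)
  then show "\<exists>g\<in>carrier Grp. restrict (E_act g) Esp x = y"
    using \<open>x \<in> Esp\<close> by (intro bexI[OF _ mult_closed[OF h(1) inv_closed[OF g(1)]]]) simp
qed

lemma stabilizer_E_base: "stabilizer Grp (\<lambda>g. restrict (E_act g) Esp) base = torus"
proof -
  have "g \<in> carrier Grp \<and> E_act g base = base \<longleftrightarrow> g \<in> torus" for g :: "'n lalg"
  proof (cases "fst g \<in> SU2")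
    case True
    show ?thesis
      unfolding E_act_base[OF True] using True
      by (cases g) (auto simp: torus_def E_base_eq SU2_stabilizer_base)
  qed (auto simp: torus_def)
  then show ?thesis
    unfolding stabilizer_def using base_in_E by auto
qed

lemma smooth_E_act: "smooth_map (carrier Grp \<times> Esp) (\<lambda>p. E_act (fst p) (snd p))"
  by (rule smooth_mapI[of "\<lambda>p. (0, snd (fst p)) + tau (fst (fst p)) (snd p)"])
    (intro smooth_intros open_UNIV, auto simp: E_act_tau)

lemma submanifold_E_space: "submanifold (2 + CARD('n)) Esp"
  unfolding E_space_eq
  by (intro submanifold_Times submanifold_sphere_subspace[OF subspace_su2] submanifold_V_real)
    (simp_all add: dim_su2)

lemma mdiff_E_act:
  assumes g: "g \<in> carrier Grp" and v: "v \<in> tangent_space Esp x"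
  shows "mdiff Esp (E_act g) x v = tau (fst g) v"
proof (rule mdiff_eqI[OF v])
  show "((\<lambda>y. (0, snd g) + tau (fst g) y) has_derivative tau (fst g)) (at x)"
    using linear_tau[of "fst g"]
    by (auto intro!: derivative_eq_intros bounded_linear_imp_has_derivative simp: linear_conv_bounded_linear)
qed (use g in \<open>auto simp: E_act_tau\<close>)

lemma orbit_diff_E_base:
  assumes X: "X \<in> (g_real :: 'n lalg set)"
  shows "orbit_diff Grp E_act base X = inf_act X"
proof -
  have Xs: "ctransp (fst X) = - fst X" using X by (intro su2_ctransp) (auto simp: g_real_def)
  have t: "((\<lambda>g. tau (fst g) base) has_derivative
      (\<lambda>v. (fst v ** fst base + fst base ** ctransp (fst v), der (ctransp (fst v)) (snd base)) + 0)) (at \<one>\<^bsub>Grp\<^esub>)"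
    by (rule has_derivative_tau_at_one[OF bounded_linear_imp_has_derivative[OF bounded_linear_fst] has_derivative_const])
      simp
  have s: "((\<lambda>g::'n lalg. (0::complex^2^2, snd g)) has_derivative (\<lambda>v. (0, snd v))) (at \<one>\<^bsub>Grp\<^esub>)"
    by (intro has_derivative_Pair has_derivative_const bounded_linear_imp_has_derivative bounded_linear_snd)
  have "mdiff (carrier Grp) (\<lambda>g. E_act g base) \<one>\<^bsub>Grp\<^esub> X =
      (0, snd X) + ((fst X ** fst base + fst base ** ctransp (fst X), der (ctransp (fst X)) (snd base)) + 0)"
    by (rule mdiff_eqI[OF _ has_derivative_add[OF s t]])
      (use X tangent_space_G_real in \<open>auto simp: E_act_tau simp del: G_real_simps(2)\<close>)
  then show ?thesis
    unfolding orbit_diff_def by (simp add: inf_act_def Xs E_base_eq matrix_mult_minus)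
qed

text \<open>The image of a curve in the group with velocity \<open>A\<close> realises the vector of the action field of
  \<open>A\<close>, translated by \<open>g\<close>, as a tangent vector.\<close>

lemma curve_in_E_space:
  assumes g: "g \<in> carrier Grp" and A: "A \<in> (g_real :: 'n lalg set)"
  shows "curve_in Esp (E_act g base) (tau (fst g) (inf_act A)) (\<lambda>t. E_act g (E_act (cayley_G A t) base))"
proof -
  have gS: "fst g \<in> SU2" using g by auto
  have As: "ctransp (fst A) = - fst A" using A by (intro su2_ctransp) (auto simp: g_real_def)
  let ?r = "cayley_radius (fst A)"
  define c where "c t = (0, snd g) + tau (fst g) ((0, t *\<^sub>R snd A) + tau (cayley (fst A) t) base)" for t
  have "fst A \<in> su2" using A by (auto simp: g_real_def)
  then have eq: "E_act g (E_act (cayley_G A t) base) = c t" if "\<bar>t\<bar> < ?r" for t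
    using that gS by (simp add: c_def cayley_G_def E_act_tau cayley_SU2)
  have d1: "(c has_derivative (\<lambda>t. 0 + tau (fst g) ((0, t *\<^sub>R snd A) +
      (((t *\<^sub>R fst A) ** fst base + fst base ** ctransp (t *\<^sub>R fst A), der (ctransp (t *\<^sub>R fst A)) (snd base)) + 0)))) (at 0)"
    unfolding c_def
    by (intro has_derivative_add has_derivative_const bounded_linear.has_derivative[OF linear_tau[THEN linear_conv_bounded_linear[THEN iffD1]]]
        has_derivative_Pair bounded_linear_imp_has_derivative[OF bounded_linear_scaleR_left]
        has_derivative_tau_at_one cayley_deriv[unfolded has_vector_derivative_def] cayley_0)
  have "(\<lambda>t. 0 + tau (fst g) ((0, t *\<^sub>R snd A) +
      (((t *\<^sub>R fst A) ** fst base + fst base ** ctransp (t *\<^sub>R fst A), der (ctransp (t *\<^sub>R fst A)) (snd base)) + 0)))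
     = (\<lambda>t. t *\<^sub>R tau (fst g) (inf_act A))"
    unfolding tau_scaleR[symmetric]
    by (simp add: linear_scale[OF linear_ctransp] As inf_act_def matrix_mult_scaleR matrix_mult_minus
        E_base_eq scaleR_diff_right prod_eq_iff)
  then have d: "(c has_vector_derivative tau (fst g) (inf_act A)) (at 0)"
    using d1 by (simp add: has_vector_derivative_def)
  have ev: "\<forall>\<^sub>F t in nhds 0. c t = E_act g (E_act (cayley_G A t) base)"
    using eventually_nhds_in_open[of "{-?r<..<?r}" 0] cayley_radius_pos[of "fst A"]
    by (auto elim!: eventually_mono simp: eq abs_less_iff)
  show ?thesis
  proof (rule curve_inI[OF cayley_radius_pos[of "fst A"]])
    have "smooth_on {-?r<..<?r} c"
      unfolding c_def by (intro smooth_intros smooth_on_cayley) simp_all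
    then show "smooth_on {-?r<..<?r} (\<lambda>t. E_act g (E_act (cayley_G A t) base))"
      by (rule smooth_on_cong) (simp add: eq abs_less_iff)
    show "E_act g (E_act (cayley_G A t) base) \<in> Esp" if "\<bar>t\<bar> < ?r" for t
    proof -
      have "cayley_G A t \<in> carrier Grp"
        using A that by (auto simp: cayley_G_def g_real_def cayley_SU2 V_real_scale)
      then show ?thesis by (intro E_act_closed g base_in_E)
    qed
    show "E_act g (E_act (cayley_G A 0) base) = E_act g base"
      using E_act_one[of base] by (simp add: cayley_G_def cayley_0)
    show "((\<lambda>t. E_act g (E_act (cayley_G A t) base)) has_vector_derivative tau (fst g) (inf_act A)) (at 0)"
      by (rule has_vector_derivative_eventually_eq[OF d ev])
  qed
qed

lemma tangent_E_space:
  "g \<in> carrier Grp \<Longrightarrow> A \<in> g_real \<Longrightarrow> tau (fst g) (inf_act A) \<in> tangent_space Esp (E_act g base)"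
  using curve_in_E_space unfolding tangent_space_def by blast

lemma q_prime_g_cplx: "(q_prime :: 'n lalg set) \<subseteq> g_cplx"
  by (auto simp: q_prime_def borel_b_def g_cplx_def)

lemma E_T01_raw:
  "(E_T01 x :: ('n lalg \<times> 'n lalg) set) = {(tau (fst g) (inf_act X), tau (fst g) (inf_act Y)) | g X Y.
     g \<in> carrier Grp \<and> E_act g base = x \<and> X \<in> g_real \<and> Y \<in> g_real \<and> X + lscale \<i> Y \<in> q_prime}"
proof -
  have "mdiff Esp (E_act g) base (orbit_diff Grp E_act base X) = tau (fst g) (inf_act X)"
    if "g \<in> carrier Grp" "X \<in> g_real" for g X
    using mdiff_E_act[OF that(1)] tangent_E_space[of "\<one>\<^bsub>Grp\<^esub>" X] that E_act_one[of base]
    by (simp add: orbit_diff_E_base)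
  then show ?thesis unfolding E_T01_def by (metis (no_types, opaque_lifting))
qed

text \<open>An element \<open>h\<close> with \<open>h o = g o\<close> differs from \<open>g\<close> by an element \<open>t\<close> of the stabilizer, and \<open>t\<close>
  preserves \<open>T01_base\<close>.\<close>

lemma E_T01_eq:
  assumes g: "g \<in> carrier Grp"
  shows "(E_T01 (E_act g base) :: ('n lalg \<times> 'n lalg) set) = re_im ` tau (fst g) ` T01_base"
proof (intro equalityI subsetI)
  fix p :: "'n lalg \<times> 'n lalg" assume "p \<in> E_T01 (E_act g base)"
  then obtain h X Y where h: "h \<in> carrier Grp" "E_act h base = E_act g base" and XY: "X \<in> g_real" "Y \<in> g_real"
    "X + lscale \<i> Y \<in> q_prime" and p: "p = (tau (fst h) (inf_act X), tau (fst h) (inf_act Y))"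
    unfolding E_T01_raw by blast
  have S: "fst g \<in> SU2" "fst h \<in> SU2" using g h by auto
  define t where "t = ctransp (fst g) ** fst h"
  have t: "t \<in> SU2" using S by (simp add: t_def SU2_mult SU2_ctransp)
  have gt: "fst g ** t = fst h" using S by (simp add: t_def matrix_mul_assoc SU2_mult_ctransp)
  have "fst h ** base_mat ** ctransp (fst h) = fst g ** base_mat ** ctransp (fst g)"
    using h(2) S by (simp add: E_act_base)
  moreover have "t ** base_mat ** ctransp t = ctransp (fst g) ** (fst h ** base_mat ** ctransp (fst h)) ** fst g"
    by (simp only: t_def ctransp_mult ctransp_ctransp matrix_mul_assoc)
  ultimately have "t ** base_mat ** ctransp t = (ctransp (fst g) ** fst g) ** base_mat ** (ctransp (fst g) ** fst g)"
    by (simp only: matrix_mul_assoc)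
  then have "t$1$2 = 0 \<and> t$2$1 = 0"
    using SU2_stabilizer_base[OF t] S by (simp add: SU2_ctransp_mult)
  moreover have "inf_act (X + lscale \<i> Y) \<in> T01_base" using XY(3) inf_act_image by blast
  ultimately have n: "tau t (inf_act (X + lscale \<i> Y)) \<in> T01_base" using tau_torus_T01_base[OF t] by blast
  have "p = re_im (recombine p)"
    using p XY S by (intro re_im_recombine[symmetric]) (simp add: tau_g_real inf_act_g_real)
  also have "recombine p = tau (fst h) (inf_act (X + lscale \<i> Y))"
    by (simp add: p recombine_def linear_inf_act tau_add tau_lscale)
  also have "\<dots> = tau (fst g) (tau t (inf_act (X + lscale \<i> Y)))" by (simp add: tau_tau gt)
  finally show "p \<in> re_im ` tau (fst g) ` T01_base" using n by blast
next
  fix p :: "'n lalg \<times> 'n lalg" assume "p \<in> re_im ` tau (fst g) ` T01_base"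
  then obtain n where n: "n \<in> T01_base" "p = re_im (tau (fst g) n)" by blast
  obtain Z where Z: "Z \<in> q_prime" "n = inf_act Z" using n(1) inf_act_image by blast
  have Zg: "Z \<in> g_cplx" using Z(1) q_prime_g_cplx by blast
  have S: "fst g \<in> SU2" using g by auto
  have re: "re_part Z \<in> g_real" "im_part Z \<in> g_real" using re_part_g_real im_part_g_real Zg by auto
  have rZ: "re_part Z + lscale \<i> (im_part Z) = Z" using recombine_re_im[of Z] by (simp add: recombine_def re_im_def)
  let ?p = "(tau (fst g) (inf_act (re_part Z)), tau (fst g) (inf_act (im_part Z)))"
  have "recombine ?p = tau (fst g) (inf_act Z)"
    by (subst (3) rZ[symmetric]) (simp add: recombine_def linear_inf_act tau_add tau_lscale)
  moreover have "?p \<in> g_real \<times> g_real" using re S by (simp add: tau_g_real inf_act_g_real)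
  ultimately have "p = ?p" using n(2) Z(2) re_im_recombine[of ?p] by simp
  then show "p \<in> E_T01 (E_act g base)"
    unfolding E_T01_raw using g re rZ Z(1)
    by - (rule CollectI, rule exI[of _ g], rule exI[of _ "re_part Z"], rule exI[of _ "im_part Z"], simp)
qed

end

section \<open>The CR structure\<close>

lemma ad2_add_left: "ad2 (A + B) Z = ad2 A Z + ad2 B Z"
  by (simp add: ad2_def der_add_left mat2_simps algebra_simps)

lemma ad2_lscale_left: "ad2 (fst (lscale c X)) Z = lscale c (ad2 (fst X) Z)"
proof -
  have "fst (lscale c X) = (\<chi> i j. c * fst X $ i $ j)" by (simp add: lscale_def)
  then show ?thesis
    by (simp add: ad2_def prod_eq_iff lscale_def der_scale_left mat2_simps algebra_simps vec_eq_iff)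
qed

lemma eventually_nhds_isCont:
  assumes "isCont c (x :: 'a::t2_space)" "open U" "c x \<in> U"
  shows "\<forall>\<^sub>F t in nhds x. c t \<in> U"
  using assms tendsto_at_iff_tendsto_nhds[of c x] topological_tendstoD[of c "c x" "nhds x" U]
  unfolding isCont_def by blast

lemma real_subspace_T01_base: "subspace (T01_base :: 'n::{finite,linorder} lalg set)"
  using subspace_T01_base unfolding subspace_def lv.subspace_def scaleR_lscale by blast

context even_degree
begin

lemma subspace_g_real: "subspace (g_real :: 'n lalg set)"
  unfolding g_real_def by (intro subspace_Times subspace_su2 subspace_V_real odd_card)

lemma E_T01_g_real: "(E_T01 x :: ('n lalg \<times> 'n lalg) set) \<subseteq> g_real \<times> g_real"
  unfolding E_T01_raw using tau_g_real inf_act_g_real by fastforce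

lemma recombine_E_T01_iff:
  assumes "g \<in> carrier Grp" "p \<in> (g_real :: 'n lalg set) \<times> g_real"
  shows "p \<in> E_T01 (E_act g base) \<longleftrightarrow> tau (ctransp (fst g)) (recombine p) \<in> T01_base"
proof -
  have S: "fst g \<in> SU2" using assms(1) by auto
  show ?thesis
  proof
    assume "p \<in> E_T01 (E_act g base)"
    then show "tau (ctransp (fst g)) (recombine p) \<in> T01_base"
      unfolding E_T01_eq[OF assms(1)] by (auto simp: tau_SU2_inverse[OF S])
  next
    assume n: "tau (ctransp (fst g)) (recombine p) \<in> T01_base"
    have "p = re_im (tau (fst g) (tau (ctransp (fst g)) (recombine p)))"
      unfolding tau_SU2_inverse[OF S] by (rule re_im_recombine[OF assms(2), symmetric])
    then show "p \<in> E_T01 (E_act g base)" unfolding E_T01_eq[OF assms(1)] using n by blast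
  qed
qed

lemma linear_re_im_tau: "Vector_Spaces.linear lscale pscale (\<lambda>Z :: 'n lalg. re_im (tau A Z))"
  unfolding Vector_Spaces.linear_iff
  using vector_space_lscale vector_space_pscale
  by (simp add: tau_add re_im_add tau_lscale re_im_lscale)

lemma inj_re_im_tau: "A \<in> SU2 \<Longrightarrow> inj (\<lambda>Z :: 'n lalg. re_im (tau A Z))"
  using inj_re_im by (metis (mono_tags, lifting) injD injI tau_SU2_inverse(1))

lemma E_T01_image: "g \<in> carrier Grp \<Longrightarrow>
    (E_T01 (E_act g base) :: ('n lalg \<times> 'n lalg) set) = (\<lambda>Z. re_im (tau (fst g) Z)) ` T01_base"
  by (simp only: E_T01_eq image_image)

lemma E_T01_subspace:
  assumes "x \<in> Esp"
  shows "pv.subspace (E_T01 x :: ('n lalg \<times> 'n lalg) set)"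
proof -
  obtain g where g: "g \<in> carrier Grp" "x = E_act g base" using E_spaceE[OF assms] by blast
  interpret f: Vector_Spaces.linear lscale pscale "\<lambda>Z :: 'n lalg. re_im (tau (fst g) Z)"
    by (rule linear_re_im_tau)
  show ?thesis unfolding g(2) E_T01_image[OF g(1)] by (rule f.subspace_image[OF subspace_T01_base])
qed

lemma E_T01_dim:
  assumes "x \<in> Esp" "CARD('n) = 2 * q + 1"
  shows "pv.dim (E_T01 x :: ('n lalg \<times> 'n lalg) set) = q + 1"
proof -
  obtain g where g: "g \<in> carrier Grp" "x = E_act g base" "fst g \<in> SU2" using E_spaceE[OF assms(1)] by blast
  have "card (insert (Inl 2) (Inr ` (high_index :: 'n set)) :: (nat + 'n) set) = q + 1"
    by (subst card_insert_disjoint) (auto simp: card_image card_high_index[OF assms(2)])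
  moreover have "insert (Inl 2) (Inr ` (high_index :: 'n set)) \<subseteq> std_index" by (auto simp: std_index_def)
  ultimately show ?thesis
    unfolding g(2) E_T01_image[OF g(1)] T01_base_coord
    by (simp add: dim_image_inj[OF linear_re_im_tau inj_re_im_tau[OF g(3)]])
qed

lemma E_T01_tangent:
  "(E_T01 x :: ('n lalg \<times> 'n lalg) set) \<subseteq> tangent_space Esp x \<times> tangent_space Esp x"
  unfolding E_T01_raw using tangent_E_space by fastforce

text \<open>After translation to the base point one vector is supported on exponents above the middle and the
  conjugate of the other on those below.\<close>

lemma E_T01_conj:
  assumes "x \<in> Esp"
  shows "(E_T01 x :: ('n lalg \<times> 'n lalg) set) \<inter> pconj ` E_T01 x = {0}"
proof -
  obtain g where g: "g \<in> carrier Grp" "x = E_act g base" "fst g \<in> SU2" using E_spaceE[OF assms] by blast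
  have 0: "0 \<in> (E_T01 x :: ('n lalg \<times> 'n lalg) set)" using pv.subspace_0[OF E_T01_subspace[OF assms]] .
  moreover have "p = 0" if p: "p \<in> E_T01 x" "p \<in> pconj ` E_T01 x" for p :: "'n lalg \<times> 'n lalg"
  proof -
    obtain n where n: "n \<in> T01_base" "p = re_im (tau (fst g) n)" using p(1) unfolding g(2) E_T01_image[OF g(1)] by blast
    obtain m where m: "m \<in> T01_base" "p = pconj (re_im (tau (fst g) m))" using p(2) unfolding g(2) E_T01_image[OF g(1)] by blast
    have "re_im (tau (fst g) n) = re_im (tau (fst g) (rconj m))"
      using n(2) m(2) by (simp add: pconj_re_im rconj_tau SU2_quat[OF g(3)])
    then have nm: "n = rconj m" using inj_re_im_tau[OF g(3)] by (meson injD)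
    have "cf (snd n) h = 0" for h
    proof (cases "2 * h \<le> int CARD('n) - 1")
      case True
      then show ?thesis using n(1) by (auto simp: T01_base_def V_minus_iff)
    next
      case False
      then show ?thesis using m(1) by (simp add: nm rconj_def theta_eq[OF odd_card] T01_base_def V_minus_iff)
    qed
    moreover have "fst n = 0"
      using n(1) m(1) by (auto simp: T01_base_def nm rconj_def mat2_eq_iff)
    ultimately have "n = 0" by (simp add: lalg_eq_iff)
    moreover have "tau (fst g) (0 :: 'n lalg) = 0" by (rule linear_0[OF linear_tau])
    ultimately show "p = 0" using n(2) linear_0[OF linear_re_im] by simp
  qed
  moreover have "0 \<in> pconj ` (E_T01 x :: ('n lalg \<times> 'n lalg) set)"
    by (rule image_eqI[OF _ 0]) (simp add: pconj_def zero_prod_def)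
  ultimately show ?thesis by blast
qed

text \<open>The rotor from \<open>fst x\<close> to \<open>fst y\<close> is polynomial in \<open>y\<close>.  Up to a length it is an element of \<open>SU2\<close> that
  carries \<open>x\<close> to a point over \<open>fst y\<close>, and lengths do no harm because \<open>T01_base\<close> is invariant
  under \<open>rescale\<close>.\<close>

lemma E_T01_extension:
  assumes x: "x \<in> Esp" and \<zeta>: "\<zeta> \<in> (E_T01 x :: ('n lalg \<times> 'n lalg) set)"
  shows "\<exists>U Z. x \<in> U \<and> smooth_on U Z \<and> Z x = \<zeta> \<and> (\<forall>y\<in>U \<inter> Esp. Z y \<in> E_T01 y)"
proof -
  obtain g where g: "g \<in> carrier Grp" "x = E_act g base" "fst g \<in> SU2" using E_spaceE[OF x] by blast
  obtain n where n: "n \<in> T01_base" "\<zeta> = re_im (tau (fst g) n)" using \<zeta> unfolding g(2) E_T01_image[OF g(1)] by blast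
  have Y0: "fst x \<in> su2" "norm (fst x) = sqrt 2" using x unfolding E_space_eq by auto
  have Y0g: "fst x = fst g ** base_mat ** ctransp (fst g)" by (simp add: g(2) E_act_base[OF g(3)])
  define Z where "Z y = re_im (tau (rotor (fst x) (fst y)) (tau (fst g) n))" for y :: "'n lalg"
  have "smooth_on UNIV Z"
    unfolding Z_def rotor_def
    by (intro smooth_on_linear[OF linear_re_im] smooth_intros open_UNIV)
  moreover have "Z x = \<zeta>" by (simp add: Z_def rotor_self[OF Y0] n(2))
  moreover have "Z y \<in> E_T01 y" if y: "y \<in> Esp" for y
  proof -
    have Y: "fst y \<in> su2" "norm (fst y) = sqrt 2" using y unfolding E_space_eq by auto
    \<comment> \<open>At the antipode of \<open>fst x\<close> the rotor vanishes, and every \<open>h\<close> that conjugates \<open>fst x\<close> to \<open>fst y\<close> serves with factor \<open>0\<close>.\<close>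
    obtain r h where h: "h \<in> SU2" "rotor (fst x) (fst y) = r *\<^sub>R h" "h ** fst x ** ctransp h = fst y"
    proof (cases "rotor (fst x) (fst y) = 0")
      case True
      obtain g' where g': "g' \<in> carrier Grp" "y = E_act g' base" "fst g' \<in> SU2" using E_spaceE[OF y] by blast
      let ?h = "fst g' ** ctransp (fst g)"
      have "?h ** fst x ** ctransp ?h = fst g' ** (ctransp (fst g) ** fst g) ** base_mat **
          (ctransp (fst g) ** fst g) ** ctransp (fst g')"
        by (simp add: Y0g ctransp_mult matrix_mul_assoc)
      also have "\<dots> = fst y" by (simp add: SU2_ctransp_mult[OF g(3)] g'(2) E_act_base[OF g'(3)])
      finally show ?thesis using that[of ?h 0] True g'(3) g(3) by (simp add: SU2_mult SU2_ctransp)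
    next
      case False
      then show ?thesis using rotor_conjugates[OF Y0 Y] that by metis
    qed
    let ?g = "(h ** fst g, snd y)"
    have "snd y \<in> V_real" using y unfolding E_space_eq by auto
    then have g': "?g \<in> carrier Grp" using h(1) g(3) by (simp add: SU2_mult)
    have yg: "y = E_act ?g base"
      using h g(3) by (simp add: E_act_base SU2_mult ctransp_mult prod_eq_iff Y0g matrix_mul_assoc flip: h(3))
    have "Z y = re_im (tau (h ** fst g) (rescale (r\<^sup>2) (r ^ (CARD('n) - 1)) n))"
      by (simp only: Z_def h(2) tau_scaleR_left) (simp only: tau_rescale tau_tau)
    moreover have "re_im (tau (h ** fst g) (rescale (r\<^sup>2) (r ^ (CARD('n) - 1)) n)) \<in> E_T01 (E_act ?g base)"
      unfolding E_T01_image[OF g'] fst_conv by (rule imageI) (rule rescale_T01_base[OF n(1)])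
    ultimately show ?thesis using yg by simp
  qed
  ultimately show ?thesis by (intro exI[of _ UNIV] exI[of _ Z]) auto
qed

text \<open>Integrability.  Along the curve \<open>t \<mapsto> g \<gamma>(t) o\<close> with velocity \<open>A\<close> a section of the structure is
  \<open>g \<gamma>(t) n(t)\<close> with \<open>n(t)\<close> in the fixed space \<open>T01_base\<close>, so its derivative is
  \<open>g ([A, n] + n')\<close>.\<close>

lemma section_derivative_real:
  assumes W: "smooth_on U W" "\<And>y. y \<in> U \<inter> Esp \<Longrightarrow> W y \<in> E_T01 y"
    and g: "g \<in> carrier Grp" "E_act g base \<in> U" and A: "A \<in> (g_real :: 'n lalg set)"
  defines "D \<equiv> frechet_derivative W (at (E_act g base))"
  shows "D (tau (fst g) (inf_act A)) \<in> g_real \<times> g_real"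
    and "tau (ctransp (fst g)) (recombine (D (tau (fst g) (inf_act A)))) -
       ad2 (fst A) (tau (ctransp (fst g)) (recombine (W (E_act g base)))) \<in> T01_base"
proof -
  define c where "c t = E_act g (E_act (cayley_G A t) base)" for t
  have c: "curve_in Esp (E_act g base) (tau (fst g) (inf_act A)) c"
    unfolding c_def by (rule curve_in_E_space[OF g(1) A])
  note c' = curve_inD[OF c]
  let ?r = "cayley_radius (fst A)"
  have S: "fst g \<in> SU2" using g(1) by auto
  have As: "ctransp (fst A) = - fst A" using A by (intro su2_ctransp) (auto simp: g_real_def)
  have "(W has_derivative D) (at (E_act g base))"
    unfolding D_def by (rule smooth_on_has_derivative[OF W(1) g(2)])
  then have w: "((\<lambda>t. W (c t)) has_vector_derivative D (tau (fst g) (inf_act A))) (at 0)"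
    by (intro has_vector_derivative_chain_at[OF c'(2)]) (simp add: c'(1))
  have "isCont c 0" using c'(2) by (rule has_vector_derivative_continuous)
  then have evU: "\<forall>\<^sub>F t in nhds 0. c t \<in> U"
    by (rule eventually_nhds_isCont) (use smooth_on_open[OF W(1)] g(2) c'(1) in auto)
  have evr: "\<forall>\<^sub>F t in nhds 0. \<bar>t\<bar> < ?r"
    using eventually_nhds_in_open[of "{-?r<..<?r}" 0] cayley_radius_pos[of "fst A"]
    by (auto elim!: eventually_mono simp: abs_less_iff)
  have evT: "\<forall>\<^sub>F t in nhds 0. W (c t) \<in> E_T01 (c t)"
    using evU c'(3) by eventually_elim (use W(2) in blast)
  have "\<forall>\<^sub>F t in nhds 0. W (c t) \<in> g_real \<times> g_real"
    using evT by eventually_elim (rule subsetD[OF E_T01_g_real])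
  then show "D (tau (fst g) (inf_act A)) \<in> g_real \<times> g_real"
    by (rule tangent_in_subspace[OF subspace_Times[OF subspace_g_real subspace_g_real] w])
  define m where "m t = tau (ctransp (fst g)) (recombine (W (c t)))" for t
  define M where "M = tau (ctransp (fst g)) (recombine (D (tau (fst g) (inf_act A))))"
  have lin: "bounded_linear (\<lambda>p :: 'n lalg \<times> 'n lalg. tau (ctransp (fst g)) (recombine p))"
    unfolding linear_conv_bounded_linear[symmetric]
    using linear_compose[OF linear_recombine linear_tau] by (simp add: o_def)
  have m: "(m has_vector_derivative M) (at 0)"
    unfolding m_def M_def by (rule bounded_linear.has_vector_derivative[OF lin w])
  have ct: "((\<lambda>t. ctransp (cayley (fst A) t)) has_derivative (\<lambda>t. ctransp (t *\<^sub>R fst A))) (at 0)"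
    by (rule bounded_linear.has_derivative[OF bounded_linear_ctransp cayley_deriv[unfolded has_vector_derivative_def]])
  have "((\<lambda>t. tau (ctransp (cayley (fst A) t)) (m t)) has_derivative
      (\<lambda>t. (ctransp (t *\<^sub>R fst A) ** fst (m 0) + fst (m 0) ** ctransp (ctransp (t *\<^sub>R fst A)),
        der (ctransp (ctransp (t *\<^sub>R fst A))) (snd (m 0))) + t *\<^sub>R M)) (at 0)"
    by (rule has_derivative_tau_at_one[OF ct m[unfolded has_vector_derivative_def]]) (simp add: cayley_0)
  moreover have "(\<lambda>t. (ctransp (t *\<^sub>R fst A) ** fst (m 0) + fst (m 0) ** ctransp (ctransp (t *\<^sub>R fst A)),
        der (ctransp (ctransp (t *\<^sub>R fst A))) (snd (m 0))) + t *\<^sub>R M) = (\<lambda>t. t *\<^sub>R (M - ad2 (fst A) (m 0)))"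
    by (simp add: linear_scale[OF linear_ctransp] linear_neg[OF linear_ctransp] As matrix_mult_scaleR matrix_mult_minus der_scaleR_left
        ad2_def prod_eq_iff fun_eq_iff algebra_simps)
  ultimately have n: "((\<lambda>t. tau (ctransp (cayley (fst A) t)) (m t)) has_vector_derivative M - ad2 (fst A) (m 0)) (at 0)"
    by (simp add: has_vector_derivative_def)
  have "\<forall>\<^sub>F t in nhds 0. tau (ctransp (cayley (fst A) t)) (m t) \<in> T01_base"
    using evT evr
  proof eventually_elim
    case (elim t)
    have cG: "cayley_G A t \<in> carrier Grp"
      using A elim(2) by (auto simp: cayley_G_def g_real_def cayley_SU2 V_real_scale)
    have ceq: "c t = E_act (g \<otimes>\<^bsub>Grp\<^esub> cayley_G A t) base"
      unfolding c_def by (simp only: E_act_mult[OF g(1) cG])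
    have fg: "fst (g \<otimes>\<^bsub>Grp\<^esub> cayley_G A t) = fst g ** cayley (fst A) t"
      by (simp add: G_real_mult S cayley_G_def)
    have "W (c t) \<in> E_T01 (E_act (g \<otimes>\<^bsub>Grp\<^esub> cayley_G A t) base)" using elim(1) ceq by simp
    moreover from this have "W (c t) \<in> g_real \<times> g_real" using E_T01_g_real by blast
    ultimately have "tau (ctransp (fst g ** cayley (fst A) t)) (recombine (W (c t))) \<in> T01_base"
      using recombine_E_T01_iff[OF mult_closed[OF g(1) cG]] fg by metis
    then show ?case by (simp add: m_def tau_tau ctransp_mult)
  qed
  from tangent_in_subspace[OF real_subspace_T01_base n this]
  show "tau (ctransp (fst g)) (recombine (D (tau (fst g) (inf_act A)))) -
       ad2 (fst A) (tau (ctransp (fst g)) (recombine (W (E_act g base)))) \<in> T01_base"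
    by (simp add: M_def m_def c'(1))
qed

text \<open>Complexifying, \<open>A\<close> becomes an element of \<open>borel_b\<close>, which preserves \<open>T01_base\<close>:
  the derivative of one section along another is again of type \<open>(0,1)\<close>.\<close>

lemma section_derivative:
  assumes W: "smooth_on U W" "\<And>y. y \<in> U \<inter> Esp \<Longrightarrow> W y \<in> E_T01 y"
    and y: "y \<in> U" and \<zeta>: "\<zeta> \<in> (E_T01 y :: ('n lalg \<times> 'n lalg) set)"
  shows "complex_dderiv W y \<zeta> \<in> E_T01 y"
proof -
  obtain g X Y where g: "g \<in> carrier Grp" "E_act g base = y" and XY: "X \<in> g_real" "Y \<in> g_real"
    "X + lscale \<i> Y \<in> q_prime" and \<zeta>': "\<zeta> = (tau (fst g) (inf_act X), tau (fst g) (inf_act Y))"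
    using \<zeta> unfolding E_T01_raw by blast
  define D where "D = frechet_derivative W (at y)"
  define m where "m = tau (ctransp (fst g)) (recombine (W y))"
  have gU: "E_act g base \<in> U" using y g(2) by simp
  have yE: "y \<in> Esp" using g unfolding E_space_def by blast
  have Wy: "W y \<in> E_T01 y" using W(2) y yE by blast
  then have m: "m \<in> T01_base"
    using recombine_E_T01_iff[OF g(1), of "W y"] E_T01_g_real g(2) unfolding m_def by blast
  note X = section_derivative_real[OF W g(1) gU XY(1), unfolded g(2), folded D_def m_def]
  note Y = section_derivative_real[OF W g(1) gU XY(2), unfolded g(2), folded D_def m_def]
  define p where "p = complex_dderiv W y \<zeta>"
  have p: "p = D (tau (fst g) (inf_act X)) + pscale \<i> (D (tau (fst g) (inf_act Y)))"
    by (simp add: p_def complex_dderiv_def \<zeta>' D_def)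
  have "p \<in> g_real \<times> g_real"
    unfolding p using X(1) Y(1)
    by (auto simp: pscale_def mem_Times_iff intro: subspace_add[OF subspace_g_real] subspace_diff[OF subspace_g_real])
  moreover have "tau (ctransp (fst g)) (recombine p) \<in> T01_base"
  proof -
    let ?t = "\<lambda>A. tau (ctransp (fst g)) (recombine (D (tau (fst g) (inf_act A))))"
    have "tau (ctransp (fst g)) (recombine p) = (?t X - ad2 (fst X) m) + lscale \<i> (?t Y - ad2 (fst Y) m)
        + ad2 (fst (X + lscale \<i> Y)) m"
      by (simp add: p recombine_add recombine_pscale tau_add tau_lscale ad2_add_left ad2_lscale_left
          lv.scale_right_diff_distrib)
    moreover have "ad2 (fst (X + lscale \<i> Y)) m \<in> T01_base"
      using XY(3) unfolding q_prime_def mem_Times_iff by (blast intro: ad2_borel_T01_base m)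
    ultimately show ?thesis
      using X(2) Y(2) by (simp add: lv.subspace_add[OF subspace_T01_base] lv.subspace_scale[OF subspace_T01_base])
  qed
  ultimately show ?thesis
    using recombine_E_T01_iff[OF g(1), of p] g(2) by (simp add: p_def)
qed

lemma cr_manifold_E:
  assumes q: "CARD('n) = 2 * q + 1"
  shows "cr_manifold (q + 1) 1 Esp E_T01"
  unfolding cr_manifold_def
proof (intro conjI ballI allI impI)
  have "2 * (q + 1) + 1 = 2 + CARD('n)" using q by simp
  then show "submanifold (2 * (q + 1) + 1) Esp" using submanifold_E_space by metis
  fix x :: "'n lalg" assume x: "x \<in> Esp"
  show "E_T01 x \<subseteq> tangent_space Esp x \<times> tangent_space Esp x" by (rule E_T01_tangent)
  show "pv.subspace (E_T01 x)" by (rule E_T01_subspace[OF x])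
  show "pv.dim (E_T01 x) = q + 1" by (rule E_T01_dim[OF x q])
  show "E_T01 x \<inter> pconj ` E_T01 x = {0}" by (rule E_T01_conj[OF x])
next
  fix x :: "'n lalg" and \<zeta> assume "x \<in> Esp" "\<zeta> \<in> E_T01 x"
  then show "\<exists>U Z. x \<in> U \<and> smooth_on U Z \<and> Z x = \<zeta> \<and> (\<forall>y\<in>U \<inter> Esp. Z y \<in> E_T01 y)"
    by (rule E_T01_extension)
next
  fix U and Z W :: "'n lalg \<Rightarrow> 'n lalg \<times> 'n lalg" and y
  assume *: "smooth_on U Z \<and> smooth_on U W \<and> (\<forall>y\<in>U \<inter> Esp. Z y \<in> E_T01 y \<and> W y \<in> E_T01 y)"
    and y: "y \<in> U \<inter> Esp"
  then show "vf_bracket Z W y \<in> E_T01 y"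
    unfolding vf_bracket_def
    by (intro pv.subspace_diff[OF E_T01_subspace] section_derivative[of U]) auto
qed

lemma E_T01_invariant:
  assumes g: "g \<in> carrier Grp" and x: "x \<in> Esp"
  shows "map_prod (mdiff Esp (E_act g) x) (mdiff Esp (E_act g) x) ` E_T01 x =
    (E_T01 (E_act g x) :: ('n lalg \<times> 'n lalg) set)"
proof -
  obtain h where h: "h \<in> carrier Grp" "x = E_act h base" "fst h \<in> SU2" using E_spaceE[OF x] by blast
  have S: "fst g \<in> SU2" using g by auto
  have "map_prod (mdiff Esp (E_act g) x) (mdiff Esp (E_act g) x) ` E_T01 x =
      map_prod (tau (fst g)) (tau (fst g)) ` E_T01 x"
    using E_T01_tangent[of x] by (intro image_cong refl) (auto simp: mdiff_E_act[OF g])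
  also have "map_prod (tau (fst g)) (tau (fst g)) (re_im Z) = re_im (tau (fst g) Z)" for Z :: "'n lalg"
    unfolding re_im_tau[OF SU2_quat[OF S]] by (simp add: re_im_def)
  then have "map_prod (tau (fst g)) (tau (fst g)) ` E_T01 x = (\<lambda>Z. re_im (tau (fst g ** fst h) Z)) ` T01_base"
    unfolding h(2) E_T01_image[OF h(1)] image_image tau_tau[symmetric] by simp
  also have "\<dots> = E_T01 (E_act (g \<otimes>\<^bsub>Grp\<^esub> h) base)"
    unfolding E_T01_image[OF mult_closed[OF g h(1)]] by (simp add: G_real_mult S)
  also have "\<dots> = E_T01 (E_act g x)" by (simp only: E_act_mult[OF g h(1)] h(2))
  finally show ?thesis .
qed

lemma homogeneous_cr_manifold_E:
  assumes q: "CARD('n) = 2 * q + 1"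
  shows "homogeneous_cr_manifold (q + 1) 1 Grp Esp E_act E_T01"
  unfolding homogeneous_cr_manifold_def
  using lie_group_G_real cr_manifold_E[OF q] transitive_E_act smooth_E_act E_T01_invariant by blast

lemma is_cr_algebra_at_E: "is_cr_algebra_at (g_real :: 'n lalg set) q_prime Grp E_act E_T01 base"
  unfolding is_cr_algebra_at_def
proof (intro conjI is_lie_algebra_of_G_real)
  have b: "E_act \<one>\<^bsub>Grp\<^esub> base = base" by (rule E_act_one)
  have *: "(orbit_diff Grp E_act base X, orbit_diff Grp E_act base Y) \<in> E_T01 base \<longleftrightarrow> X + lscale \<i> Y \<in> q_prime"
    if XY: "X \<in> g_real" "Y \<in> g_real" for X Y
  proof -
    have "\<one>\<^bsub>Grp\<^esub> \<in> carrier Grp" by simp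
    moreover have "(inf_act X, inf_act Y) \<in> g_real \<times> g_real" using XY by (simp add: inf_act_g_real)
    ultimately have "(inf_act X, inf_act Y) \<in> E_T01 base \<longleftrightarrow> inf_act (X + lscale \<i> Y) \<in> T01_base"
      using recombine_E_T01_iff[of "\<one>\<^bsub>Grp\<^esub>" "(inf_act X, inf_act Y)"] b
      by (simp add: recombine_def linear_inf_act)
    moreover have "X + lscale \<i> Y \<in> g_cplx" using XY recombine_g_cplx[of "(X, Y)"] by (simp add: recombine_def)
    ultimately show ?thesis using XY by (simp add: orbit_diff_E_base inf_act_mem_iff)
  qed
  show "q_prime = {X + lscale \<i> Y |X Y. X \<in> g_real \<and> Y \<in> g_real \<and>
      (orbit_diff Grp E_act base X, orbit_diff Grp E_act base Y) \<in> E_T01 base}"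
  proof (intro equalityI subsetI)
    fix Z :: "'n lalg" assume Z: "Z \<in> q_prime"
    then have Zg: "Z \<in> g_cplx" using q_prime_g_cplx by blast
    have "Z = re_part Z + lscale \<i> (im_part Z)" using recombine_re_im[of Z] by (simp add: recombine_def re_im_def)
    then show "Z \<in> {X + lscale \<i> Y |X Y. X \<in> g_real \<and> Y \<in> g_real \<and>
      (orbit_diff Grp E_act base X, orbit_diff Grp E_act base Y) \<in> E_T01 base}"
      using Z re_part_g_real[OF Zg] im_part_g_real[OF Zg] *[of "re_part Z" "im_part Z"] by (smt (verit) mem_Collect_eq)
  qed (use * in blast)
qed

end

section \<open>The CR algebra\<close>

lemma lbr_eq:
  assumes "Z \<in> g_cplx" "W \<in> g_cplx"
  shows "lbr Z W = (fst Z ** fst W - fst W ** fst Z, der (fst W) (snd Z) - der (fst Z) (snd W))"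
  using assms by (auto simp: lbr_def g_cplx_def alg_act_der)

lemma der_diff: "der B (a - b) = der B a - der B b"
  by (rule cf_eqI) (simp add: cf_der algebra_simps)

lemma sl2_commutator: "trace (A ** B - B ** (A :: complex^2^2)) = 0"
  by (simp add: trace_def sum_2 matrix_mult_2 algebra_simps)

lemma lbr_g_cplx:
  assumes "Z \<in> g_cplx" "W \<in> g_cplx"
  shows "lbr Z W \<in> g_cplx"
  unfolding lbr_eq[OF assms] by (simp add: g_cplx_def sl2_def sl2_commutator)

lemma lie_algebra_g_cplx: "lie_algebra lscale (g_cplx :: 'n::{finite,linorder} lalg set) lbr"
  unfolding lie_algebra_def
proof (intro conjI ballI allI)
  show "lv.subspace (g_cplx :: 'n lalg set)" by (rule subspace_g_cplx)
  note add = lv.subspace_add[OF subspace_g_cplx] and scale = lv.subspace_scale[OF subspace_g_cplx]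
  fix X Y :: "'n lalg" assume X: "X \<in> g_cplx" and Y: "Y \<in> g_cplx"
  show "lbr X Y \<in> g_cplx" by (rule lbr_g_cplx[OF X Y])
  show "lbr (lscale c X) Y = lscale c (lbr X Y)" "lbr X (lscale c Y) = lscale c (lbr X Y)" for c
    by (simp_all add: lbr_eq X Y scale lalg_eq_iff mat2_eq_iff matrix_mult_2 fst_lscale cf_der algebra_simps)
  fix Z :: "'n lalg" assume Z: "Z \<in> g_cplx"
  show "lbr (X + Y) Z = lbr X Z + lbr Y Z" "lbr Z (X + Y) = lbr Z X + lbr Z Y"
    by (simp_all add: lbr_eq X Y Z add lalg_eq_iff mat2_eq_iff matrix_mult_2 cf_der algebra_simps)
  have "fst (lbr X (lbr Y Z) + lbr Y (lbr Z X) + lbr Z (lbr X Y)) = 0"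
    by (simp add: lbr_def mat2_eq_iff matrix_mult_2 algebra_simps)
  moreover have "snd (lbr X (lbr Y Z) + lbr Y (lbr Z X) + lbr Z (lbr X Y)) = 0"
  proof -
    have "snd (lbr A (lbr B C)) = der (fst C) (der (fst B) (snd A)) - der (fst B) (der (fst C) (snd A))
        - der (fst A) (der (fst C) (snd B)) + der (fst A) (der (fst B) (snd C))"
      if "A \<in> g_cplx" "B \<in> g_cplx" "C \<in> g_cplx" for A B C :: "'n lalg"
      unfolding lbr_eq[OF that(1) lbr_g_cplx[OF that(2,3)]] unfolding lbr_eq[OF that(2,3)]
      by (simp add: der_diff der_commutator[symmetric])
    from this[OF X Y Z] this[OF Y Z X] this[OF Z X Y] show ?thesis by simp
  qed
  ultimately show "lbr X (lbr Y Z) + lbr Y (lbr Z X) + lbr Z (lbr X Y) = 0" by (simp add: prod_eq_iff)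
next
  fix X :: "'n lalg" assume "X \<in> g_cplx"
  then show "lbr X X = 0" by (simp add: lbr_eq prod_eq_iff)
qed

lemma subspace_q_prime: "lv.subspace q_prime"
  by (simp add: lv.subspace_def q_prime_def borel_b_def sl2_def trace_def sum_2 mem_Times_iff fst_lscale
      V_minus_iff add_eq_0_iff)

lemma q_prime_iff:
  "Z \<in> (q_prime :: 'n::{finite,linorder} lalg set) \<longleftrightarrow>
     Z \<in> g_cplx \<and> fst Z $1$2 = 0 \<and> (\<forall>h. 2 * h \<le> int CARD('n) - 1 \<longrightarrow> cf (snd Z) h = 0)"
  by (auto simp: q_prime_def borel_b_def g_cplx_def V_minus_iff)

lemma lie_subalgebra_q_prime: "lie_subalgebra lscale g_cplx lbr (q_prime :: 'n::{finite,linorder} lalg set)"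
  unfolding lie_subalgebra_def
proof (intro conjI ballI subspace_q_prime)
  show "q_prime \<subseteq> (g_cplx :: 'n lalg set)" by (auto simp: q_prime_iff)
  fix X Y :: "'n lalg" assume "X \<in> q_prime" "Y \<in> q_prime"
  then show "lbr X Y \<in> q_prime"
    by (simp add: q_prime_iff lbr_g_cplx) (simp add: lbr_eq matrix_mult_2 cf_der)
qed

text \<open>The generators that detect the filtration: monomials, indexed by the exponent of \<open>z\<close>, and \<open>E\<close>,
  which raises weights and hence lowers that exponent.\<close>

definition mono_elt :: "int \<Rightarrow> 'n::{finite,linorder} lalg" where
  "mono_elt h = (0, of_cf (\<lambda>j. if j = h then 1 else 0))"

definition raise_elt :: "'n::{finite,linorder} lalg" where
  "raise_elt = (vector [vector [0, 1], vector [0, 0]], 0)"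

lemma fst_mono_elt [simp]: "fst (mono_elt h) = 0"
  by (simp add: mono_elt_def)

lemma cf_mono_elt: "0 \<le> h \<Longrightarrow> h < int CARD('n) \<Longrightarrow>
    cf (snd (mono_elt h :: 'n::{finite,linorder} lalg)) j = (if j = h then 1 else 0)"
  by (auto simp: mono_elt_def cf_of_cf)

lemma raise_elt_simps [simp]: "fst raise_elt $1$1 = 0" "fst raise_elt $1$2 = 1" "fst raise_elt $2$1 = 0"
  "fst raise_elt $2$2 = 0" "snd raise_elt = 0"
  by (simp_all add: raise_elt_def)

lemma mono_elt_g_cplx [simp]: "mono_elt h \<in> g_cplx"
  by (simp add: mono_elt_def g_cplx_def sl2_def trace_def)

lemma raise_elt_g_cplx [simp]: "raise_elt \<in> g_cplx"
  by (simp add: raise_elt_def g_cplx_def sl2_def trace_def sum_2)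

lemma g_cplxI: "fst Z $1$1 + fst Z $2$2 = 0 \<Longrightarrow> Z \<in> g_cplx"
  by (simp add: g_cplx_def sl2_def trace_def sum_2 mem_Times_iff)

text \<open>The filtration in closed form: \<open>F\<close> is removed at the first step, and then one monomial
  at each step, starting from the one next to the middle.\<close>

definition levi_space :: "nat \<Rightarrow> nat \<Rightarrow> 'n::{finite,linorder} lalg set" where
  "levi_space q p = {Z \<in> g_cplx. fst Z $1$2 = 0 \<and> (p > 0 \<longrightarrow> fst Z $2$1 = 0) \<and>
     (\<forall>h. h \<le> int (q + p) \<longrightarrow> cf (snd Z) h = 0)}"

definition opp_space :: "nat \<Rightarrow> 'n::{finite,linorder} lalg set" where
  "opp_space q = {Z \<in> g_cplx. fst Z $2$1 = 0 \<and> (\<forall>h. int q \<le> h \<longrightarrow> cf (snd Z) h = 0)}"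

text \<open>The part of \<open>Z\<close> on \<open>E\<close> and on the exponents below \<open>q\<close> belongs to the second space, the rest to
  the first.\<close>

lemma levi_opp_sum:
  "{X + Y | X Y. X \<in> levi_space q p \<and> Y \<in> opp_space q} = {Z \<in> (g_cplx :: 'n::{finite,linorder} lalg set).
     (p > 0 \<longrightarrow> fst Z $2$1 = 0) \<and> (\<forall>h. int q \<le> h \<and> h \<le> int (q + p) \<longrightarrow> cf (snd Z) h = 0)}"
proof (intro equalityI subsetI)
  fix Z :: "'n lalg" assume "Z \<in> {X + Y | X Y. X \<in> levi_space q p \<and> Y \<in> opp_space q}"
  then obtain X Y where XY: "X \<in> levi_space q p" "Y \<in> opp_space q" "Z = X + Y" by blast
  then have "Z \<in> g_cplx" by (auto simp: levi_space_def opp_space_def intro: lv.subspace_add[OF subspace_g_cplx])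
  then show "Z \<in> {Z \<in> g_cplx. (p > 0 \<longrightarrow> fst Z $2$1 = 0) \<and> (\<forall>h. int q \<le> h \<and> h \<le> int (q + p) \<longrightarrow> cf (snd Z) h = 0)}"
    using XY by (auto simp: levi_space_def opp_space_def simp del: of_nat_add)
next
  fix Z :: "'n lalg" assume "Z \<in> {Z \<in> g_cplx. (p > 0 \<longrightarrow> fst Z $2$1 = 0) \<and> (\<forall>h. int q \<le> h \<and> h \<le> int (q + p) \<longrightarrow> cf (snd Z) h = 0)}"
  then have Z: "Z \<in> g_cplx" "p > 0 \<Longrightarrow> fst Z $2$1 = 0" "\<And>h. int q \<le> h \<Longrightarrow> h \<le> int (q + p) \<Longrightarrow> cf (snd Z) h = 0"
    by auto
  define Y :: "'n lalg" where "Y = ((\<chi> i j. if i = 1 \<and> j = 2 then fst Z $1$2 else 0),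
     of_cf (\<lambda>h. if h < int q then cf (snd Z) h else 0))"
  have Y1: "fst Y $1$1 = 0" "fst Y $1$2 = fst Z $1$2" "fst Y $2$1 = 0" "fst Y $2$2 = 0"
    by (simp_all add: Y_def)
  have Y2: "cf (snd Y) h = (if h < int q then cf (snd Z) h else 0)" for h
    by (auto simp: Y_def cf_of_cf cf_outside)
  have Yg: "Y \<in> g_cplx" by (rule g_cplxI) (simp add: Y1)
  then have "Y \<in> opp_space q" by (simp add: opp_space_def Y1 Y2)
  moreover have "Z - Y \<in> levi_space q p"
    using Z by (auto simp: levi_space_def Y1 Y2 lv.subspace_diff[OF subspace_g_cplx _ Yg] simp del: of_nat_add)
  ultimately show "Z \<in> {X + Y | X Y. X \<in> levi_space q p \<and> Y \<in> opp_space q}"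
    by (intro CollectI exI[of _ "Z - Y"] exI[of _ Y]) simp
qed

text \<open>Necessity of the new conditions is tested on two elements of the conjugate algebra: \<open>E\<close>, and for
  the first step the monomial with exponent \<open>q - 1\<close>, which \<open>F\<close> would move to the middle.\<close>

lemma levi_space_step:
  assumes q: "q > 0" "CARD('n::{finite,linorder}) = 2 * q + 1" and p: "p < q"
  shows "{Z \<in> levi_space q p. \<forall>W\<in>opp_space q. lbr Z W \<in> {X + Y | X Y. X \<in> levi_space q p \<and> Y \<in> opp_space q}}
    = (levi_space q (Suc p) :: 'n lalg set)"
  unfolding levi_opp_sum
proof (intro equalityI subsetI)
  fix Z :: "'n lalg"
  assume "Z \<in> {Z \<in> levi_space q p. \<forall>W\<in>opp_space q. lbr Z W \<in> {Z \<in> g_cplx.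
     (p > 0 \<longrightarrow> fst Z $2$1 = 0) \<and> (\<forall>h. int q \<le> h \<and> h \<le> int (q + p) \<longrightarrow> cf (snd Z) h = 0)}}"
  then have Z: "Z \<in> levi_space q p" and br: "\<And>W h. W \<in> opp_space q \<Longrightarrow> int q \<le> h \<Longrightarrow> h \<le> int (q + p) \<Longrightarrow>
      cf (snd (lbr Z W)) h = 0" by auto
  have Zg: "Z \<in> g_cplx" using Z by (simp add: levi_space_def)
  \<comment> \<open>bracket with the raising operator, at the highest exponent that is required to vanish\<close>
  have "raise_elt \<in> opp_space q" by (simp add: opp_space_def)
  from br[OF this, of "int (q + p)"] have "of_int (int (q + p) + 1) * cf (snd Z) (int (q + p) + 1) = 0"
    by (simp add: lbr_eq[OF Zg] cf_der del: of_nat_add of_int_add)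
  moreover have "(of_int (int (q + p) + 1) :: complex) \<noteq> 0" by (simp only: of_int_eq_0_iff)
  ultimately have top: "cf (snd Z) (int (q + p) + 1) = 0" by simp
  have F: "fst Z $2$1 = 0"
  proof (cases "p > 0")
    case True
    then show ?thesis using Z by (simp add: levi_space_def)
  next
    case False
    \<comment> \<open>bracket with the monomial next to the middle on the other side\<close>
    have cm: "cf (snd (mono_elt (int q - 1) :: 'n lalg)) j = (if j = int q - 1 then 1 else 0)" for j
      using q by (intro cf_mono_elt) auto
    have "mono_elt (int q - 1) \<in> (opp_space q :: 'n lalg set)" by (simp add: opp_space_def cm)
    moreover have "complex_of_nat q + 1 \<noteq> 0" using of_nat_neq_0[of q] by (simp add: add.commute)
    ultimately show ?thesis
      using br[of "mono_elt (int q - 1)" "int q"] q by (simp add: lbr_eq[OF Zg] cf_der cm False)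
  qed
  show "Z \<in> levi_space q (Suc p)"
    unfolding levi_space_def
  proof (intro CollectI conjI allI impI Zg F)
    show "fst Z $1$2 = 0" using Z by (simp add: levi_space_def)
    fix h assume "h \<le> int (q + Suc p)"
    then have "h \<le> int (q + p) \<or> h = int (q + p) + 1" by linarith
    then show "cf (snd Z) h = 0" using top Z by (auto simp: levi_space_def)
  qed
next
  fix Z :: "'n lalg" assume Z: "Z \<in> levi_space q (Suc p)"
  then have Zg: "Z \<in> g_cplx" and Z1: "fst Z $1$2 = 0" "fst Z $2$1 = 0"
    and Z2: "\<And>h. h \<le> int (q + p) + 1 \<Longrightarrow> cf (snd Z) h = 0" by (auto simp: levi_space_def)
  have "Z \<in> levi_space q p" using Zg Z1 Z2 by (simp add: levi_space_def)
  moreover have "lbr Z W \<in> {Z \<in> g_cplx.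
     (p > 0 \<longrightarrow> fst Z $2$1 = 0) \<and> (\<forall>h. int q \<le> h \<and> h \<le> int (q + p) \<longrightarrow> cf (snd Z) h = 0)}"
    if W: "W \<in> opp_space q" for W
  proof -
    have Wg: "W \<in> g_cplx" and W1: "fst W $2$1 = 0" and W2: "\<And>h. int q \<le> h \<Longrightarrow> cf (snd W) h = 0"
      using W by (auto simp: opp_space_def)
    have "fst (lbr Z W) $2$1 = 0" by (simp add: lbr_eq[OF Zg Wg] matrix_mult_2 Z1 W1)
    moreover have "cf (snd (lbr Z W)) h = 0" if "int q \<le> h" "h \<le> int (q + p)" for h
      using that by (simp add: lbr_eq[OF Zg Wg] cf_der Z1 Z2 W2)
    ultimately show ?thesis using lbr_g_cplx[OF Zg Wg] by blast
  qed
  ultimately show "Z \<in> {Z \<in> levi_space q p. \<forall>W\<in>opp_space q. lbr Z W \<in> {Z \<in> g_cplx.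
     (p > 0 \<longrightarrow> fst Z $2$1 = 0) \<and> (\<forall>h. int q \<le> h \<and> h \<le> int (q + p) \<longrightarrow> cf (snd Z) h = 0)}}"
    by blast
qed

context even_degree
begin

lemma der_V_real:
  assumes X: "X \<in> su2" and a: "a \<in> (V_real :: 'n form set)"
  shows "der X a \<in> V_real"
proof -
  have q: "X$2$1 = - cnj (X$1$2)" "X$2$2 = - X$1$1" "cnj (X$1$1) = - X$1$1"
    using X by (auto simp: su2_iff complex_eq_iff)
  have th: "theta a = a" using a by (simp add: V_real_def)
  have k: "int (CARD('n) - 1) = int CARD('n) - 1" using card_Suc[where 'n='n] by linarith
  define k where "k = int CARD('n) - 1"
  have "theta (der X a) = der X (theta a)"
  proof (rule cf_eqI)
    fix h
    have e: "k - h + 1 = k - (h - 1)" "k - h - 1 = k - (h + 1)" by simp_all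
    show "cf (theta (der X a)) h = cf (der X (theta a)) h"
      unfolding theta_eq(2)[OF odd_card] cf_der k k_def[symmetric] e
      by (simp add: q algebra_simps)
  qed
  then show ?thesis by (simp add: V_real_def th)
qed

lemma lbr_g_real:
  assumes "X \<in> (g_real :: 'n lalg set)" "Y \<in> g_real"
  shows "lbr X Y \<in> g_real"
proof -
  have g: "X \<in> g_cplx" "Y \<in> g_cplx" using assms by (auto simp: g_real_iff)
  have s: "fst X \<in> su2" "fst Y \<in> su2" "snd X \<in> V_real" "snd Y \<in> V_real" using assms by (auto simp: g_real_def)
  have "fst X ** fst Y - fst Y ** fst X \<in> su2"
    using s(1,2) by (auto simp: su2_iff matrix_mult_2 complex_eq_iff algebra_simps)
  then show ?thesis
    unfolding lbr_eq[OF g] g_real_def using s by (simp add: V_real_diff der_V_real)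
qed

lemma lie_algebra_g_real: "lie_algebra (*\<^sub>R) (g_real :: 'n lalg set) lbr"
proof -
  have sub: "X \<in> g_cplx" if "X \<in> g_real" for X :: "'n lalg" using that by (simp add: g_real_iff)
  have c: "lie_algebra lscale (g_cplx :: 'n lalg set) lbr" by (rule lie_algebra_g_cplx)
  have "module.subspace (*\<^sub>R) (g_real :: 'n lalg set)" using subspace_g_real by (simp add: subspace_raw_def)
  then show ?thesis
    using c unfolding lie_algebra_def scaleR_lscale by (simp add: sub lbr_g_real)
qed

lemma rconj_recombine:
  "X \<in> g_real \<Longrightarrow> Y \<in> (g_real :: 'n lalg set) \<Longrightarrow> rconj (X + lscale \<i> Y) = X - lscale \<i> Y"
  by (simp add: rconj_add rconj_lscale g_real_iff)

lemma is_complexification_g: "is_complexification (g_real :: 'n lalg set) g_cplx"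
  unfolding is_complexification_def
proof (intro conjI ballI lie_algebra_g_real lie_algebra_g_cplx)
  show "g_real \<subseteq> (g_cplx :: 'n lalg set)" by (auto simp: g_real_iff)
  fix Z :: "'n lalg" assume Z: "Z \<in> g_cplx"
  show "\<exists>!p. p \<in> g_real \<times> g_real \<and> Z = fst p + lscale \<i> (snd p)"
  proof (rule ex1I[of _ "re_im Z"])
    show "re_im Z \<in> g_real \<times> g_real \<and> Z = fst (re_im Z) + lscale \<i> (snd (re_im Z))"
      using re_part_g_real[OF Z] im_part_g_real[OF Z] recombine_re_im[of Z]
      by (simp add: re_im_def recombine_def)
    fix p assume "p \<in> g_real \<times> g_real \<and> Z = fst p + lscale \<i> (snd p)"
    then show "p = re_im Z" using re_im_recombine[of p] by (simp add: recombine_def)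
  qed
qed

lemma conj_wrt_g_real:
  assumes Z: "Z \<in> (g_cplx :: 'n lalg set)"
  shows "conj_wrt g_real Z = rconj Z"
  unfolding conj_wrt_def
proof (rule the_equality)
  have "Z = re_part Z + lscale \<i> (im_part Z)" using recombine_re_im[of Z] by (simp add: recombine_def re_im_def)
  then show "\<exists>X\<in>g_real. \<exists>Y\<in>g_real. Z = X + lscale \<i> Y \<and> rconj Z = X - lscale \<i> Y"
    using re_part_g_real[OF Z] im_part_g_real[OF Z] rconj_recombine by metis
  fix W assume "\<exists>X\<in>g_real. \<exists>Y\<in>g_real. Z = X + lscale \<i> Y \<and> W = X - lscale \<i> Y"
  then obtain X Y where "X \<in> g_real" "Y \<in> g_real" "Z = X + lscale \<i> Y" "W = X - lscale \<i> Y" by blast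
  then show "W = rconj Z" by (simp add: rconj_recombine)
qed

lemma q_prime_levi: "CARD('n) = 2 * q + 1 \<Longrightarrow> (q_prime :: 'n lalg set) = levi_space q 0"
  by (auto simp: q_prime_iff levi_space_def)

text \<open>Conjugation reflects the exponents in the middle and exchanges the two triangular parts.\<close>

lemma conj_q_prime:
  assumes q: "CARD('n) = 2 * q + 1"
  shows "conj_wrt g_real ` (q_prime :: 'n lalg set) = opp_space q"
proof -
  have "conj_wrt g_real ` (q_prime :: 'n lalg set) = rconj ` q_prime"
    using q_prime_g_cplx by (intro image_cong refl conj_wrt_g_real) auto
  also have "\<dots> = {Z. rconj Z \<in> q_prime}"
  proof safe
    show "Z \<in> rconj ` q_prime" if "rconj Z \<in> q_prime" for Z :: "'n lalg"
      using that by (intro image_eqI[of _ rconj "rconj Z"]) simp_all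
  qed simp
  also have "\<dots> = opp_space q"
  proof (intro equalityI subsetI)
    fix Z :: "'n lalg" assume "Z \<in> {Z. rconj Z \<in> q_prime}"
    then have c: "rconj Z \<in> g_cplx" "fst (rconj Z) $1$2 = 0"
      and h: "\<And>h. 2 * h \<le> int CARD('n) - 1 \<Longrightarrow> cf (snd (rconj Z)) h = 0" by (auto simp: q_prime_iff)
    have "Z \<in> g_cplx" using rconj_g_cplx[OF c(1)] by simp
    moreover have "cf (snd Z) h = 0" if "int q \<le> h" for h
      using h[of "2 * int q - h"] that q by (auto simp: rconj_def theta_eq[OF odd_card] split: if_splits)
    ultimately show "Z \<in> opp_space q" using c(2) by (simp add: opp_space_def rconj_def)
  next
    fix Z :: "'n lalg" assume "Z \<in> opp_space q"
    then show "Z \<in> {Z. rconj Z \<in> q_prime}"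
      using q by (simp add: q_prime_iff opp_space_def rconj_g_cplx) (simp add: rconj_def theta_eq[OF odd_card])
  qed
  finally show ?thesis .
qed

lemma cr_algebra_q_prime: "cr_algebra (g_real :: 'n lalg set) g_cplx q_prime"
  unfolding cr_algebra_def
proof (intro conjI is_complexification_g lie_subalgebra_q_prime)
  have "UNIV \<subseteq> span (Basis \<union> (g_real \<inter> q_prime) :: 'n lalg set)"
    using span_mono[of Basis "Basis \<union> (g_real \<inter> q_prime) :: 'n lalg set"] by simp
  then show "\<exists>F. finite F \<and> g_real \<subseteq> span (F \<union> (g_real \<inter> q_prime) :: 'n lalg set)"
    by (intro exI[of _ Basis]) auto
qed

context
  fixes q :: nat
  assumes q: "q > 0" "CARD('n) = 2 * q + 1"
begin

lemma levi_filt_eq: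
  "p \<le> q \<Longrightarrow> levi_filt (g_real :: 'n lalg set) q_prime p = levi_space q p"
proof (induction p)
  case 0
  then show ?case using q_prime_levi[OF q(2)] by simp
next
  case (Suc p)
  then show ?case
    using levi_space_step[OF q, of p] by (simp add: conj_q_prime[OF q(2)])
qed

lemma levi_opp_Int: "levi_space q 0 \<inter> opp_space q = (levi_space q q :: 'n lalg set)"
proof (intro equalityI subsetI)
  fix Z :: "'n lalg" assume Z: "Z \<in> levi_space q 0 \<inter> opp_space q"
  then have "cf (snd Z) h = 0" for h by (cases "h \<le> int q") (auto simp: levi_space_def opp_space_def)
  then show "Z \<in> levi_space q q" using Z by (auto simp: levi_space_def opp_space_def)
next
  fix Z :: "'n lalg" assume Z: "Z \<in> levi_space q q"
  have "cf (snd Z) h = 0" for h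
  proof (cases "h \<le> int (q + q)")
    case True
    then show ?thesis using Z by (simp add: levi_space_def)
  next
    case False
    then show ?thesis using q(2) by (intro cf_outside) linarith
  qed
  then show "Z \<in> levi_space q 0 \<inter> opp_space q" using Z q(1) by (auto simp: levi_space_def opp_space_def)
qed

lemma q_prime_Int_conj: "q_prime \<inter> conj_wrt g_real ` q_prime = (levi_space q q :: 'n lalg set)"
  unfolding conj_q_prime[OF q(2)] unfolding q_prime_levi[OF q(2)] by (rule levi_opp_Int)

lemma weakly_nondegenerate_q_prime:
  "weakly_nondegenerate_of_order q (g_real :: 'n lalg set) q_prime"
  unfolding weakly_nondegenerate_of_order_def
proof (intro conjI)
  show "1 \<le> q" using q(1) by simp
  have cm: "cf (snd (mono_elt (2 * int q) :: 'n lalg)) j = (if j = 2 * int q then 1 else 0)" for j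
    using q by (intro cf_mono_elt) auto
  have "mono_elt (2 * int q) \<in> (levi_space q (q - 1) :: 'n lalg set)"
    using q(1) by (simp add: levi_space_def cm)
  moreover have "mono_elt (2 * int q) \<notin> (levi_space q q :: 'n lalg set)"
    using cm[of "2 * int q"] by (auto simp: levi_space_def intro!: exI[of _ "2 * int q"])
  moreover have "levi_space q q \<subseteq> (levi_space q (q - 1) :: 'n lalg set)"
    using q(1) by (auto simp: levi_space_def)
  ultimately show "levi_filt (g_real :: 'n lalg set) q_prime q \<subset> levi_filt g_real q_prime (q - 1)"
    by (auto simp: levi_filt_eq)
  show "levi_filt (g_real :: 'n lalg set) q_prime q = q_prime \<inter> conj_wrt g_real ` q_prime"
    using q_prime_Int_conj by (simp add: levi_filt_eq)
qed

lemma sum_q_prime_conj: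
  "{X + Y | X Y. X \<in> q_prime \<and> Y \<in> conj_wrt (g_real :: 'n lalg set) ` q_prime} = {Z \<in> g_cplx. cf (snd Z) (int q) = 0}"
  unfolding conj_q_prime[OF q(2)] unfolding q_prime_levi[OF q(2)] levi_opp_sum by (auto intro: order_antisym)

lemma middle_index:
  obtains m :: 'n where "zexp m = q"
proof -
  obtain m :: 'n where "int q = int (zexp m)"
    using zexp_surj[of "int q", where 'n='n] q by auto
  then show ?thesis using that[of m] by simp
qed

lemma card_std_index: "card (std_index :: (nat + 'n) set) = 3 + CARD('n)"
  unfolding std_index_def
  by (subst card_Un_disjoint) (auto simp: card_image)

lemma cdim_g_cplx: "cdim (g_cplx :: 'n lalg set) = 3 + CARD('n)"
proof -
  have "(g_cplx :: 'n lalg set) = coord_space std_index" by (auto simp: coord_space_def)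
  then show ?thesis using cdim_coord_space[of "std_index :: (nat + 'n) set"] card_std_index by simp
qed

lemma cr_codim_q_prime: "cr_codim (g_real :: 'n lalg set) g_cplx q_prime = 1"
proof -
  obtain m :: 'n where m: "zexp m = q" by (rule middle_index)
  have mem: "(\<forall>k\<in>std_index - (std_index - {Inr m}). P k) \<longleftrightarrow> P (Inr m)" for P
    by (auto simp: std_index_def)
  have "{Z \<in> g_cplx. cf (snd Z) (int q) = 0} = (coord_space (std_index - {Inr m}) :: 'n lalg set)"
    unfolding coord_space_def mem by (simp add: coord_def flip: m)
  then have "cdim {Z \<in> (g_cplx :: 'n lalg set). cf (snd Z) (int q) = 0} = card (std_index - {Inr m :: nat + 'n})"
    by (simp add: cdim_coord_space)
  also have "\<dots> = 2 + CARD('n)"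
    using card_std_index by (subst card_Diff_singleton) (auto simp: std_index_def)
  finally show ?thesis
    unfolding cr_codim_def sum_q_prime_conj cdim_g_cplx by simp
qed

lemma cr_dim_q_prime: "cr_dim (g_real :: 'n lalg set) q_prime = q + 1"
proof -
  let ?I = "insert (Inl 0) (insert (Inl 2) (Inr ` high_index)) :: (nat + 'n) set"
  have mem: "(\<forall>k\<in>std_index - ?I. P k) \<longleftrightarrow> P (Inl 1) \<and> (\<forall>i. i \<notin> high_index \<longrightarrow> P (Inr i))" for P
    by (auto simp: std_index_def less_Suc_eq numeral_3_eq_3 numeral_2_eq_2)
  have "(q_prime :: 'n lalg set) = coord_space ?I"
    unfolding coord_space_def mem
    by (auto simp: q_prime_def borel_b_def coord_def g_cplx_def V_minus_def high_index_def)
  moreover have "?I \<subseteq> std_index" by (auto simp: std_index_def)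
  moreover have "card ?I = q + 2"
    by (simp add: card_insert_if image_iff card_image card_high_index[OF q(2)])
  ultimately have 1: "cdim (q_prime :: 'n lalg set) = q + 2" using cdim_coord_space by metis
  have mem': "(\<forall>k\<in>std_index - {Inl 0}. P k) \<longleftrightarrow> P (Inl 1) \<and> P (Inl 2) \<and> (\<forall>i. P (Inr i))"
    for P :: "nat + 'n \<Rightarrow> bool"
    by (auto simp: std_index_def less_Suc_eq numeral_3_eq_3 numeral_2_eq_2)
  have "(q_prime \<inter> conj_wrt g_real ` q_prime :: 'n lalg set) = {Z \<in> g_cplx. fst Z $1$2 = 0 \<and> fst Z $2$1 = 0 \<and> snd Z = 0}"
  proof -
    have "a = 0 \<longleftrightarrow> (\<forall>h. h \<le> int (q + q) \<longrightarrow> cf a h = 0)" for a :: "'n form"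
    proof
      assume a: "\<forall>h. h \<le> int (q + q) \<longrightarrow> cf a h = 0"
      show "a = 0"
      proof (rule cf_eqI)
        fix h show "cf a h = cf 0 h"
          using a q(2) cf_outside[of h a] by (cases "h \<le> int (q + q)") auto
      qed
    qed simp
    then show ?thesis
      unfolding q_prime_Int_conj using q(1)
      by (auto simp: levi_space_def)
  qed
  also have "\<dots> = (coord_space {Inl 0} :: 'n lalg set)"
    unfolding coord_space_def mem' by (auto simp: coord_def vec_eq_iff)
  finally have "cdim (q_prime \<inter> conj_wrt g_real ` q_prime :: 'n lalg set) = 1"
    using cdim_coord_space[of "{Inl 0} :: (nat + 'n) set"] by (simp add: std_index_def)
  then show ?thesis unfolding cr_dim_def using 1 by simp
qed

text \<open>The sum of \<open>q_prime\<close> and its conjugate misses only the middle monomial, which the raising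
  operator produces from its neighbour.\<close>

lemma fundamental_q_prime: "fundamental (g_real :: 'n lalg set) g_cplx q_prime"
  unfolding fundamental_def sum_q_prime_conj
proof (intro equalityI subsetI)
  fix Z :: "'n lalg"
  assume Z: "Z \<in> \<Inter> {S. lie_subalgebra lscale g_cplx lbr S \<and> {Z \<in> g_cplx. cf (snd Z) (int q) = 0} \<subseteq> S}"
  have "lie_subalgebra lscale g_cplx lbr (g_cplx :: 'n lalg set)"
    by (simp add: lie_subalgebra_def subspace_g_cplx lbr_g_cplx)
  then show "Z \<in> g_cplx" using Z by blast
next
  fix Z :: "'n lalg" assume Z: "Z \<in> g_cplx"
  have cm: "cf (snd (mono_elt (int q) :: 'n lalg)) j = (if j = int q then 1 else 0)"
    "cf (snd (mono_elt (int q + 1) :: 'n lalg)) j = (if j = int q + 1 then 1 else 0)" for j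
    using q by (intro cf_mono_elt; auto)+
  show "Z \<in> \<Inter> {S. lie_subalgebra lscale g_cplx lbr S \<and> {Z \<in> g_cplx. cf (snd Z) (int q) = 0} \<subseteq> S}"
  proof (intro InterI, elim CollectE conjE)
    fix S :: "'n lalg set"
    assume S: "lie_subalgebra lscale g_cplx lbr S" and sub: "{Z \<in> g_cplx. cf (snd Z) (int q) = 0} \<subseteq> S"
    have sS: "lv.subspace S" using S by (simp add: lie_subalgebra_def)
    have "raise_elt \<in> S" "mono_elt (int q + 1) \<in> S" using sub by (auto simp: cm)
    then have "lbr (mono_elt (int q + 1)) raise_elt \<in> S" using S by (simp add: lie_subalgebra_def)
    also have "lbr (mono_elt (int q + 1)) raise_elt = lscale (of_int (int q + 1)) (mono_elt (int q) :: 'n lalg)"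
      by (auto simp: lalg_eq_iff lbr_eq cf_der cm mat2_eq_iff matrix_mult_2 fst_lscale)
    finally have "lscale (inverse (of_int (int q + 1))) (lscale (of_int (int q + 1)) (mono_elt (int q) :: 'n lalg)) \<in> S"
      by (rule lv.subspace_scale[OF sS])
    moreover have "(of_int (int q + 1) :: complex) \<noteq> 0" by (simp only: of_int_eq_0_iff)
    ultimately have m: "mono_elt (int q) \<in> S" by simp
    let ?Z = "Z - lscale (cf (snd Z) (int q)) (mono_elt (int q))"
    have "?Z \<in> S"
      using sub Z by (auto simp: cm lv.subspace_diff[OF subspace_g_cplx] lv.subspace_scale[OF subspace_g_cplx])
    from lv.subspace_add[OF sS this lv.subspace_scale[OF sS m, of "cf (snd Z) (int q)"]]
    show "Z \<in> S" by simp
  qed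
qed

end

end

theorem proposition3p1:
  fixes q :: nat
  assumes "q > 0"
    and "CARD('n::{finite,linorder}) = 2 * q + 1"
  shows "cr_algebra (g_real :: 'n lalg set) g_cplx q_prime \<and>
    homogeneous_cr_manifold (q + 1) 1 (G_real :: 'n lalg monoid) E_space E_act E_T01 \<and>
    stabilizer (G_real :: 'n lalg monoid) (\<lambda>g. restrict (E_act g) E_space) E_base = torus \<and>
    is_cr_algebra_at (g_real :: 'n lalg set) q_prime G_real E_act E_T01 E_base \<and>
    cr_dim (g_real :: 'n lalg set) q_prime = q + 1 \<and>
    cr_codim (g_real :: 'n lalg set) g_cplx q_prime = 1 \<and>
    fundamental (g_real :: 'n lalg set) g_cplx q_prime \<and>
    weakly_nondegenerate_of_order q (g_real :: 'n lalg set) q_prime"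
proof -
  interpret even_degree "TYPE('n)"
    by unfold_locales (simp add: assms(2))
  show ?thesis
    using cr_algebra_q_prime homogeneous_cr_manifold_E[OF assms(2)] stabilizer_E_base is_cr_algebra_at_E
      cr_dim_q_prime[OF assms] cr_codim_q_prime[OF assms] fundamental_q_prime[OF assms]
      weakly_nondegenerate_q_prime[OF assms]
    by blast
qed

end
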